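(* Let $(T,A)$ be a locally constant integral uniform cocycle on $(\Delta,\mu)$, and let $\Theta\subset\mathbb{P}^{p-1}$ be adapted to $(T,A)$. Assume that for every line $J\in\mathcal{J}(\Theta)$, $J\cap E^{cs}(x)=\emptyset$ for $\mu$-almost every $x\in\Delta$. Then if $L$ is a line contained in $\mathbb{R}^p$ parallel to some element of $\Theta$, we have $L\cap W^s(x)\subset\mathbb{Z}^p$ for $\mu$-almost every $x\in\Delta$.
   Context: Cocycle: a pair $(T,A)$, $T:\Delta\to\Delta$, $A:\Delta\to\mathrm{GL}(p,\mathbb{R})$, with $A_n(x)=A(T^{n-1}(x))\cdots A(x)$. For $B\in\mathrm{GL}(p,\mathbb{R})$, $\|B\|_0=\max\{\|B\|,\|B^{-1}\|\}$. Uniform: $(\Delta,\mu)$ is a probability space, $\mu$ is $T$-invariant and ergodic, and $\int\ln\|A\|_0\,d\mu<\infty$. Integral: $A(x)\in\mathrm{GL}(p,\mathbb{Z})$ for a.e. $x$. Strongly expanding: there is a partition mod $0$ $\{\Delta^{(l)},l\in\mathbb{Z}\}$ of $\Delta$ into sets of positive measure such that $T$ maps each $\Delta^{(l)}$ onto $\Delta$, $T|\Delta^{(l)}$ is invertible and $(T|\Delta^{(l)})_*\mu$ is equivalent to $\mu|\Delta^{(l)}$; moreover, writing for a finite integer word $\underline l=(l_1,\dots,l_n)$, $\Delta^{\underline l}=\{x:T^{k-1}x\in\Delta^{(l_k)},1\le k\le n\}$, $T^{\underline l}=T^n|\Delta^{\underline l}$, $\mu^{\underline l}=\mu(\Delta^{\underline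 l})^{-1}T^{\underline l}_*\mu$, there is $K>0$ with $K^{-1}\le d\mu^{\underline l}/d\mu\le K$ for all words $\underline l$. Locally constant: $T$ is strongly expanding and $A$ is constant, equal to some $A^{(l)}$, on each $\Delta^{(l)}$. Central stable space: $E^{cs}(x)=\{w\in\mathbb{R}^p:\limsup_n\|A_n(x)w\|^{1/n}\le1\}$. Weak-stable space: $W^s(x)=\{w\in\mathbb{R}^p:\|A_n(x)w\|_{\mathbb{R}^p/\mathbb{Z}^p}\to0\}$, where $\|\cdot\|_{\mathbb{R}^p/\mathbb{Z}^p}$ is the Euclidean distance to $\mathbb{Z}^p$. A compact set $\Theta\subset\mathbb{P}^{p-1}$ is adapted to $(T,A)$ if $A^{(l)}\cdot\Theta\subset\Theta$ for all $l$ and, for $\mu$-a.e. $x$, every $w\in\mathbb{R}^p\setminus\{0\}$ whose projectivization lies in $\Theta$ satisfies $\|A(x)w\|\ge\|w\|$ and $\|A_n(x)w\|\to\infty$. $\mathcal{J}(\Theta)$ is the set of (affine) lines in $\mathbb{R}^p$ parallel to some element of $\Theta$ and not passing through $0$. *)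

theory Defs
  imports "HOL-Probability.Probability"
begin

fun cocycle :: "('a \<Rightarrow> 'a) \<Rightarrow> ('a \<Rightarrow> real^'p^'p) \<Rightarrow> nat \<Rightarrow> 'a \<Rightarrow> real^'p^'p" where
  "cocycle T A 0 x = mat 1"
| "cocycle T A (Suc n) x = A ((T ^^ n) x) ** cocycle T A n x"

definition mat_norm :: "real^'p^'p \<Rightarrow> real" where
  "mat_norm B = onorm (\<lambda>v. B *v v)"

definition mat_norm0 :: "real^'p^'p \<Rightarrow> real" where
  "mat_norm0 B = max (mat_norm B) (mat_norm (matrix_inv B))"

definition int_lattice :: "(real^'p) set" where
  "int_lattice = {v. \<forall>i. v $ i \<in> \<int>}"

definition int_matrix :: "real^'p^'p \<Rightarrow> bool" where
  "int_matrix B \<longleftrightarrow> (\<forall>i j. B $ i $ j \<in> \<int>)"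

definition GL_int :: "real^'p^'p \<Rightarrow> bool" where
  "GL_int B \<longleftrightarrow> invertible B \<and> int_matrix B \<and> int_matrix (matrix_inv B)"

definition invariant_measure :: "'a measure \<Rightarrow> ('a \<Rightarrow> 'a) \<Rightarrow> bool" where
  "invariant_measure M T \<longleftrightarrow> T \<in> measurable M M \<and> distr M M T = M"

definition ergodic :: "'a measure \<Rightarrow> ('a \<Rightarrow> 'a) \<Rightarrow> bool" where
  "ergodic M T \<longleftrightarrow>
     (\<forall>S \<in> sets M. T -` S \<inter> space M = S \<longrightarrow> measure M S = 0 \<or> measure M S = 1)"

definition uniform_cocycle :: "'a measure \<Rightarrow> ('a \<Rightarrow> 'a) \<Rightarrow> ('a \<Rightarrow> real^'p^'p) \<Rightarrow> bool" where
  "uniform_cocycle M T A \<longleftrightarrow>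
     prob_space M \<and> invariant_measure M T \<and> ergodic M T
     \<and> (\<forall>x \<in> space M. invertible (A x))
     \<and> integrable M (\<lambda>x. ln (mat_norm0 (A x)))"

definition integral_cocycle :: "'a measure \<Rightarrow> ('a \<Rightarrow> real^'p^'p) \<Rightarrow> bool" where
  "integral_cocycle M A \<longleftrightarrow> (AE x in M. GL_int (A x))"

definition word_cyl :: "'a measure \<Rightarrow> ('a \<Rightarrow> 'a) \<Rightarrow> (int \<Rightarrow> 'a set) \<Rightarrow> int list \<Rightarrow> 'a set" where
  "word_cyl M T D ls = {x \<in> space M. \<forall>k < length ls. (T ^^ k) x \<in> D (ls ! k)}"

text \<open>\<open>D\<close> is the partition mod 0 \<open>{\<Delta>^(l)}\<close>. The measure \<open>\<mu>^l = \<mu>(\<Delta>^l)^-1 (T^n)_* (\<mu>|\<Delta>^l)\<close>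
  has density between \<open>1/K\<close> and \<open>K\<close> w.r.t. \<open>\<mu>\<close>; this is stated on measurable sets.\<close>

definition strongly_expanding :: "'a measure \<Rightarrow> ('a \<Rightarrow> 'a) \<Rightarrow> (int \<Rightarrow> 'a set) \<Rightarrow> bool" where
  "strongly_expanding M T D \<longleftrightarrow>
     (\<forall>l. D l \<in> sets M \<and> measure M (D l) > 0)
     \<and> (\<forall>l k. l \<noteq> k \<longrightarrow> measure M (D l \<inter> D k) = 0)
     \<and> (AE x in M. \<exists>l. x \<in> D l)
     \<and> (\<forall>l. T ` D l = space M)
     \<and> (\<forall>l. inj_on T (D l))
     \<and> (\<forall>l. \<forall>C \<in> sets M. emeasure M (T -` C \<inter> D l) = 0 \<longleftrightarrow> emeasure M C = 0)
     \<and> (\<exists>K > 0. \<forall>ls :: int list. \<forall>C \<in> sets M.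
          measure M C / K
            \<le> measure M (word_cyl M T D ls \<inter> (T ^^ length ls) -` C) / measure M (word_cyl M T D ls)
          \<and> measure M (word_cyl M T D ls \<inter> (T ^^ length ls) -` C) / measure M (word_cyl M T D ls)
            \<le> K * measure M C)"

definition locally_constant ::
  "'a measure \<Rightarrow> ('a \<Rightarrow> 'a) \<Rightarrow> ('a \<Rightarrow> real^'p^'p) \<Rightarrow> (int \<Rightarrow> 'a set) \<Rightarrow> (int \<Rightarrow> real^'p^'p) \<Rightarrow> bool" where
  "locally_constant M T A D Al \<longleftrightarrow>
     strongly_expanding M T D \<and> (\<forall>l. \<forall>x \<in> D l \<inter> space M. A x = Al l)"

definition central_stable :: "('a \<Rightarrow> 'a) \<Rightarrow> ('a \<Rightarrow> real^'p^'p) \<Rightarrow> 'a \<Rightarrow> (real^'p) set" where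
  "central_stable T A x =
     {w. limsup (\<lambda>n. ereal (norm (cocycle T A n x *v w) powr (1 / real n))) \<le> 1}"

definition weak_stable :: "('a \<Rightarrow> 'a) \<Rightarrow> ('a \<Rightarrow> real^'p^'p) \<Rightarrow> 'a \<Rightarrow> (real^'p) set" where
  "weak_stable T A x =
     {w. (\<lambda>n. infdist (cocycle T A n x *v w) int_lattice) \<longlonglongrightarrow> 0}"

text \<open>A subset \<open>\<Theta>\<close> of P^(p-1) is represented by its cone \<open>Th\<close> in R^p minus 0: the set of
  nonzero vectors whose projectivization lies in \<open>\<Theta>\<close>. \<open>\<Theta>\<close> is compact iff
  \<open>Th \<inter> unit sphere\<close> is compact.\<close>

definition proj_cone :: "(real^'p) set \<Rightarrow> bool" where
  "proj_cone Th \<longleftrightarrow> 0 \<notin> Th \<and> (\<forall>w \<in> Th. \<forall>c. c \<noteq> 0 \<longrightarrow> c *\<^sub>R w \<in> Th)"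

definition compact_proj :: "(real^'p) set \<Rightarrow> bool" where
  "compact_proj Th \<longleftrightarrow> proj_cone Th \<and> compact (Th \<inter> sphere 0 1)"

definition adapted ::
  "'a measure \<Rightarrow> ('a \<Rightarrow> 'a) \<Rightarrow> ('a \<Rightarrow> real^'p^'p) \<Rightarrow> (int \<Rightarrow> real^'p^'p) \<Rightarrow> (real^'p) set \<Rightarrow> bool" where
  "adapted M T A Al Th \<longleftrightarrow>
     compact_proj Th
     \<and> (\<forall>l. \<forall>w \<in> Th. Al l *v w \<in> Th)
     \<and> (AE x in M. \<forall>w \<in> Th. norm (A x *v w) \<ge> norm w
                     \<and> filterlim (\<lambda>n. norm (cocycle T A n x *v w)) at_top sequentially)"

definition aff_line :: "real^'p \<Rightarrow> real^'p \<Rightarrow> (real^'p) set" where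
  "aff_line a w = {a + t *\<^sub>R w | t. True}"

definition lines_parallel :: "(real^'p) set \<Rightarrow> (real^'p) set set" where
  "lines_parallel Th = {aff_line a w | a w. w \<in> Th}"

definition J_lines :: "(real^'p) set \<Rightarrow> (real^'p) set set" where
  "J_lines Th = {L \<in> lines_parallel Th. 0 \<notin> L}"

end

theory Submission
  imports Defs
begin

text \<open>
  A line \<open>J\<close> parallel to \<open>\<Theta>\<close> near \<open>0\<close> is followed under the cocycle modulo \<open>\<int>\<^sup>p\<close>: after each block of
  \<open>N\<close> steps it is replaced by its image and by the integer translates of that image (its children)
  that come close to \<open>0\<close> again. The distance \<open>\<parallel>J\<parallel>\<close> to \<open>0\<close> of the image increases: if it grew
  subexponentially, expansion along \<open>\<Theta>\<close> would single out a point of \<open>J\<close> in the central stable space.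
  Since the spaces of vectors of growth at most \<open>e\<^sup>b\<^sup>n\<close> have almost surely constant dimension,
  there is a uniform rate of growth, and compactness and bounded distortion turn it into a contraction
  in the mean of \<open>\<parallel>J\<parallel>\<^sup>-\<^sup>\<alpha>\<close>, uniformly in \<open>J\<close> and in the conditional measures \<open>\<mu>\<^sup>u\<close>. Further
  children only arise from blocks of large norm, and their distance to \<open>0\<close> is at least a multiple of
  the inverse norm. As only the logarithm of the norm is integrable, blocks of large norm are damped by
  weights; the total damping along an orbit is beaten by the contraction infinitely often, hence almost
  every orbit of \<open>J\<close> leaves the neighbourhood of the lattice.

  For \<open>w \<in> L \<inter> W\<^sup>s(x)\<close> this forces the countably many possible translates of \<open>A\<^sub>n(x)L\<close> near \<open>0\<close> to pass
  through \<open>0\<close>, so that \<open>w\<close> is a limit of integer points of \<open>L\<close>.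
\<close>

section \<open>Lines and the integer lattice\<close>

text \<open>Only the logarithm of the norm is integrable, while the number of children of a block of
  norm M is only bounded by a multiple of M^p, so its mean need not be finite. Hence two damping
  factors: \<open>damp \<alpha> R\<close> tames the ratio of distances for the image of the line,
  \<open>damp \<beta> R'\<close> outweighs the number and size of the other children. The rate of
  contraction of the image is known before any threshold is fixed, which permits a choice without
  circularity in the order N and s, R, \<alpha>, \<epsilon>, \<beta>, R', \<delta>. Per block the
  damped mass decays by \<alpha> s / 4 in the exponent, while the damping costs less than \<alpha> s
  / 8 on average. The line reached after a block depends on the letters already read. All mean
  bounds are therefore proved for every cylinder and every line at once, so that they can be
  iterated; bounded distortion reduces them to bounds for \<mu>. Uniformity in the line comes from
  compactness, because only ratios of distances occur and these do not change under
  homothety.\<close>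

lemma mat_norm_bound: "norm ((B::real^'p^'p) *v v) \<le> mat_norm B * norm v"
  unfolding mat_norm_def by (rule onorm[OF matrix_vector_mul_bounded_linear])

lemma mat_norm_nonneg: "0 \<le> mat_norm (B::real^'p^'p)"
  unfolding mat_norm_def by (rule onorm_pos_le[OF matrix_vector_mul_bounded_linear])

lemma matrix_inv_cancel:
  assumes "invertible (B::real^'p^'p)"
  shows "matrix_inv B ** B = mat 1" "B ** matrix_inv B = mat 1"
  using assms matrix_inv_def[of B] someI_ex[of "\<lambda>A'. B ** A' = mat 1 \<and> A' ** B = mat 1"]
  unfolding invertible_def by auto

lemma matrix_inv_unique:
  fixes X Y :: "real^'p^'p"
  assumes "X ** Y = mat 1" "Y ** X = mat 1"
  shows "matrix_inv X = Y"
proof -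
  have "invertible X" using assms by (auto simp: invertible_def)
  then have "matrix_inv X ** X = mat 1" by (rule matrix_inv_cancel)
  then have "matrix_inv X = matrix_inv X ** (X ** Y)" using assms by simp
  also have "\<dots> = Y" using \<open>matrix_inv X ** X = mat 1\<close> by (simp add: matrix_mul_assoc)
  finally show ?thesis .
qed

lemma matrix_inv_mult:
  fixes X Y :: "real^'p^'p"
  assumes "invertible X" "invertible Y"
  shows "matrix_inv (X ** Y) = matrix_inv Y ** matrix_inv X"
proof (rule matrix_inv_unique)
  have "X ** Y ** (matrix_inv Y ** matrix_inv X) = X ** (Y ** matrix_inv Y) ** matrix_inv X"
    by (simp add: matrix_mul_assoc)
  then show "X ** Y ** (matrix_inv Y ** matrix_inv X) = mat 1" using assms by (simp add: matrix_inv_cancel)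
  have "matrix_inv Y ** matrix_inv X ** (X ** Y) = matrix_inv Y ** (matrix_inv X ** X) ** Y"
    by (simp add: matrix_mul_assoc)
  then show "matrix_inv Y ** matrix_inv X ** (X ** Y) = mat 1" using assms by (simp add: matrix_inv_cancel)
qed

lemma int_matrix_mult: "int_matrix X \<Longrightarrow> int_matrix Y \<Longrightarrow> int_matrix (X ** Y)"
  by (auto simp: int_matrix_def matrix_matrix_mult_def intro!: Ints_sum Ints_mult)

lemma GL_int_mult:
  fixes X Y :: "real^'p^'p"
  assumes "GL_int X" "GL_int Y"
  shows "GL_int (X ** Y)"
  using assms by (auto simp: GL_int_def matrix_inv_mult int_matrix_mult invertible_mult)

lemma GL_int_one: "GL_int (mat 1 :: real^'p^'p)"
proof -
  have "matrix_inv (mat 1) = (mat 1 :: real^'p^'p)" by (rule matrix_inv_unique) auto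
  moreover have "int_matrix (mat 1 :: real^'p^'p)" by (auto simp: int_matrix_def mat_def)
  moreover have "invertible (mat 1 :: real^'p^'p)" by (auto simp: invertible_def intro: exI[of _ "mat 1"])
  ultimately show ?thesis by (simp add: GL_int_def)
qed

lemma mat_norm0_bounds:
  assumes "invertible (B::real^'p^'p)"
  shows "norm (B *v v) \<le> mat_norm0 B * norm v"
    and "norm (matrix_inv B *v v) \<le> mat_norm0 B * norm v"
    and "1 \<le> mat_norm0 B"
proof -
  show 1: "norm (B *v v) \<le> mat_norm0 B * norm v" for v
    using mat_norm_bound[of B v] mult_right_mono[of "mat_norm B" "mat_norm0 B" "norm v"]
    by (simp add: mat_norm0_def)
  show 2: "norm (matrix_inv B *v v) \<le> mat_norm0 B * norm v" for v
    using mat_norm_bound[of "matrix_inv B" v] mult_right_mono[of "mat_norm (matrix_inv B)" "mat_norm0 B" "norm v"]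
    by (simp add: mat_norm0_def)
  define e :: "real^'p" where "e = axis undefined 1"
  have e: "norm e = 1" by (simp add: e_def)
  have "e = matrix_inv B *v (B *v e)"
    using assms by (simp add: matrix_vector_mul_assoc matrix_inv_cancel)
  then have "1 \<le> mat_norm0 B * norm (B *v e)" using 2[of "B *v e"] e by simp
  also have "\<dots> \<le> mat_norm0 B * (mat_norm0 B * 1)"
    using 1[of e] e mat_norm_nonneg[of B] by (intro mult_left_mono) (auto simp: mat_norm0_def)
  finally have "1 \<le> (mat_norm0 B)\<^sup>2" by (simp add: power2_eq_square)
  moreover have "0 \<le> mat_norm0 B" using mat_norm_nonneg[of B] by (simp add: mat_norm0_def)
  ultimately show "1 \<le> mat_norm0 B" using power2_less_1_iff[of "mat_norm0 B"] by (auto simp: not_less[symmetric])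
qed

section \<open>Distance from the origin to an affine line\<close>

definition line_dist :: "'v::euclidean_space \<Rightarrow> 'v \<Rightarrow> real" where
  "line_dist a u = norm (a - ((a \<bullet> u) / (u \<bullet> u)) *\<^sub>R u)"

lemma line_dist_nonneg [simp]: "0 \<le> line_dist a u"
  by (simp add: line_dist_def)

lemma line_dist_attained: "\<exists>t. line_dist a u = norm (a + t *\<^sub>R u)"
  by (rule exI[of _ "- ((a \<bullet> u) / (u \<bullet> u))"]) (simp add: line_dist_def)

text \<open>Pythagoras: \<open>line_dist a u\<close> is the norm of the component of a orthogonal to
  u. For u = 0 the convention x / 0 = 0 turns it into \<open>norm a\<close>, the distance to the
  degenerate line.\<close>

lemma line_dist_le: "line_dist a u \<le> norm (a + t *\<^sub>R u)"
proof (cases "u = 0")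
  case False
  define b where "b = a - ((a \<bullet> u) / (u \<bullet> u)) *\<^sub>R u"
  define s where "s = t + (a \<bullet> u) / (u \<bullet> u)"
  have bu: "b \<bullet> u = 0" using False by (simp add: b_def inner_diff_left)
  have "a + t *\<^sub>R u = b + s *\<^sub>R u" by (simp add: b_def s_def algebra_simps)
  then have "(norm (a + t *\<^sub>R u))\<^sup>2 = (norm b)\<^sup>2 + (norm (s *\<^sub>R u))\<^sup>2"
    using bu norm_add_Pythagorean[of b "s *\<^sub>R u"] by (simp add: orthogonal_def)
  then have "(norm b)\<^sup>2 \<le> (norm (a + t *\<^sub>R u))\<^sup>2" by simp
  then show ?thesis by (simp add: line_dist_def b_def abs_le_square_iff[symmetric])
qed (simp add: line_dist_def)

text \<open>Evaluate the bound at the point of the line closest to 0. Applied to an inverse matrix,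
  this limits how much a line can approach 0.\<close>

lemma line_dist_image_le:
  assumes "\<And>v. norm (B *v v) \<le> b * norm v"
  shows "line_dist (B *v a) (B *v u) \<le> b * line_dist a (u::real^'p)"
proof -
  obtain t where "line_dist a u = norm (a + t *\<^sub>R u)" using line_dist_attained by blast
  moreover have "line_dist (B *v a) (B *v u) \<le> norm (B *v (a + t *\<^sub>R u))"
    using line_dist_le[of "B *v a" "B *v u" t]
    by (simp add: matrix_vector_right_distrib matrix_vector_mult_scaleR)
  ultimately show ?thesis using assms[of "a + t *\<^sub>R u"] by simp
qed

lemma line_dist_scale:
  assumes "r \<noteq> 0"
  shows "line_dist (s *\<^sub>R a) (r *\<^sub>R u) = \<bar>s\<bar> * line_dist a u"
proof -
  have "s *\<^sub>R a - ((s *\<^sub>R a) \<bullet> (r *\<^sub>R u) / ((r *\<^sub>R u) \<bullet> (r *\<^sub>R u))) *\<^sub>R (r *\<^sub>R u)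
     = s *\<^sub>R (a - ((a \<bullet> u) / (u \<bullet> u)) *\<^sub>R u)"
    using assms by (simp add: scaleR_diff_right)
  then show ?thesis unfolding line_dist_def by (simp only: norm_scaleR)
qed

lemma line_dist_shift: "line_dist (a + t *\<^sub>R u) u = line_dist a u"
proof (cases "u = 0")
  case False
  then show ?thesis by (simp add: line_dist_def inner_add_left add_divide_distrib algebra_simps)
qed simp

lemma line_dist_eq_0_iff: "line_dist a u = 0 \<longleftrightarrow> (\<exists>t. a + t *\<^sub>R u = 0)"
  by (metis line_dist_attained line_dist_le line_dist_nonneg norm_eq_zero order_antisym)

lemma continuous_on_line_dist:
  assumes "continuous_on S f" "continuous_on S h" "\<And>x. x \<in> S \<Longrightarrow> h x \<noteq> 0"
  shows "continuous_on S (\<lambda>x. line_dist (f x) (h x))"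
  unfolding line_dist_def using assms by (intro continuous_intros) auto

text \<open>The ratio of the distances after and before applying B survives rescaling the line to
  distance 1, moving the base point to the closest point and normalizing the direction. Such
  orthonormal pairs lie in a compact set.\<close>

lemma line_dist_normalize:
  assumes "u \<noteq> 0" "line_dist a u > 0"
  defines "a' \<equiv> (1 / line_dist a u) *\<^sub>R (a - ((a \<bullet> u) / (u \<bullet> u)) *\<^sub>R u)"
    and "u' \<equiv> (1 / norm u) *\<^sub>R u"
  shows "norm a' = 1" "norm u' = 1" "a' \<bullet> u' = 0"
    and "line_dist (B *v a) (B *v u) = line_dist a u * line_dist (B *v a') (B *v (u'::real^'p))"
proof -
  show "norm u' = 1" using assms by (simp add: u'_def)
  show "norm a' = 1" using assms(2) unfolding a'_def by (simp add: line_dist_def)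
  show "a' \<bullet> u' = 0" using assms(1) by (simp add: a'_def u'_def inner_diff_left)
  let ?d = "line_dist a u"
  have a: "a = ?d *\<^sub>R a' + ((a \<bullet> u) / (u \<bullet> u)) *\<^sub>R u" using assms(2) by (simp add: a'_def)
  have u: "u = norm u *\<^sub>R u'" using assms(1) by (simp add: u'_def)
  have "line_dist (B *v a) (B *v u) = line_dist (?d *\<^sub>R (B *v a') + ((a \<bullet> u) / (u \<bullet> u)) *\<^sub>R (B *v u)) (B *v u)"
    by (subst a) (simp add: matrix_vector_right_distrib matrix_vector_mult_scaleR)
  also have "\<dots> = line_dist (?d *\<^sub>R (B *v a')) (norm u *\<^sub>R (B *v u'))"
    unfolding line_dist_shift by (subst (2) u) (simp add: matrix_vector_mult_scaleR)
  also have "\<dots> = ?d * line_dist (B *v a') (B *v u')" using assms by (subst line_dist_scale) auto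
  finally show "line_dist (B *v a) (B *v u) = line_dist a u * line_dist (B *v a') (B *v u')" .
qed

section \<open>The integer lattice\<close>

lemma closed_int_lattice: "closed (int_lattice :: (real^'p) set)"
proof -
  have "int_lattice = (\<Inter>i. (\<lambda>v::real^'p. v $ i) -` \<int>)" by (auto simp: int_lattice_def)
  moreover have "closed ((\<lambda>v::real^'p. v $ i) -` \<int>)" for i
    by (rule closed_vimage) (auto intro: closed_Ints continuous_intros)
  ultimately show ?thesis by (metis closed_INT UNIV_I)
qed

lemma int_lattice_norm_ge_1:
  assumes "c \<in> int_lattice" "c \<noteq> (0::real^'p)"
  shows "1 \<le> norm c"
proof -
  obtain i where i: "c $ i \<noteq> 0" using assms(2) by (auto simp: vec_eq_iff)
  moreover have "c $ i \<in> \<int>" using assms(1) by (auto simp: int_lattice_def)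
  ultimately have "1 \<le> \<bar>c $ i\<bar>" using Ints_nonzero_abs_ge1 by auto
  also have "\<dots> \<le> norm c" by (rule component_le_norm_cart)
  finally show ?thesis .
qed

lemma int_matrix_maps_lattice:
  assumes "int_matrix B" "c \<in> int_lattice"
  shows "B *v c \<in> int_lattice"
  using assms by (auto simp: int_matrix_def int_lattice_def matrix_vector_mult_def intro!: Ints_sum Ints_mult)

lemma int_lattice_diff: "c \<in> int_lattice \<Longrightarrow> d \<in> int_lattice \<Longrightarrow> c - d \<in> int_lattice"
  by (auto simp: int_lattice_def)

lemma int_lattice_ball_subset:
  "{c \<in> int_lattice. norm c \<le> r} \<subseteq>
     (\<lambda>f. \<chi> i. of_int (f i)) ` ((UNIV::'p::finite set) \<rightarrow>\<^sub>E {-\<lfloor>r\<rfloor>..\<lfloor>r\<rfloor>})" for r :: real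
proof
  fix c :: "real^'p" assume c: "c \<in> {c \<in> int_lattice. norm c \<le> r}"
  have f: "of_int \<lfloor>c $ i\<rfloor> = c $ i" for i using c by (auto simp: int_lattice_def)
  have "\<lfloor>c $ i\<rfloor> \<in> {-\<lfloor>r\<rfloor>..\<lfloor>r\<rfloor>}" for i
  proof -
    have "\<bar>c $ i\<bar> \<le> r" using c component_le_norm_cart[of c i] by auto
    then have "of_int \<bar>\<lfloor>c $ i\<rfloor>\<bar> \<le> r" using f[of i] by (metis of_int_abs)
    then have "\<bar>\<lfloor>c $ i\<rfloor>\<bar> \<le> \<lfloor>r\<rfloor>" by (simp only: le_floor_iff)
    then show ?thesis by auto
  qed
  then show "c \<in> (\<lambda>f. \<chi> i. of_int (f i)) ` ((UNIV::'p::finite set) \<rightarrow>\<^sub>E {-\<lfloor>r\<rfloor>..\<lfloor>r\<rfloor>})"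
    by (intro image_eqI[of _ _ "\<lambda>i. \<lfloor>c $ i\<rfloor>"]) (auto simp: f vec_eq_iff)
qed

lemma int_lattice_ball:
  assumes "0 \<le> (r::real)"
  shows "finite {c \<in> int_lattice :: (real^'p) set. norm c \<le> r}"
    and "real (card {c \<in> int_lattice :: (real^'p) set. norm c \<le> r}) \<le> (2 * r + 1) ^ CARD('p)"
proof -
  have fin: "finite ((UNIV::'p::finite set) \<rightarrow>\<^sub>E {-\<lfloor>r\<rfloor>..\<lfloor>r\<rfloor>})" by (intro finite_PiE) auto
  show "finite {c \<in> int_lattice :: (real^'p) set. norm c \<le> r}"
    using finite_subset[OF int_lattice_ball_subset] fin by blast
  have "card {c \<in> int_lattice :: (real^'p) set. norm c \<le> r} \<le> card ((UNIV::'p::finite set) \<rightarrow>\<^sub>E {-\<lfloor>r\<rfloor>..\<lfloor>r\<rfloor>})"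
    using fin by (intro order.trans[OF card_mono[OF _ int_lattice_ball_subset] card_image_le]) auto
  also have "\<dots> = nat (2 * \<lfloor>r\<rfloor> + 1) ^ CARD('p)" by (simp add: card_PiE algebra_simps)
  finally have "real (card {c \<in> int_lattice :: (real^'p) set. norm c \<le> r}) \<le> real (nat (2 * \<lfloor>r\<rfloor> + 1)) ^ CARD('p)"
    by (metis of_nat_le_iff of_nat_power)
  also have "real (nat (2 * \<lfloor>r\<rfloor> + 1)) \<le> 2 * r + 1" using assms by simp
  then have "real (nat (2 * \<lfloor>r\<rfloor> + 1)) ^ CARD('p) \<le> (2 * r + 1) ^ CARD('p)" by (intro power_mono) auto
  finally show "real (card {c \<in> int_lattice :: (real^'p) set. norm c \<le> r}) \<le> (2 * r + 1) ^ CARD('p)" .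
qed

lemma countable_int_lattice: "countable (int_lattice :: (real^'p) set)"
proof -
  have "int_lattice \<subseteq> (\<Union>n::nat. {c \<in> int_lattice :: (real^'p) set. norm c \<le> real n})"
    using real_arch_simple by auto
  then show ?thesis
    by (rule countable_subset) (intro countable_UN countableI_type countable_finite int_lattice_ball(1), simp)
qed

text \<open>The children of a line \<open>a + \<real>u\<close> near \<open>0\<close>, other than its own image, stay at a definite distance
  from the origin: the preimage of \<open>c\<close> is a lattice point too, hence far from the part of the line
  near \<open>0\<close>, and \<open>B\<close> does not shrink distances along the line.\<close>

lemma child_line_dist_ge:
  fixes B :: "real^'p^'p"
  assumes GL: "GL_int B" and b: "\<And>v. norm (matrix_inv B *v v) \<le> b * norm v" "1 \<le> b"
    and exp: "norm u \<le> norm (B *v u)"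
    and c: "c \<in> int_lattice" "c \<noteq> 0"
    and t: "norm (a + t *\<^sub>R u) < 1 / 10" "norm (B *v (a + t *\<^sub>R u) - c) < 1 / 10"
  shows "1 / (10 * b) \<le> line_dist (B *v a - c) (B *v u)"
proof (rule ccontr)
  assume "\<not> ?thesis"
  then obtain t' where t': "norm (B *v a - c + t' *\<^sub>R (B *v u)) < 1 / (10 * b)"
    using line_dist_attained[of "B *v a - c" "B *v u"] by (auto simp: not_le)
  define z where "z = B *v (a + t' *\<^sub>R u) - c"
  have z: "norm z < 1 / (10 * b)" using t'
    by (simp add: z_def matrix_vector_right_distrib matrix_vector_mult_scaleR algebra_simps)
  have z1: "norm z < 1 / 10" using z b(2) by (smt (verit) frac_le)
  have inv: "matrix_inv B ** B = mat 1" "B ** matrix_inv B = mat 1"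
    using GL by (auto simp: GL_int_def matrix_inv_cancel)
  have "norm (matrix_inv B *v z) \<le> b * norm z" by (rule b)
  also have "\<dots> \<le> b * (1 / (10 * b))" using z b(2) by (intro mult_left_mono) auto
  finally have "norm (matrix_inv B *v z) \<le> 1 / 10" using b(2) by simp
  moreover have "matrix_inv B *v z = a + t' *\<^sub>R u - matrix_inv B *v c"
    using inv by (simp add: z_def matrix_vector_mult_diff_distrib matrix_vector_mul_assoc)
  ultimately have *: "norm (a + t' *\<^sub>R u - matrix_inv B *v c) \<le> 1 / 10" by simp
  have "matrix_inv B *v c \<in> int_lattice"
    using GL c by (auto simp: GL_int_def intro: int_matrix_maps_lattice)
  moreover have "matrix_inv B *v c \<noteq> 0"
  proof
    assume "matrix_inv B *v c = 0"
    then have "B *v (matrix_inv B *v c) = 0" by simp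
    then show False using inv c by (simp add: matrix_vector_mul_assoc)
  qed
  ultimately have c': "1 \<le> norm (matrix_inv B *v c)" by (rule int_lattice_norm_ge_1)
  have "matrix_inv B *v c = ((t' - t) *\<^sub>R u + (a + t *\<^sub>R u)) - (a + t' *\<^sub>R u - matrix_inv B *v c)"
    by (simp add: algebra_simps)
  then have "norm (matrix_inv B *v c)
      \<le> norm ((t' - t) *\<^sub>R u + (a + t *\<^sub>R u)) + norm (a + t' *\<^sub>R u - matrix_inv B *v c)"
    by (metis norm_triangle_ineq4)
  also have "\<dots> \<le> norm ((t' - t) *\<^sub>R u) + norm (a + t *\<^sub>R u) + norm (a + t' *\<^sub>R u - matrix_inv B *v c)"
    using norm_triangle_ineq by (intro add_right_mono)
  finally have 1: "8 / 10 \<le> \<bar>t' - t\<bar> * norm u" using c' * t(1) by simp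
  have "B *v ((t' - t) *\<^sub>R u) = z - (B *v (a + t *\<^sub>R u) - c)"
    by (simp add: z_def matrix_vector_right_distrib matrix_vector_mult_scaleR algebra_simps)
  then have "norm (B *v ((t' - t) *\<^sub>R u)) \<le> norm z + norm (B *v (a + t *\<^sub>R u) - c)"
    by (simp add: norm_triangle_ineq4)
  then have 2: "\<bar>t' - t\<bar> * norm (B *v u) \<le> 2 / 10" using z1 t(2) by (simp add: matrix_vector_mult_scaleR)
  have "\<bar>t' - t\<bar> * norm u \<le> \<bar>t' - t\<bar> * norm (B *v u)" using exp by (intro mult_left_mono) auto
  then show False using 1 2 by simp
qed

section \<open>Coded measure-preserving systems\<close>

text \<open>A Dini argument: closedness in J makes the probability of \<open>bad m J\<close> upper
  semicontinuous in J, and upper semicontinuous functions decreasing to 0 at each point of a compact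
  set do so uniformly.\<close>

lemma (in prob_space) uniformly_small_on_compact:
  fixes X :: "'b::metric_space set" and bad :: "nat \<Rightarrow> 'b \<Rightarrow> 'a set"
  assumes X: "compact X"
    and meas: "\<And>n J. J \<in> X \<Longrightarrow> bad n J \<in> events"
    and dec: "\<And>m n J. J \<in> X \<Longrightarrow> m \<le> n \<Longrightarrow> bad n J \<subseteq> bad m J"
    and cl: "\<And>m x. x \<in> space M \<Longrightarrow> closed {J \<in> X. x \<in> bad m J}"
    and null: "\<And>J. J \<in> X \<Longrightarrow> AE x in M. \<exists>n. x \<notin> bad n J"
    and \<eta>: "0 < \<eta>"
  shows "\<exists>n. \<forall>J \<in> X. prob (bad n J) < \<eta>"
proof (rule ccontr)
  assume "\<not> ?thesis"
  then have "\<forall>n. \<exists>J. J \<in> X \<and> \<eta> \<le> prob (bad n J)" by (auto simp: not_less)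
  then obtain J where J: "\<And>n. J n \<in> X" "\<And>n. \<eta> \<le> prob (bad n (J n))" by metis
  obtain L r where L: "L \<in> X" "strict_mono r" "(J \<circ> r) \<longlonglongrightarrow> L"
    using X J(1) unfolding compact_def by metis
  have "\<eta> \<le> prob (bad m L)" for m
  proof -
    \<comment> \<open>The intersection of the E i is the upper limit of the sets
      \<open>bad m (J (r j))\<close>. It keeps probability at least \<eta>, and closedness puts it
      inside \<open>bad m L\<close>.\<close>
    define E where "E i = (\<Union>j\<in>{i..}. bad m (J (r j)))" for i
    have Em: "E i \<in> events" for i unfolding E_def using meas J(1) by auto
    have "decseq E" unfolding E_def decseq_def by (auto intro: order.trans)
    then have lim: "(\<lambda>i. prob (E i)) \<longlonglongrightarrow> prob (\<Inter>i. E i)"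
      using Em by (intro finite_Lim_measure_decseq) auto
    have "\<eta> \<le> prob (E i)" for i
    proof -
      have "\<eta> \<le> prob (bad (r (max i m)) (J (r (max i m))))" by (rule J)
      also have "\<dots> \<le> prob (E i)"
      proof (rule finite_measure_mono[OF _ Em])
        \<comment> \<open>The lower bound \<eta> is known for the pair with equal indices; as the
          bad sets shrink with the first index, it passes to the fixed index m.\<close>
        have "m \<le> r (max i m)" using seq_suble[OF L(2), of "max i m"] by linarith
        then have "bad (r (max i m)) (J (r (max i m))) \<subseteq> bad m (J (r (max i m)))" using dec J(1) by blast
        then show "bad (r (max i m)) (J (r (max i m))) \<subseteq> E i"
          unfolding E_def by (intro order.trans[OF _ UN_upper[of "max i m"]]) auto
      qed
      finally show ?thesis .
    qed
    then have 1: "\<eta> \<le> prob (\<Inter>i. E i)" using LIMSEQ_le_const[OF lim] by auto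
    have "(\<Inter>i. E i) \<subseteq> bad m L"
    proof
      fix x assume x: "x \<in> (\<Inter>i. E i)"
      then have xs: "x \<in> space M" using Em[of 0] sets.sets_into_space by fastforce
      show "x \<in> bad m L"
      proof (rule ccontr)
        assume nb: "x \<notin> bad m L"
        have "eventually (\<lambda>i. (J \<circ> r) i \<in> - {J \<in> X. x \<in> bad m J}) sequentially"
          using cl[OF xs, of m] nb by (intro topological_tendstoD[OF L(3)]) (auto simp: open_Compl)
        then obtain i where "\<And>j. j \<ge> i \<Longrightarrow> x \<notin> bad m (J (r j))"
          using J(1) by (auto simp: eventually_sequentially)
        then show False using x by (auto simp: E_def)
      qed
    qed
    then show ?thesis using 1 finite_measure_mono[of "\<Inter>i. E i" "bad m L"] meas L(1) by fastforce
  qed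
  moreover have "(\<lambda>m. prob (bad m L)) \<longlonglongrightarrow> prob (\<Inter>m. bad m L)"
    using meas dec L(1) by (intro finite_Lim_measure_decseq) (auto simp: decseq_def image_subset_iff)
  ultimately have "\<eta> \<le> prob (\<Inter>m. bad m L)" using LIMSEQ_le_const by blast
  moreover have "prob (\<Inter>m. bad m L) = 0"
    using null[OF L(1)] meas[OF L(1)] by (intro prob_eq_0[THEN iffD2]) auto
  ultimately show False using \<eta> by simp
qed

section \<open>Words and the matrix products along them\<close>

definition word :: "('a \<Rightarrow> 'a) \<Rightarrow> ('a \<Rightarrow> int) \<Rightarrow> nat \<Rightarrow> 'a \<Rightarrow> int list" where
  "word T lt n x = map (\<lambda>k. lt ((T ^^ k) x)) [0..<n]"

primrec wmat :: "(int \<Rightarrow> real^'p^'p) \<Rightarrow> int list \<Rightarrow> real^'p^'p" where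
  "wmat B [] = mat 1"
| "wmat B (l # v) = wmat B v ** B l"

lemma length_word [simp]: "length (word T lt n x) = n"
  by (simp add: word_def)

lemma word_add: "word T lt (m + n) x = word T lt m x @ word T lt n ((T ^^ m) x)"
proof -
  have "word T lt (m + n) x = map (\<lambda>k. lt ((T ^^ k) x)) [0..<m] @ map (\<lambda>k. lt ((T ^^ k) x)) [m..<m + n]"
    unfolding word_def map_append[symmetric] by (simp add: upt_add_eq_append[symmetric])
  moreover have "map (\<lambda>k. lt ((T ^^ k) x)) [m..<m + n] = word T lt n ((T ^^ m) x)"
    unfolding word_def
    by (rule nth_equalityI) (auto simp: funpow_add[unfolded o_def, THEN fun_cong, symmetric] add.commute)
  ultimately show ?thesis by (simp add: word_def)
qed

lemma wmat_append: "wmat B (u @ v) = wmat B v ** wmat B u"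
  by (induction u) (auto simp: matrix_mul_assoc)

text \<open>Any predicate of a finite orbit segment factors through \<open>word\<close>, a
  measurable map to a discrete space. This makes even predicates with quantifiers over vectors or
  frames measurable.\<close>

lemma cocycle_eq_wmat: "cocycle T (\<lambda>x. B (lt x)) n x = wmat B (word T lt n x)"
proof (induction n)
  case (Suc n)
  have "word T lt (Suc n) x = word T lt n x @ [lt ((T ^^ n) x)]"
    using word_add[of T lt n 1 x] by (simp add: word_def)
  then show ?case using Suc by (simp add: wmat_append)
qed (simp add: word_def)

lemma cocycle_add: "cocycle T A (m + n) x = cocycle T A n ((T ^^ m) x) ** cocycle T A m x"
proof (induction n)
  case (Suc n)
  have "(T ^^ (m + n)) x = (T ^^ n) ((T ^^ m) x)" by (simp add: add.commute[of m] funpow_add)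
  then show ?case using Suc by (simp add: matrix_mul_assoc)
qed simp

section \<open>Measure-preserving maps\<close>

locale mpt = prob_space M for M :: "'a measure" +
  fixes T :: "'a \<Rightarrow> 'a"
  assumes T_meas [measurable]: "T \<in> measurable M M"
    and T_inv: "distr M M T = M"
begin

lemma T_pow_meas [measurable]: "(T ^^ n) \<in> measurable M M"
  by (induction n) (auto simp: comp_def intro: measurable_compose[OF _ T_meas] simp: id_def)

lemma T_pow_space: "x \<in> space M \<Longrightarrow> (T ^^ n) x \<in> space M"
  using measurable_space[OF T_pow_meas] by blast

lemma T_pow_inv: "distr M M (T ^^ n) = M"
proof (induction n)
  case (Suc n)
  have "distr M M (T ^^ Suc n) = distr (distr M M (T ^^ n)) M T"
    by (subst distr_distr) (auto simp: comp_def)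
  then show ?case unfolding Suc T_inv .
qed (simp add: distr_id2 id_def)

lemma nn_integral_T_pow:
  assumes "F \<in> borel_measurable M"
  shows "(\<integral>\<^sup>+ x. F ((T ^^ n) x) \<partial>M) = (\<integral>\<^sup>+ x. F x \<partial>M)"
  using nn_integral_distr[of "T ^^ n" M M F] T_pow_inv assms by auto

lemma AE_T_pow:
  assumes "AE x in M. P x"
  shows "AE x in M. P ((T ^^ n) x)"
proof -
  have "AE x in distr M M (T ^^ n). P x" using assms by (simp only: T_pow_inv)
  then show ?thesis by (rule AE_distrD[rotated]) auto
qed

lemma AE_all_T_pow:
  assumes "AE x in M. P x"
  shows "AE x in M. \<forall>n. P ((T ^^ n) x)"
  using AE_T_pow[OF assms] by (simp add: AE_all_countable)

lemma word_measurable: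
  assumes [measurable]: "lt \<in> measurable M (count_space UNIV)"
  shows "word T lt n \<in> measurable M (count_space UNIV)"
proof (induction n)
  case (Suc n)
  have e: "word T lt (Suc n) x = word T lt n x @ [lt ((T ^^ n) x)]" for x
    using word_add[of T lt n 1 x] by (simp add: word_def)
  have [measurable]: "word T lt n \<in> measurable M (count_space UNIV)" by (rule Suc)
  have "(\<lambda>x. word T lt n x @ [lt ((T ^^ n) x)]) \<in> measurable M (count_space UNIV)" by measurable
  then show ?case by (simp add: e cong: measurable_cong)
qed (simp add: word_def)

end

text \<open>The partition becomes a total labelling \<open>lt\<close>, so that the cylinders of each
  length partition the whole space. \<open>distortion\<close> is the upper density bound with the
  denominator multiplied out.\<close>

locale symbolic_system = mpt M T for M :: "'a measure" and T +
  fixes lt :: "'a \<Rightarrow> int" and K :: real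
  assumes erg: "ergodic M T"
    and lt_meas [measurable]: "lt \<in> measurable M (count_space UNIV)"
    and K_pos: "0 < K"
    and distortion: "\<And>u C. C \<in> sets M \<Longrightarrow>
        emeasure M ({x \<in> space M. word T lt (length u) x = u} \<inter> (T ^^ length u) -` C)
          \<le> ennreal K * emeasure M {x \<in> space M. word T lt (length u) x = u} * emeasure M C"
begin

abbreviation "wd \<equiv> word T lt"

definition cyl :: "int list \<Rightarrow> 'a set" where
  "cyl u = {x \<in> space M. wd (length u) x = u}"

text \<open>\<open>cylint u F\<close> is \<open>\<mu>(\<Delta>\<^sup>u) \<integral> F d\<mu>\<^sup>u\<close> in the notation of the paper; bounds of the form
  \<open>cylint u F \<le> c \<mu>(\<Delta>\<^sup>u)\<close> for all \<open>u\<close> are bounds of \<open>F\<close> in mean, uniform over all \<open>\<mu>\<^sup>u\<close>.\<close>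

definition cylint :: "int list \<Rightarrow> ('a \<Rightarrow> ennreal) \<Rightarrow> ennreal" where
  "cylint u F = (\<integral>\<^sup>+ x. indicator (cyl u) x * F ((T ^^ length u) x) \<partial>M)"

lemma word_meas [measurable]: "wd n \<in> measurable M (count_space UNIV)"
  by (rule word_measurable[OF lt_meas])

lemma cyl_meas [measurable]: "cyl u \<in> sets M"
  unfolding cyl_def by measurable

lemma cylint_mono: 
  assumes "\<And>x. x \<in> space M \<Longrightarrow> F x \<le> F' x"
  shows "cylint u F \<le> cylint u F'"
  unfolding cylint_def using assms T_pow_space
  by (intro nn_integral_mono mult_left_mono) auto

lemma cylint_const: "cylint u (\<lambda>x. c) = c * emeasure M (cyl u)"
  unfolding cylint_def by (simp add: nn_integral_cmult_indicator mult.commute)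

lemma cylint_Nil: "cylint [] F = (\<integral>\<^sup>+ x. F x \<partial>M)"
  unfolding cylint_def cyl_def by (intro nn_integral_cong) (simp add: word_def)

lemma cylint_add:
  assumes [measurable]: "F \<in> borel_measurable M" "F' \<in> borel_measurable M"
  shows "cylint u (\<lambda>x. F x + F' x) = cylint u F + cylint u F'"
  unfolding cylint_def by (subst nn_integral_add[symmetric]) (auto simp: distrib_left)

lemma cylint_cmult:
  assumes [measurable]: "F \<in> borel_measurable M"
  shows "cylint u (\<lambda>x. c * F x) = c * cylint u F"
  unfolding cylint_def by (subst nn_integral_cmult[symmetric]) (auto simp: ac_simps)

lemma cylint_sum:
  assumes "\<And>i. i \<in> I \<Longrightarrow> F i \<in> borel_measurable M"
  shows "cylint u (\<lambda>x. \<Sum>i\<in>I. F i x) = (\<Sum>i\<in>I. cylint u (F i))"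
proof -
  have "(\<lambda>x. indicator (cyl u) x * F i ((T ^^ length u) x)) \<in> borel_measurable M" if "i \<in> I" for i
    using measurable_compose[OF T_pow_meas assms[OF that]] by measurable
  then show ?thesis
    unfolding cylint_def by (subst nn_integral_sum[symmetric]) (auto simp: sum_distrib_left)
qed

text \<open>\<open>distortion\<close> is a domination of measures: the image of \<mu> restricted to
  \<open>cyl u\<close> is at most K \<mu>(cyl u) times \<mu>. Integrals inherit it.\<close>

lemma cylint_le:
  assumes F: "F \<in> borel_measurable M"
  shows "cylint u F \<le> ennreal K * (\<integral>\<^sup>+ x. F x \<partial>M) * emeasure M (cyl u)"
proof -
  let ?n = "length u"
  let ?N = "distr (density M (indicator (cyl u))) M (T ^^ ?n)"
  let ?S = "scale_measure (ennreal K * emeasure M (cyl u)) M"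
  have Fu[measurable]: "(\<lambda>x. F ((T ^^ ?n) x)) \<in> borel_measurable M"
    using measurable_compose[OF T_pow_meas F] by simp
  have "cylint u F = (\<integral>\<^sup>+ x. F ((T ^^ ?n) x) \<partial>density M (indicator (cyl u)))"
    unfolding cylint_def by (subst nn_integral_density) auto
  also have "\<dots> = integral\<^sup>N ?N F"
    using F by (subst nn_integral_distr) auto
  also have "\<dots> \<le> integral\<^sup>N ?S F"
  proof (rule nn_integral_mono_measure)
    show "?N \<le> ?S"
    proof -
      have "emeasure ?N \<le> emeasure ?S"
      proof (rule le_funI)
        fix C
        show "emeasure ?N C \<le> emeasure ?S C"
        proof (cases "C \<in> sets M")
          case True
          note [measurable] = True
          have "emeasure ?N C = emeasure M (cyl u \<inter> (T ^^ ?n) -` C)"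
          proof -
            have "emeasure ?N C = (\<integral>\<^sup>+ x. indicator (cyl u) x * indicator ((T ^^ ?n) -` C \<inter> space M) x \<partial>M)"
              using True by (subst emeasure_distr) (auto simp: emeasure_density)
            also have "\<dots> = (\<integral>\<^sup>+ x. indicator (cyl u \<inter> ((T ^^ ?n) -` C \<inter> space M)) x \<partial>M)"
              by (simp add: indicator_inter_arith)
            also have "\<dots> = emeasure M (cyl u \<inter> ((T ^^ ?n) -` C \<inter> space M))"
              by (subst nn_integral_indicator) auto
            also have "cyl u \<inter> ((T ^^ ?n) -` C \<inter> space M) = cyl u \<inter> (T ^^ ?n) -` C"
              by (auto simp: cyl_def)
            finally show ?thesis .
          qed
          also have "\<dots> \<le> ennreal K * emeasure M (cyl u) * emeasure M C"
            unfolding cyl_def by (rule distortion[OF True])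
          finally show ?thesis by simp
        qed (simp add: emeasure_notin_sets)
      qed
      then show ?thesis unfolding le_measure_iff by (simp add: le_fun_def space_scale_measure)
    qed
  qed simp
  also have "\<dots> = ennreal K * emeasure M (cyl u) * integral\<^sup>N M F"
    by (rule nn_integral_scale_measure[OF F])
  finally show ?thesis by (simp add: ac_simps)
qed

text \<open>The substitute for conditioning on the past: cut \<open>cyl u\<close> according to the
  next N letters v. On \<open>cyl (u @ v)\<close> the integrand is that of
  \<open>cylint (u @ v) (H v)\<close>, so a bound valid for all cylinders applies with v
  fixed.\<close>

lemma cylint_tower:
  assumes H: "\<And>v. length v = N \<Longrightarrow> H v \<in> borel_measurable M"
    and h: "\<And>u v. length v = N \<Longrightarrow> cylint u (H v) \<le> h v * emeasure M (cyl u)"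
  shows "cylint u (\<lambda>x. H (wd N x) ((T ^^ N) x)) \<le> cylint u (\<lambda>x. h (wd N x))"
proof -
  let ?V = "{v :: int list. length v = N}"
  \<comment> \<open>Exactly one v contributes at a given x. Writing the sum as an integral over the
    counting measure lets it be exchanged with the integral over M.\<close>
  have split: "indicator (cyl u) x * F (wd N ((T ^^ length u) x)) x
      = (\<integral>\<^sup>+ v. indicator (cyl (u @ v)) x * F v x \<partial>count_space ?V)"
    if x: "x \<in> space M" for F :: "int list \<Rightarrow> 'a \<Rightarrow> ennreal" and x
  proof -
    define w where "w = wd N ((T ^^ length u) x)"
    have w: "w \<in> ?V" by (simp add: w_def)
    have "indicator (cyl (u @ v)) x * F v x = indicator (cyl u) x * F w x * indicator {w} v"
      if "v \<in> ?V" for v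
      using that x by (auto simp: cyl_def word_add w_def indicator_def)
    then have "(\<integral>\<^sup>+ v. indicator (cyl (u @ v)) x * F v x \<partial>count_space ?V)
       = (\<integral>\<^sup>+ v. indicator (cyl u) x * F w x * indicator {w} v \<partial>count_space ?V)"
      by (intro nn_integral_cong) auto
    also have "\<dots> = indicator (cyl u) x * F w x"
      using w by (subst nn_integral_cmult_indicator) auto
    finally show ?thesis by (simp add: w_def)
  qed
  have TT: "(T ^^ N) ((T ^^ length u) x) = (T ^^ (length u + N)) x" for x
    by (simp add: funpow_add add.commute[of "length u"])
  have "cylint u (\<lambda>x. H (wd N x) ((T ^^ N) x))
      = (\<integral>\<^sup>+ x. \<integral>\<^sup>+ v. indicator (cyl (u @ v)) x * H v ((T ^^ (length u + N)) x) \<partial>count_space ?V \<partial>M)"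
    unfolding cylint_def TT by (intro nn_integral_cong) (rule split)
  also have "\<dots> = (\<integral>\<^sup>+ v. \<integral>\<^sup>+ x. indicator (cyl (u @ v)) x * H v ((T ^^ (length u + N)) x) \<partial>M \<partial>count_space ?V)"
  proof (rule nn_integral_count_space_nn_integral)
    fix v assume "v \<in> ?V"
    then have "(\<lambda>x. H v ((T ^^ (length u + N)) x)) \<in> borel_measurable M"
      using measurable_compose[OF T_pow_meas H] by simp
    then show "(\<lambda>x. indicator (cyl (u @ v)) x * H v ((T ^^ (length u + N)) x)) \<in> borel_measurable M"
      by measurable
  qed simp
  also have "\<dots> \<le> (\<integral>\<^sup>+ v. \<integral>\<^sup>+ x. indicator (cyl (u @ v)) x * h v \<partial>M \<partial>count_space ?V)"
  proof (rule nn_integral_mono)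
    fix v assume "v \<in> space (count_space ?V)"
    then have v: "length v = N" by simp
    then have "(\<integral>\<^sup>+ x. indicator (cyl (u @ v)) x * H v ((T ^^ (length u + N)) x) \<partial>M) = cylint (u @ v) (H v)"
      by (simp add: cylint_def)
    also have "\<dots> \<le> h v * emeasure M (cyl (u @ v))" by (rule h[OF v])
    also have "\<dots> = (\<integral>\<^sup>+ x. indicator (cyl (u @ v)) x * h v \<partial>M)"
      by (subst nn_integral_multc) (auto simp: mult.commute)
    finally show "(\<integral>\<^sup>+ x. indicator (cyl (u @ v)) x * H v ((T ^^ (length u + N)) x) \<partial>M)
      \<le> (\<integral>\<^sup>+ x. indicator (cyl (u @ v)) x * h v \<partial>M)" .
  qed
  also have "\<dots> = (\<integral>\<^sup>+ x. \<integral>\<^sup>+ v. indicator (cyl (u @ v)) x * h v \<partial>count_space ?V \<partial>M)"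
    by (rule nn_integral_count_space_nn_integral[symmetric]) auto
  also have "\<dots> = cylint u (\<lambda>x. h (wd N x))"
    unfolding cylint_def by (intro nn_integral_cong split[symmetric])
  finally show ?thesis .
qed

lemma word_fun_meas [measurable]: "(\<lambda>x. f (wd n x) :: 'b::topological_space) \<in> borel_measurable M"
  by (rule measurable_compose[OF word_meas]) simp

text \<open>This half of Birkhoff's theorem only needs Fatou's lemma, as the exceptional set is invariant.\<close>

lemma frequently_birkhoff_sum_le:
  fixes f :: "'a \<Rightarrow> real"
  assumes [measurable]: "f \<in> borel_measurable M" and f0: "\<And>x. 0 \<le> f x"
    and int: "(\<integral>\<^sup>+ x. f x \<partial>M) < ennreal b"
  shows "AE x in M. \<exists>R::nat. \<exists>\<^sub>F n in sequentially. (\<Sum>i<n. f ((T ^^ i) x)) \<le> b * n + R"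
proof -
  have b0: "0 < b" using int by (metis ennreal_neg not_le not_less_zero)
  \<comment> \<open>Quantifying over all R makes S strictly invariant: passing from x to T x changes
    the sum by f x and the bound by b, which another R absorbs.\<close>
  define S where "S = {x \<in> space M. \<forall>R::nat. eventually (\<lambda>n. (\<Sum>i<n. f ((T ^^ i) x)) > b * n + R) sequentially}"
  have [measurable]: "S \<in> sets M" unfolding S_def eventually_sequentially by measurable
  have shift: "(\<Sum>i<n. f ((T ^^ i) (T x))) = (\<Sum>i<Suc n. f ((T ^^ i) x)) - f x" for n x
    by (simp add: sum.lessThan_Suc_shift funpow_swap1 del: sum.lessThan_Suc)
  have "T -` S \<inter> space M = S"
  proof (rule set_eqI)
    fix x
    have "(\<forall>R::nat. eventually (\<lambda>n. (\<Sum>i<n. f ((T ^^ i) (T x))) > b * n + R) sequentially) \<longleftrightarrow>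
          (\<forall>R::nat. eventually (\<lambda>n. (\<Sum>i<n. f ((T ^^ i) x)) > b * n + R) sequentially)" (is "?l \<longleftrightarrow> ?r")
    proof
      assume l: ?l
      show ?r
      proof
        fix R :: nat
        obtain R' :: nat where "R + b \<le> R'" using real_arch_simple by blast
        then have "eventually (\<lambda>n. (\<Sum>i<Suc n. f ((T ^^ i) x)) > b * (Suc n) + R) sequentially"
          using l[rule_format, of R'] f0[of x] unfolding shift
          by (auto elim!: eventually_mono simp del: sum.lessThan_Suc simp add: algebra_simps)
        then show "eventually (\<lambda>n. (\<Sum>i<n. f ((T ^^ i) x)) > b * n + R) sequentially"
          using eventually_sequentially_Suc[of "\<lambda>n. (\<Sum>i<n. f ((T ^^ i) x)) > b * n + R"] by simp
      qed
    next
      assume r: ?r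
      show ?l
      proof
        fix R :: nat
        obtain R' :: nat where R': "R + f x \<le> R'" using real_arch_simple by blast
        have "eventually (\<lambda>n. (\<Sum>i<Suc n. f ((T ^^ i) x)) > b * (Suc n) + R') sequentially"
          using r[rule_format, of R']
            eventually_sequentially_Suc[of "\<lambda>n. (\<Sum>i<n. f ((T ^^ i) x)) > b * n + R'"] by simp
        then show "eventually (\<lambda>n. (\<Sum>i<n. f ((T ^^ i) (T x))) > b * n + R) sequentially"
          unfolding shift using R' b0
          by (auto elim!: eventually_mono simp del: sum.lessThan_Suc simp add: algebra_simps)
      qed
    qed
    then show "x \<in> T -` S \<inter> space M \<longleftrightarrow> x \<in> S"
      using measurable_space[OF T_meas, of x] by (auto simp: S_def)
  qed
  then have "prob S = 0 \<or> prob S = 1" using erg \<open>S \<in> sets M\<close> unfolding ergodic_def by blast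
  moreover have "prob S \<noteq> 1"
  proof
    assume "prob S = 1"
    then have AE: "AE x in M. x \<in> S" by (simp add: prob_eq_1)
    have "ennreal b = (\<integral>\<^sup>+ x. ennreal b \<partial>M)" by (simp add: emeasure_space_1)
    \<comment> \<open>If S had full measure, the lower limit of the averages would be at least b,
      although by invariance each average has integral at most that of f.\<close>
    also have "\<dots> \<le> (\<integral>\<^sup>+ x. liminf (\<lambda>n. ennreal ((1 / real n) * (\<Sum>i<n. f ((T ^^ i) x)))) \<partial>M)"
    proof (rule nn_integral_mono_AE)
      show "AE x in M. ennreal b \<le> liminf (\<lambda>n. ennreal ((1 / real n) * (\<Sum>i<n. f ((T ^^ i) x))))"
        using AE
      proof eventually_elim
        fix x assume "x \<in> S"
        then have "eventually (\<lambda>n. (\<Sum>i<n. f ((T ^^ i) x)) > b * n) sequentially"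
          unfolding S_def by (auto dest!: spec[of _ 0])
        then have "eventually (\<lambda>n. ennreal b \<le> ennreal ((1 / real n) * (\<Sum>i<n. f ((T ^^ i) x)))) sequentially"
          using eventually_gt_at_top[of 0]
          by eventually_elim (auto intro!: ennreal_leI simp: field_simps)
        then show "ennreal b \<le> liminf (\<lambda>n. ennreal ((1 / real n) * (\<Sum>i<n. f ((T ^^ i) x))))"
          by (rule Liminf_bounded)
      qed
    qed
    also have "\<dots> \<le> liminf (\<lambda>n. \<integral>\<^sup>+ x. ennreal ((1 / real n) * (\<Sum>i<n. f ((T ^^ i) x))) \<partial>M)"
      by (rule nn_integral_liminf) measurable
    also have "\<dots> \<le> (\<integral>\<^sup>+ x. f x \<partial>M)"
    proof -
      have "(\<integral>\<^sup>+ x. ennreal ((1 / real n) * (\<Sum>i<n. f ((T ^^ i) x))) \<partial>M) \<le> (\<integral>\<^sup>+ x. f x \<partial>M)" for n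
      proof (cases "n = 0")
        case False
        have "(\<integral>\<^sup>+ x. ennreal ((1 / real n) * (\<Sum>i<n. f ((T ^^ i) x))) \<partial>M)
            = (\<integral>\<^sup>+ x. ennreal (1 / real n) * (\<Sum>i<n. ennreal (f ((T ^^ i) x))) \<partial>M)"
          using f0 by (intro nn_integral_cong) (simp add: ennreal_mult'[symmetric] sum_nonneg)
        also have "\<dots> = ennreal (1 / real n) * (\<Sum>i<n. \<integral>\<^sup>+ x. ennreal (f ((T ^^ i) x)) \<partial>M)"
          by (subst nn_integral_cmult) (auto simp: nn_integral_sum)
        also have "\<dots> = ennreal (1 / real n) * (ennreal (real n) * (\<integral>\<^sup>+ x. f x \<partial>M))"
          using nn_integral_T_pow[of "\<lambda>x. ennreal (f x)"] by (simp add: ennreal_of_nat_eq_real_of_nat)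
        also have "\<dots> = (\<integral>\<^sup>+ x. f x \<partial>M)"
          using False by (simp add: mult.assoc[symmetric] ennreal_mult'[symmetric])
        finally show ?thesis by simp
      qed simp
      then show ?thesis by (intro Liminf_le) auto
    qed
    finally show False using int by simp
  qed
  ultimately have "AE x in M. x \<notin> S" by (simp add: prob_eq_0)
  then show ?thesis
    using AE_space
  proof eventually_elim
    fix x assume x: "x \<notin> S" "x \<in> space M"
    then obtain R :: nat where "\<not> eventually (\<lambda>n. (\<Sum>i<n. f ((T ^^ i) x)) > b * n + R) sequentially"
      by (auto simp: S_def)
    then show "\<exists>R::nat. \<exists>\<^sub>F n in sequentially. (\<Sum>i<n. f ((T ^^ i) x)) \<le> b * n + R"
      by (intro exI[of _ R]) (simp add: frequently_def not_le)
  qed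
qed

text \<open>Borel-Cantelli: by invariance the probabilities of f exceeding c n at time n add up to
  at most the integral of f / c + 1.\<close>

lemma AE_subexponential:
  fixes f :: "'a \<Rightarrow> real"
  assumes [measurable]: "f \<in> borel_measurable M" and f0: "\<And>x. 0 \<le> f x"
    and int: "(\<integral>\<^sup>+ x. f x \<partial>M) < \<infinity>" and c: "0 < c"
  shows "AE x in M. eventually (\<lambda>n. f ((T ^^ n) x) \<le> c * real n) sequentially"
proof -
  let ?I = "\<lambda>n x. indicator {x \<in> space M. c * real n < f x} x :: ennreal"
  have I: "(\<lambda>x. ?I n ((T ^^ n) x)) \<in> borel_measurable M" for n by measurable
  have "(\<integral>\<^sup>+ x. (\<Sum>n. ?I n ((T ^^ n) x)) \<partial>M) = (\<Sum>n. \<integral>\<^sup>+ x. ?I n ((T ^^ n) x) \<partial>M)"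
    by (rule nn_integral_suminf) (rule I)
  also have "\<dots> = (\<Sum>n. \<integral>\<^sup>+ x. ?I n x \<partial>M)"
    by (subst nn_integral_T_pow) auto
  also have "\<dots> = (\<integral>\<^sup>+ x. (\<Sum>n. ?I n x) \<partial>M)"
    by (rule nn_integral_suminf[symmetric]) auto
  also have "\<dots> \<le> (\<integral>\<^sup>+ x. ennreal (1 / c) * ennreal (f x) + 1 \<partial>M)"
  proof (rule nn_integral_mono)
    fix x assume x: "x \<in> space M"
    \<comment> \<open>At most m of the indices n satisfy c n < f x.\<close>
    define m where "m = nat \<lceil>f x / c\<rceil>"
    have "?I n x = 0" if "m \<le> n" for n
    proof -
      have "f x / c \<le> real n" using that by (simp add: m_def)
      then have "f x \<le> c * real n" using c by (simp add: field_simps)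
      then show ?thesis by (simp add: indicator_def)
    qed
    then have "(\<Sum>n. ?I n x) = (\<Sum>n<m. ?I n x)" by (intro suminf_finite) auto
    also have "\<dots> \<le> (\<Sum>n<m. 1)" by (intro sum_mono) (simp add: indicator_def)
    also have "\<dots> = ennreal (real m)" by (simp add: ennreal_of_nat_eq_real_of_nat)
    also have "\<dots> \<le> ennreal (1 / c * f x + 1)"
      using c f0[of x] by (intro ennreal_leI) (auto simp: m_def)
    also have "\<dots> = ennreal (1 / c) * ennreal (f x) + 1"
      using c f0[of x] ennreal_plus[of "f x / c" 1] by (simp add: ennreal_mult'[symmetric])
    finally show "(\<Sum>n. ?I n x) \<le> ennreal (1 / c) * ennreal (f x) + 1" .
  qed
  also have "\<dots> = ennreal (1 / c) * (\<integral>\<^sup>+ x. f x \<partial>M) + 1"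
    by (subst nn_integral_add) (auto simp: nn_integral_cmult emeasure_space_1)
  also have "\<dots> < \<infinity>" using int by (simp add: ennreal_mult_less_top)
  finally have "AE x in M. (\<Sum>n. ?I n ((T ^^ n) x)) \<noteq> \<infinity>"
    by (intro nn_integral_PInf_AE) auto
  then show ?thesis using AE_space
  proof eventually_elim
    fix x assume fin: "(\<Sum>n. ?I n ((T ^^ n) x)) \<noteq> \<infinity>" and x: "x \<in> space M"
    let ?r = "\<lambda>n. indicator {x \<in> space M. c * real n < f x} ((T ^^ n) x) :: real"
    have "(\<Sum>n. ennreal (?r n)) \<noteq> top" using fin by (simp add: ennreal_indicator)
    then have "summable ?r" by (intro summable_suminf_not_top) auto
    then have "?r \<longlonglongrightarrow> 0" by (rule summable_LIMSEQ_zero)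
    then have "eventually (\<lambda>n. ?r n < 1) sequentially"
      by (rule order_tendstoD) simp
    then show "eventually (\<lambda>n. f ((T ^^ n) x) \<le> c * real n) sequentially"
      using x T_pow_space by (auto elim!: eventually_mono simp: indicator_def not_less split: if_splits)
  qed
qed

end

section \<open>Expansion along the cone\<close>

text \<open>The cocycle is \<open>B\<close> composed with \<open>lt\<close>, so the almost sure
  conditions on A become conditions on every letter. \<open>0 < line_dist a w\<close> says that the
  line misses 0, as the lines of \<open>J_lines Th\<close> do.\<close>

locale theta_cocycle = symbolic_system M T lt K
  for M :: "'a measure" and T lt K +
  fixes B :: "int \<Rightarrow> real^'p^'p" and Th :: "(real^'p) set"
  assumes GL: "\<And>l. GL_int (B l)"
    and log_int: "integrable M (\<lambda>x. ln (mat_norm0 (B (lt x))))"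
    and Th_cone: "compact_proj Th"
    and Th_inv: "\<And>l w. w \<in> Th \<Longrightarrow> B l *v w \<in> Th"
    and Th_expand: "\<And>l w. w \<in> Th \<Longrightarrow> norm w \<le> norm (B l *v w)"
    and Th_grow: "\<And>w. w \<in> Th \<Longrightarrow>
          AE x in M. filterlim (\<lambda>n. norm (cocycle T (\<lambda>x. B (lt x)) n x *v w)) at_top sequentially"
    and no_cs: "\<And>a w. w \<in> Th \<Longrightarrow> 0 < line_dist a w \<Longrightarrow>
          AE x in M. aff_line a w \<inter> central_stable T (\<lambda>x. B (lt x)) x = {}"
begin

abbreviation "co \<equiv> cocycle T (\<lambda>x. B (lt x))"

definition lognorm :: "int \<Rightarrow> real" where
  "lognorm l = ln (mat_norm0 (B l))"

text \<open>An upper bound for the logarithm of the norms of the block and of its inverse. Unlike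
  these norms it is additive, so along an orbit it is a Birkhoff sum of an integrable
  function.\<close>

definition wlog :: "int list \<Rightarrow> real" where
  "wlog v = sum_list (map lognorm v)"

lemmas co_wmat = cocycle_eq_wmat[of T B lt]

lemma co_meas [measurable]: "(\<lambda>x. f (co n x) :: 'b::topological_space) \<in> borel_measurable M"
  unfolding co_wmat by (rule word_fun_meas)

lemma lognorm_nonneg: "0 \<le> lognorm l"
  using GL[of l] mat_norm0_bounds(3)[of "B l"] by (simp add: lognorm_def GL_int_def)

lemma exp_lognorm: "exp (lognorm l) = mat_norm0 (B l)"
  using GL[of l] mat_norm0_bounds(3)[of "B l"] by (simp add: lognorm_def GL_int_def)

lemma lognorm_bounds:
  "norm (B l *v v) \<le> exp (lognorm l) * norm v" "norm (matrix_inv (B l) *v v) \<le> exp (lognorm l) * norm v"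
  using GL[of l] mat_norm0_bounds[of "B l"] by (auto simp: exp_lognorm GL_int_def)

lemma lognorm_finite: "(\<integral>\<^sup>+ x. ennreal (lognorm (lt x)) \<partial>M) < \<infinity>"
  using log_int lognorm_nonneg unfolding lognorm_def[symmetric]
  by (simp add: integrable_iff_bounded)

lemma lognorm_meas [measurable]: "(\<lambda>x. lognorm (lt x)) \<in> borel_measurable M"
  by (rule measurable_compose[OF lt_meas]) simp

lemma wlog_nonneg: "0 \<le> wlog v"
  by (induction v) (auto simp: wlog_def lognorm_nonneg add_nonneg_nonneg)

lemma wmat_GL: "GL_int (wmat B v)"
  by (induction v) (auto simp: GL_int_one GL_int_mult GL)

lemma wmat_invertible: "invertible (wmat B v)"
  using wmat_GL by (auto simp: GL_int_def)

lemma wmat_bounds: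
  "norm (wmat B v *v w) \<le> exp (wlog v) * norm w"
  "norm (matrix_inv (wmat B v) *v w) \<le> exp (wlog v) * norm w"
proof (induction v arbitrary: w)
  case Nil
  { case 1 show ?case by (simp add: wlog_def) }
  { case 2 show ?case by (simp add: wlog_def matrix_inv_unique) }
next
  case (Cons l v)
  have e: "exp (wlog (l # v)) = exp (wlog v) * exp (lognorm l)" by (simp add: wlog_def exp_add)
  { case 1
    have "norm (wmat B (l # v) *v w) = norm (wmat B v *v (B l *v w))"
      by (simp add: matrix_vector_mul_assoc)
    also have "\<dots> \<le> exp (wlog v) * norm (B l *v w)" by (rule Cons)
    also have "\<dots> \<le> exp (wlog v) * (exp (lognorm l) * norm w)" by (intro mult_left_mono lognorm_bounds) auto
    finally show ?case by (simp add: e) }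
  { case 2
    have "matrix_inv (wmat B (l # v)) = matrix_inv (B l) ** matrix_inv (wmat B v)"
      using GL[of l] wmat_invertible by (simp add: matrix_inv_mult GL_int_def)
    then have "norm (matrix_inv (wmat B (l # v)) *v w) = norm (matrix_inv (B l) *v (matrix_inv (wmat B v) *v w))"
      by (simp add: matrix_vector_mul_assoc)
    also have "\<dots> \<le> exp (lognorm l) * norm (matrix_inv (wmat B v) *v w)" by (rule lognorm_bounds)
    also have "\<dots> \<le> exp (lognorm l) * (exp (wlog v) * norm w)" by (intro mult_left_mono Cons) auto
    finally show ?case by (simp add: e ac_simps) }
qed

lemma line_dist_wmat_ge: "line_dist a w \<le> exp (wlog v) * line_dist (wmat B v *v a) (wmat B v *v w)"
proof -
  have "line_dist (matrix_inv (wmat B v) *v (wmat B v *v a)) (matrix_inv (wmat B v) *v (wmat B v *v w))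
     \<le> exp (wlog v) * line_dist (wmat B v *v a) (wmat B v *v w)"
    by (rule line_dist_image_le) (rule wmat_bounds)
  then show ?thesis
    using wmat_invertible[of v] by (simp add: matrix_vector_mul_assoc matrix_inv_cancel)
qed

lemma line_dist_wmat_pos: "0 < line_dist a w \<Longrightarrow> 0 < line_dist (wmat B v *v a) (wmat B v *v w)"
  using line_dist_wmat_ge[of a w v] by (smt (verit) exp_gt_zero line_dist_nonneg mult_eq_0_iff)

lemma wmat_Th: "w \<in> Th \<Longrightarrow> wmat B v *v w \<in> Th \<and> norm w \<le> norm (wmat B v *v w)"
proof (induction v arbitrary: w)
  case (Cons l v)
  have "wmat B (l # v) *v w = wmat B v *v (B l *v w)" by (simp add: matrix_vector_mul_assoc)
  then show ?case using Cons.IH[OF Th_inv[OF Cons.prems, of l]] Th_expand[OF Cons.prems, of l] by auto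
qed simp

lemma Th_nonzero: "w \<in> Th \<Longrightarrow> w \<noteq> 0"
  using Th_cone by (auto simp: compact_proj_def proj_cone_def)

lemma co_Th: "w \<in> Th \<Longrightarrow> co n x *v w \<in> Th"
  by (simp add: co_wmat wmat_Th)

lemma co_add: "co (m + n) x *v w = co n ((T ^^ m) x) *v (co m x *v w)"
  by (simp add: cocycle_add matrix_vector_mul_assoc)

lemma co_norm_mono:
  assumes "w \<in> Th" "m \<le> n"
  shows "norm (co m x *v w) \<le> norm (co n x *v w)"
proof -
  have "norm (co m x *v w) \<le> norm (co (n - m) ((T ^^ m) x) *v (co m x *v w))"
    using wmat_Th[OF co_Th[OF assms(1), of m x]] by (simp add: co_wmat)
  then show ?thesis using assms co_add[of m "n - m" x w] by simp
qed

lemma Th_normalize: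
  assumes "w \<in> Th"
  shows "(1 / norm w) *\<^sub>R w \<in> Th \<inter> sphere 0 1"
  using assms Th_cone Th_nonzero[OF assms] by (auto simp: compact_proj_def proj_cone_def)

text \<open>By compactness of the directions some block length gives growth by a factor 4 outside a
  set of measure below 1 / (4 K), where the ratio is still at most 1. The inverse growth over a
  block thus has mean at most 1/4 + 1/4 on every cylinder, and \<open>cylint_tower\<close> iterates
  this.\<close>

lemma direction_growth:
  "\<exists>\<rho> C. 0 < \<rho> \<and> \<rho> < 1 \<and> 0 < C \<and> (\<forall>j u. \<forall>w \<in> Th.
      cylint u (\<lambda>x. ennreal (norm w / norm (co j x *v w))) \<le> ennreal (C * \<rho> ^ j) * emeasure M (cyl u))"
proof -
  define bad where "bad n w = {x \<in> space M. norm (co n x *v w) \<le> 4}" for n w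
  have badm[measurable]: "bad n w \<in> sets M" for n w
    unfolding bad_def by measurable
  have "\<exists>n. \<forall>w \<in> Th \<inter> sphere 0 1. prob (bad n w) < 1 / (4 * K)"
  proof (rule uniformly_small_on_compact)
    show "compact (Th \<inter> sphere 0 1)" using Th_cone by (simp add: compact_proj_def)
    show "bad n w \<subseteq> bad m w" if "w \<in> Th \<inter> sphere 0 1" "m \<le> n" for m n w
      using that co_norm_mono[of w m n] by (auto simp: bad_def intro: order.trans)
    show "closed {w \<in> Th \<inter> sphere 0 1. x \<in> bad m w}" if "x \<in> space M" for m x
    proof -
      have "{w \<in> Th \<inter> sphere 0 1. x \<in> bad m w} = Th \<inter> sphere 0 1 \<inter> {w. norm (co m x *v w) \<le> 4}"
        using that by (auto simp: bad_def)
      moreover have "closed {w. norm (co m x *v w) \<le> 4}"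
        by (intro closed_Collect_le continuous_intros)
      ultimately show ?thesis using \<open>compact (Th \<inter> sphere 0 1)\<close> by (simp add: closed_Int compact_imp_closed)
    qed
    show "AE x in M. \<exists>n. x \<notin> bad n w" if "w \<in> Th \<inter> sphere 0 1" for w
    proof -
      have "AE x in M. filterlim (\<lambda>n. norm (co n x *v w)) at_top sequentially" using Th_grow that by auto
      then show ?thesis
      proof eventually_elim
        fix x assume "filterlim (\<lambda>n. norm (co n x *v w)) at_top sequentially"
        then have "eventually (\<lambda>n. 4 < norm (co n x *v w)) sequentially"
          by (auto simp: filterlim_at_top_dense)
        then show "\<exists>n. x \<notin> bad n w" by (auto simp: bad_def eventually_sequentially not_le)
      qed
    qed
  qed (use K_pos in auto)
  then obtain n1 where n1: "\<And>w. w \<in> Th \<inter> sphere 0 1 \<Longrightarrow> prob (bad n1 w) < 1 / (4 * K)" by blast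
  \<comment> \<open>Positive, since times are divided by it; norms along Th do not decrease from
    time n1 to n0.\<close>
  define n0 where "n0 = Suc n1"
  have block: "cylint u (\<lambda>x. ennreal (norm w / norm (co n0 x *v w))) \<le> ennreal (1 / 2) * emeasure M (cyl u)"
    if w: "w \<in> Th" for u w
  proof -
    define w' where "w' = (1 / norm w) *\<^sub>R w"
    have w': "w' \<in> Th \<inter> sphere 0 1" unfolding w'_def by (rule Th_normalize[OF w])
    have q: "norm w / norm (co n0 x *v w) = 1 / norm (co n0 x *v w')" for x
      using Th_nonzero[OF w] by (simp add: w'_def matrix_vector_mult_scaleR)
    have pos: "1 \<le> norm (co n x *v w')" for n x
      using w' co_norm_mono[of w' 0 n x] by auto
    have "cylint u (\<lambda>x. ennreal (norm w / norm (co n0 x *v w)))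
        \<le> cylint u (\<lambda>x. ennreal (1 / 4) + indicator (bad n1 w') x)"
    proof (rule cylint_mono)
      fix x assume x: "x \<in> space M"
      show "ennreal (norm w / norm (co n0 x *v w)) \<le> ennreal (1 / 4) + indicator (bad n1 w') x"
      proof (cases "x \<in> bad n1 w'")
        case True
        have "ennreal (norm w / norm (co n0 x *v w)) \<le> ennreal 1"
          unfolding q using pos[of n0 x] by (intro ennreal_leI divide_le_eq_1_pos[THEN iffD2]) linarith+
        also have "\<dots> \<le> ennreal (1 / 4) + 1" by simp
        finally show ?thesis using True by simp
      next
        case False
        have "4 \<le> norm (co n0 x *v w')"
          using False x co_norm_mono[of w' n1 n0 x] w' by (simp add: bad_def n0_def del: cocycle.simps)
        then have "norm w / norm (co n0 x *v w) \<le> 1 / 4"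
          unfolding q by (intro divide_left_mono) (auto intro!: mult_pos_pos)
        then show ?thesis using False by (simp add: ennreal_leI)
      qed
    qed
    also have "\<dots> = ennreal (1 / 4) * emeasure M (cyl u) + cylint u (indicator (bad n1 w'))"
      by (subst cylint_add) (auto simp: cylint_const)
    also have "\<dots> \<le> ennreal (1 / 4) * emeasure M (cyl u) + ennreal (1 / 4) * emeasure M (cyl u)"
    proof (rule add_left_mono)
      have "cylint u (indicator (bad n1 w')) \<le> ennreal K * emeasure M (bad n1 w') * emeasure M (cyl u)"
        using cylint_le[of "indicator (bad n1 w')" u] by simp
      also have "\<dots> \<le> ennreal (1 / 4) * emeasure M (cyl u)"
      proof (rule mult_right_mono)
        have "ennreal K * emeasure M (bad n1 w') = ennreal (K * prob (bad n1 w'))"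
          using K_pos by (simp add: emeasure_eq_measure ennreal_mult')
        also have "\<dots> \<le> ennreal (1 / 4)"
          using n1[OF w'] K_pos by (intro ennreal_leI) (simp add: field_simps)
        finally show "ennreal K * emeasure M (bad n1 w') \<le> ennreal (1 / 4)" .
      qed simp
      finally show "cylint u (indicator (bad n1 w')) \<le> ennreal (1 / 4) * emeasure M (cyl u)" .
    qed
    also have "\<dots> = ennreal (1 / 2) * emeasure M (cyl u)"
      by (simp add: distrib_right[symmetric] ennreal_plus[symmetric] del: ennreal_plus)
    finally show ?thesis .
  qed
  have blocks: "cylint u (\<lambda>x. ennreal (norm w / norm (co (m * n0) x *v w))) \<le> ennreal ((1 / 2) ^ m) * emeasure M (cyl u)"
    if w: "w \<in> Th" for u w m
    using w
  proof (induction m arbitrary: w u)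
    case 0
    then show ?case using Th_nonzero[OF 0] by (simp add: cylint_const)
  next
    case (Suc m)
    \<comment> \<open>With the first block v fixed, the remaining ratio is that of the fixed vector
      \<open>wmat B v *v w\<close>, which is again in Th.\<close>
    define H where "H v y = ennreal (norm w / norm (wmat B v *v w))
       * ennreal (norm (wmat B v *v w) / norm (co (m * n0) y *v (wmat B v *v w)))" for v y
    have "cylint u (\<lambda>x. ennreal (norm w / norm (co (Suc m * n0) x *v w))) = cylint u (\<lambda>x. H (wd n0 x) ((T ^^ n0) x))"
    proof -
      have "ennreal (norm w / norm (co (Suc m * n0) x *v w)) = H (wd n0 x) ((T ^^ n0) x)" for x
      proof -
        have "wmat B (wd n0 x) *v w \<noteq> 0" using Th_nonzero wmat_Th[OF Suc.prems] by blast
        moreover have "co (Suc m * n0) x *v w = co (m * n0) ((T ^^ n0) x) *v (wmat B (wd n0 x) *v w)"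
          using co_add[of n0 "m * n0" x w] by (simp add: co_wmat)
        ultimately show ?thesis
          by (simp add: H_def ennreal_mult'[symmetric])
      qed
      then show ?thesis by simp
    qed
    also have "\<dots> \<le> cylint u (\<lambda>x. ennreal (norm w / norm (wmat B (wd n0 x) *v w)) * ennreal ((1 / 2) ^ m))"
    proof (rule cylint_tower)
      fix u v
      show "H v \<in> borel_measurable M" unfolding H_def by measurable
      have "cylint u (H v) = ennreal (norm w / norm (wmat B v *v w))
          * cylint u (\<lambda>y. ennreal (norm (wmat B v *v w) / norm (co (m * n0) y *v (wmat B v *v w))))"
        unfolding H_def by (rule cylint_cmult) measurable
      also have "\<dots> \<le> ennreal (norm w / norm (wmat B v *v w)) * (ennreal ((1 / 2) ^ m) * emeasure M (cyl u))"
        using Suc.IH wmat_Th[OF Suc.prems] by (intro mult_left_mono) auto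
      finally show "cylint u (H v) \<le> ennreal (norm w / norm (wmat B v *v w)) * ennreal ((1 / 2) ^ m) * emeasure M (cyl u)"
        by (simp add: mult.assoc)
    qed
    also have "\<dots> = ennreal ((1 / 2) ^ m) * cylint u (\<lambda>x. ennreal (norm w / norm (co n0 x *v w)))"
      by (subst cylint_cmult[symmetric]) (auto simp: co_wmat mult.commute)
    also have "\<dots> \<le> ennreal ((1 / 2) ^ m) * (ennreal (1 / 2) * emeasure M (cyl u))"
      by (intro mult_left_mono block[OF Suc.prems]) auto
    also have "\<dots> = ennreal ((1 / 2) ^ m * (1 / 2)) * emeasure M (cyl u)"
      by (subst ennreal_mult') (simp_all add: mult.assoc)
    also have "(1 / 2) ^ m * (1 / 2) = (1 / 2 :: real) ^ Suc m" by simp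
    finally show ?case .
  qed
  \<comment> \<open>The geometric rate equivalent to halving every n0 steps. The constant 2 below
    covers the incomplete last block, as j < (j div n0 + 1) * n0.\<close>
  define \<rho> where "\<rho> = (1 / 2 :: real) powr (1 / real n0)"
  have n0: "0 < n0" by (simp add: n0_def)
  show ?thesis
  proof (rule exI[of _ \<rho>], rule exI[of _ 2], intro conjI allI ballI)
    show "0 < \<rho>" by (simp add: \<rho>_def)
    show "\<rho> < 1" unfolding \<rho>_def using n0 by (simp add: powr_def ln_div)
    fix j u w assume w: "w \<in> Th"
    define m where "m = j div n0"
    have "(1 / 2) powr (real m + 1) \<le> (1 / 2 :: real) powr (real j / real n0)"
    proof (rule powr_mono')
      have "j < (m + 1) * n0" using n0 by (simp add: m_def dividend_less_div_times add.commute)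
      then have "real j < real ((m + 1) * n0)" by (simp only: of_nat_less_iff)
      then have "real j \<le> (real m + 1) * real n0" by (simp add: distrib_right)
      then show "real j / real n0 \<le> real m + 1" using n0 by (simp add: field_simps)
    qed auto
    moreover have "\<rho> ^ j = (1 / 2) powr (real j / real n0)"
      by (simp add: \<rho>_def powr_realpow[symmetric] powr_powr)
    moreover have "(1 / 2 :: real) powr (real m + 1) = (1 / 2) ^ m / 2" by (simp add: powr_add powr_realpow)
    ultimately have le: "(1 / 2) ^ m \<le> 2 * \<rho> ^ j" by simp
    have "cylint u (\<lambda>x. ennreal (norm w / norm (co j x *v w))) \<le> cylint u (\<lambda>x. ennreal (norm w / norm (co (m * n0) x *v w)))"
    proof (rule cylint_mono)
      fix x
      have "norm (co (m * n0) x *v w) \<le> norm (co j x *v w)"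
        by (rule co_norm_mono[OF w]) (simp add: m_def div_times_less_eq_dividend)
      moreover have "0 < norm (co (m * n0) x *v w)" using Th_nonzero[OF co_Th[OF w]] by simp
      ultimately show "ennreal (norm w / norm (co j x *v w)) \<le> ennreal (norm w / norm (co (m * n0) x *v w))"
        by (intro ennreal_leI divide_left_mono mult_pos_pos) (linarith | simp)+
    qed
    also have "\<dots> \<le> ennreal ((1 / 2) ^ m) * emeasure M (cyl u)" by (rule blocks[OF w])
    also have "\<dots> \<le> ennreal (2 * \<rho> ^ j) * emeasure M (cyl u)"
      by (intro mult_right_mono ennreal_leI le) auto
    finally show "cylint u (\<lambda>x. ennreal (norm w / norm (co j x *v w))) \<le> ennreal (2 * \<rho> ^ j) * emeasure M (cyl u)" .
  qed auto
qed

end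

section \<open>Lines recede exponentially\<close>

lemma eventually_le_imp_bound:
  fixes f h :: "nat \<Rightarrow> real"
  assumes "eventually (\<lambda>n. f n \<le> h n) sequentially" and h: "\<And>n. 0 < h n"
  shows "\<exists>D\<ge>0. \<forall>n. f n \<le> D * h n"
proof -
  obtain N where N: "\<And>n. n \<ge> N \<Longrightarrow> f n \<le> h n" using assms by (auto simp: eventually_sequentially)
  define D where "D = 1 + (\<Sum>n<N. \<bar>f n\<bar> / h n)"
  have D: "1 \<le> D" unfolding D_def using less_imp_le[OF h] by (simp add: sum_nonneg)
  have "f n \<le> D * h n" for n
  proof (cases "n < N")
    case True
    then have "\<bar>f n\<bar> / h n \<le> (\<Sum>n<N. \<bar>f n\<bar> / h n)"
      using less_imp_le[OF h] by (intro member_le_sum) auto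
    then have "\<bar>f n\<bar> / h n \<le> D" by (simp add: D_def)
    then have "\<bar>f n\<bar> \<le> D * h n" using h[of n] by (simp add: field_simps)
    then show ?thesis by simp
  next
    case False
    then have "f n \<le> 1 * h n" using N by simp
    also have "\<dots> \<le> D * h n" using D h[of n] by (intro mult_right_mono) auto
    finally show ?thesis .
  qed
  then show ?thesis using D by (intro exI[of _ D]) auto
qed

text \<open>If the lines \<open>P\<^sub>n(a + \<real>u)\<close> stay close to \<open>0\<close>, the preimages of their points closest to \<open>0\<close>
  converge, because the direction \<open>u\<close> is expanded; the limit is a single point with a slow orbit.\<close>

lemma shadowing_point:
  fixes P Q :: "nat \<Rightarrow> real^'p^'p" and c :: real
  assumes P_Suc: "\<And>n. P (Suc n) = Q n ** P n"
    and Q: "\<And>n v. norm v \<le> D2 * exp (c * n) * norm (Q n *v v)"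
    and dist: "\<And>n. line_dist (P n *v a) (P n *v u) \<le> D * exp (c * n)"
    and pos: "\<And>n. 0 < norm (P n *v u)"
    and summ: "\<And>n. summable (\<lambda>j. exp (3 * c * j) * (norm (P n *v u) / norm (P (n + j) *v u)))"
    and sum: "\<And>n. (\<Sum>j. exp (3 * c * j) * (norm (P n *v u) / norm (P (n + j) *v u))) \<le> D3 * exp (c * n)"
    and c: "0 < c" and D: "0 \<le> D" "0 \<le> D2" "0 \<le> D3"
  shows "\<exists>t C. \<forall>n. norm (P n *v (a + t *\<^sub>R u)) \<le> C * exp (4 * c * n)"
proof -
  define q where "q n = norm (P n *v u)" for n
  have q: "0 < q n" for n using pos by (simp add: q_def)
  have "\<exists>t. line_dist (P n *v a) (P n *v u) = norm (P n *v (a + t *\<^sub>R u))" for n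
    using line_dist_attained[of "P n *v a" "P n *v u"]
    by (auto simp: matrix_vector_right_distrib matrix_vector_mult_scaleR)
  then obtain t where t: "\<And>n. line_dist (P n *v a) (P n *v u) = norm (P n *v (a + t n *\<^sub>R u))" by metis
  have tn: "norm (P n *v (a + t n *\<^sub>R u)) \<le> D * exp (c * n)" for n using dist[of n] t by simp
  define D4 where "D4 = D + D2 * D * exp c"
  have D4: "0 \<le> D4" using D by (simp add: D4_def)
  \<comment> \<open>At time n both points have small images: the one with parameter t n by
    \<open>dist\<close>, the one with parameter t (Suc n) because its image is small one step later
    and going back costs at most D2 * exp (c n).\<close>
  have step: "\<bar>t (Suc n) - t n\<bar> * q n \<le> D4 * exp (2 * c * n)" for n
  proof -
    have "P n *v ((t (Suc n) - t n) *\<^sub>R u) = P n *v (a + t (Suc n) *\<^sub>R u) - P n *v (a + t n *\<^sub>R u)"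
      by (simp add: matrix_vector_mult_diff_distrib[symmetric] algebra_simps)
    then have "norm (P n *v ((t (Suc n) - t n) *\<^sub>R u)) \<le> norm (P n *v (a + t (Suc n) *\<^sub>R u)) + norm (P n *v (a + t n *\<^sub>R u))"
      by (simp add: norm_triangle_ineq4)
    then have "\<bar>t (Suc n) - t n\<bar> * q n \<le> norm (P n *v (a + t (Suc n) *\<^sub>R u)) + D * exp (c * n)"
      using tn[of n] by (simp add: q_def matrix_vector_mult_scaleR)
    also have "norm (P n *v (a + t (Suc n) *\<^sub>R u)) \<le> D2 * exp (c * n) * norm (P (Suc n) *v (a + t (Suc n) *\<^sub>R u))"
      using Q[of "P n *v (a + t (Suc n) *\<^sub>R u)" n] by (simp add: P_Suc matrix_vector_mul_assoc)
    also have "\<dots> \<le> D2 * exp (c * n) * (D * exp (c * Suc n))"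
      using D tn[of "Suc n"] by (intro mult_left_mono) auto
    also have "\<dots> = D2 * D * exp c * exp (2 * c * n)"
      by (simp add: exp_add[symmetric] algebra_simps)
    also have "D * exp (c * n) \<le> D * exp (2 * c * n)" using D c by (intro mult_left_mono) auto
    finally show ?thesis by (simp add: D4_def algebra_simps)
  qed
  \<comment> \<open>Measured at time n, the increment made at time n + j carries the factor q n / q
    (n + j). Summability of these ratios makes t converge.\<close>
  have tail: "\<bar>t (Suc (n + j)) - t (n + j)\<bar> * q n \<le> D4 * exp (2 * c * n) * (exp (3 * c * j) * (q n / q (n + j)))" for n j
  proof -
    have "\<bar>t (Suc (n + j)) - t (n + j)\<bar> * q n = \<bar>t (Suc (n + j)) - t (n + j)\<bar> * q (n + j) * (q n / q (n + j))"
      using q[of "n + j"] by simp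
    also have "\<dots> \<le> D4 * exp (2 * c * (n + j)) * (q n / q (n + j))"
      using step[of "n + j"] q[of n] q[of "n + j"] by (intro mult_right_mono) auto
    also have "\<dots> \<le> D4 * (exp (2 * c * n) * exp (3 * c * j)) * (q n / q (n + j))"
    proof -
      have "exp (2 * c * (n + j)) \<le> exp (2 * c * n) * exp (3 * c * j)"
        using c by (simp add: exp_add[symmetric] algebra_simps)
      then show ?thesis using q[of n] q[of "n + j"] D4 by (intro mult_right_mono mult_left_mono) auto
    qed
    finally show ?thesis by (simp add: ac_simps)
  qed
  have summ': "summable (\<lambda>j. \<bar>t (Suc (n + j)) - t (n + j)\<bar> * q n)" for n
  proof (rule summable_comparison_test'[where N=0])
    show "summable (\<lambda>j. D4 * exp (2 * c * n) * (exp (3 * c * j) * (q n / q (n + j))))"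
      using summ[of n] unfolding q_def by (intro summable_mult)
    show "norm (\<bar>t (Suc (n + j)) - t (n + j)\<bar> * q n) \<le> D4 * exp (2 * c * n) * (exp (3 * c * j) * (q n / q (n + j)))" for j
      using tail[of n j] q[of n] by simp
  qed
  have summ_t: "summable (\<lambda>j. \<bar>t (Suc (n + j)) - t (n + j)\<bar>)" for n
    using summable_mult[OF summ'[of n], of "1 / q n"] q[of n] by simp
  have "summable (\<lambda>j. t (Suc j) - t j)" using summ_t[of 0] by (auto intro: summable_rabs_cancel)
  then have "convergent (\<lambda>n. \<Sum>j<n. t (Suc j) - t j)" by (simp add: summable_iff_convergent)
  then have "convergent (\<lambda>n. t n - t 0)" by (simp add: sum_lessThan_telescope)
  then have "convergent t" using convergent_add_const_right_iff[of t "- t 0"] by simp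
  then obtain s where s: "t \<longlonglongrightarrow> s" by (auto simp: convergent_def)
  \<comment> \<open>The rates add: 2c from the increments and c from the sums of ratios.\<close>
  have close: "\<bar>s - t n\<bar> * q n \<le> D4 * D3 * exp (3 * c * n)" for n
  proof -
    have "(\<lambda>j. t (j + n)) \<longlonglongrightarrow> s" using s by (rule LIMSEQ_ignore_initial_segment)
    then have "(\<lambda>j. t (n + j)) \<longlonglongrightarrow> s" by (simp add: add.commute)
    from telescope_sums[OF this] have sums: "(\<lambda>j. t (Suc (n + j)) - t (n + j)) sums (s - t n)" by simp
    have "\<bar>s - t n\<bar> \<le> (\<Sum>j. \<bar>t (Suc (n + j)) - t (n + j)\<bar>)"
      using summable_rabs[OF summ_t[of n]] sums by (simp add: sums_iff)
    then have "\<bar>s - t n\<bar> * q n \<le> (\<Sum>j. \<bar>t (Suc (n + j)) - t (n + j)\<bar>) * q n"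
      using q[of n] by (intro mult_right_mono) auto
    also have "\<dots> = (\<Sum>j. \<bar>t (Suc (n + j)) - t (n + j)\<bar> * q n)"
      by (rule suminf_mult2[OF summ_t])
    also have "\<dots> \<le> (\<Sum>j. D4 * exp (2 * c * n) * (exp (3 * c * j) * (q n / q (n + j))))"
      using summ[of n] unfolding q_def[symmetric]
      by (intro suminf_le tail summ' summable_mult)
    also have "\<dots> = D4 * exp (2 * c * n) * (\<Sum>j. exp (3 * c * j) * (q n / q (n + j)))"
      using summ[of n] unfolding q_def[symmetric] by (rule suminf_mult)
    also have "\<dots> \<le> D4 * exp (2 * c * n) * (D3 * exp (c * n))"
      using sum[of n] D4 unfolding q_def[symmetric] by (intro mult_left_mono) auto
    also have "\<dots> = D4 * D3 * exp (3 * c * n)"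
      by (simp add: exp_add[symmetric] algebra_simps)
    finally show ?thesis .
  qed
  have "norm (P n *v (a + s *\<^sub>R u)) \<le> (D + D4 * D3) * exp (4 * c * n)" for n
  proof -
    have "P n *v (a + s *\<^sub>R u) = P n *v (a + t n *\<^sub>R u) + (s - t n) *\<^sub>R (P n *v u)"
      by (simp add: matrix_vector_right_distrib matrix_vector_mult_scaleR algebra_simps)
    then have "norm (P n *v (a + s *\<^sub>R u)) \<le> norm (P n *v (a + t n *\<^sub>R u)) + \<bar>s - t n\<bar> * q n"
      using norm_triangle_ineq[of "P n *v (a + t n *\<^sub>R u)" "(s - t n) *\<^sub>R (P n *v u)"] by (simp add: q_def)
    also have "\<dots> \<le> D * exp (c * n) + D4 * D3 * exp (3 * c * n)" using tn close by (intro add_mono)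
    also have "\<dots> \<le> D * exp (4 * c * n) + D4 * D3 * exp (4 * c * n)"
      using D D4 c by (intro add_mono mult_left_mono) auto
    finally show ?thesis by (simp add: distrib_right)
  qed
  then show ?thesis by blast
qed

lemma limsup_root_le_1:
  fixes y :: "nat \<Rightarrow> real"
  assumes y: "\<And>n. 0 \<le> y n" and b: "b \<longlonglongrightarrow> (0::real)"
    and C: "\<And>i. \<exists>C. \<forall>n. y n \<le> C * exp (b i * n)"
  shows "limsup (\<lambda>n. ereal (y n powr (1 / real n))) \<le> 1"
proof -
  have "limsup (\<lambda>n. ereal (y n powr (1 / real n))) \<le> ereal (exp (b i))" for i
  proof -
    obtain C where C: "\<And>n. y n \<le> C * exp (b i * n)" using C[of i] by blast
    define C' where "C' = \<bar>C\<bar> + 1"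
    have C': "0 < C'" by (simp add: C'_def)
    have "eventually (\<lambda>n. ereal (y n powr (1 / real n)) \<le> ereal (C' powr (1 / real n) * exp (b i))) sequentially"
      using eventually_gt_at_top[of 0]
    proof eventually_elim
      fix n :: nat assume n: "0 < n"
      have "C * exp (b i * n) \<le> C' * exp (b i * n)" by (intro mult_right_mono) (auto simp: C'_def)
      then have "y n powr (1 / real n) \<le> (C' * exp (b i * n)) powr (1 / real n)"
        using order.trans[OF C[of n]] y[of n] by (intro powr_mono2) auto
      also have "\<dots> = C' powr (1 / real n) * exp (b i)"
        using C' n by (simp add: powr_mult powr_def[of "exp _"])
      finally show "ereal (y n powr (1 / real n)) \<le> ereal (C' powr (1 / real n) * exp (b i))" by simp
    qed
    then have "limsup (\<lambda>n. ereal (y n powr (1 / real n))) \<le> limsup (\<lambda>n. ereal (C' powr (1 / real n) * exp (b i)))"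
      by (rule Limsup_mono)
    also have "\<dots> = ereal (exp (b i))"
    proof -
      have "(\<lambda>n. C' powr (1 / real n) * exp (b i)) \<longlonglongrightarrow> C' powr 0 * exp (b i)"
        using C' by (intro tendsto_intros lim_1_over_n) auto
      then have "(\<lambda>n. ereal (C' powr (1 / real n) * exp (b i))) \<longlonglongrightarrow> ereal (exp (b i))" using C' by simp
      then show ?thesis by (intro lim_imp_Limsup) auto
    qed
    finally show ?thesis .
  qed
  moreover have "(\<lambda>i. ereal (exp (b i))) \<longlonglongrightarrow> ereal (exp 0)"
    using b by (intro tendsto_intros)
  ultimately have "limsup (\<lambda>n. ereal (y n powr (1 / real n))) \<le> ereal (exp 0)"
    using LIMSEQ_le_const by blast
  then show ?thesis by (simp add: one_ereal_def)
qed

section \<open>Spaces of slowly growing vectors and the rate of recession of lines\<close>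

context theta_cocycle begin

text \<open>A filtration in b of Lyapunov type. A constant C valid at all times, in place of an
  upper limit, makes membership a union over natural C of intersections of closed conditions on
  finite words.\<close>

definition slow :: "real \<Rightarrow> 'a \<Rightarrow> (real^'p) set" where
  "slow b x = {v. \<exists>C. \<forall>n. norm (co n x *v v) \<le> C * exp (b * n)}"

lemma subspace_slow: "subspace (slow b x)"
proof (rule subspaceI)
  show "0 \<in> slow b x" by (auto simp: slow_def intro: exI[of _ 0])
  fix v w assume "v \<in> slow b x" "w \<in> slow b x"
  then obtain C C' where C: "\<And>n. norm (co n x *v v) \<le> C * exp (b * n)" "\<And>n. norm (co n x *v w) \<le> C' * exp (b * n)"
    by (auto simp: slow_def)
  have "norm (co n x *v (v + w)) \<le> (C + C') * exp (b * n)" for n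
    using norm_triangle_le[OF add_mono[OF C]] by (simp add: matrix_vector_right_distrib distrib_right)
  then show "v + w \<in> slow b x" by (auto simp: slow_def)
next
  fix r v assume "v \<in> slow b x"
  then obtain C where C: "\<And>n. norm (co n x *v v) \<le> C * exp (b * n)" by (auto simp: slow_def)
  have "norm (co n x *v (r *\<^sub>R v)) \<le> \<bar>r\<bar> * C * exp (b * n)" for n
    using mult_left_mono[OF C, of "\<bar>r\<bar>"] by (simp add: matrix_vector_mult_scaleR mult.assoc)
  then show "r *\<^sub>R v \<in> slow b x" by (auto simp: slow_def)
qed

lemma slow_mono: "b \<le> b' \<Longrightarrow> slow b x \<subseteq> slow b' x"
proof
  fix v assume b: "b \<le> b'" and "v \<in> slow b x"
  then obtain C where C: "\<And>n. norm (co n x *v v) \<le> C * exp (b * n)" by (auto simp: slow_def)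
  have "0 \<le> C" using order.trans[OF norm_ge_zero C[of 0]] by simp
  then have "C * exp (b * n) \<le> C * exp (b' * n)" for n :: nat
    using b by (intro mult_left_mono) (auto intro: mult_right_mono)
  then have "norm (co n x *v v) \<le> C * exp (b' * n)" for n using C[of n] order.trans by blast
  then show "v \<in> slow b' x" by (auto simp: slow_def)
qed

lemma slow_shift_iff: "B (lt x) *v v \<in> slow b (T x) \<longleftrightarrow> v \<in> slow b x"
proof -
  have e: "co n (T x) *v (B (lt x) *v v) = co (Suc n) x *v v" for n
    using co_add[of 1 n x v] by (simp add: matrix_vector_mul_assoc)
  show ?thesis
  proof
    assume "B (lt x) *v v \<in> slow b (T x)"
    then obtain C where C: "\<And>n. norm (co (Suc n) x *v v) \<le> C * exp (b * n)"
      unfolding slow_def mem_Collect_eq e by blast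
    define C' where "C' = norm v + C * exp (-b)"
    have C0: "0 \<le> C" using order.trans[OF norm_ge_zero C[of 0]] by simp
    have "norm (co n x *v v) \<le> C' * exp (b * n)" for n
    proof (cases n)
      case 0 then show ?thesis using C0 by (simp add: C'_def)
    next
      case (Suc m)
      have "norm (co n x *v v) \<le> C * exp (b * m)" using C[of m] Suc by simp
      also have "\<dots> = C * exp (-b) * exp (b * n)" by (simp add: Suc exp_add[symmetric] algebra_simps)
      also have "\<dots> \<le> C' * exp (b * n)" by (intro mult_right_mono) (auto simp: C'_def)
      finally show ?thesis .
    qed
    then show "v \<in> slow b x" by (auto simp: slow_def)
  next
    assume "v \<in> slow b x"
    then obtain C where C: "\<And>n. norm (co n x *v v) \<le> C * exp (b * n)" by (auto simp: slow_def)
    have "norm (co (Suc n) x *v v) \<le> C * exp b * exp (b * n)" for n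
      using C[of "Suc n"] by (simp add: exp_add[symmetric] algebra_simps del: cocycle.simps)
    then show "B (lt x) *v v \<in> slow b (T x)" unfolding slow_def mem_Collect_eq e by blast
  qed
qed

lemma dim_slow_shift: "dim (slow b (T x)) = dim (slow b x)"
proof (rule antisym)
  let ?B = "B (lt x)"
  have inv: "matrix_inv ?B ** ?B = mat 1" "?B ** matrix_inv ?B = mat 1"
    using GL[of "lt x"] matrix_inv_cancel by (auto simp: GL_int_def)
  have "slow b (T x) \<subseteq> (\<lambda>v. ?B *v v) ` slow b x"
  proof
    fix w assume w: "w \<in> slow b (T x)"
    have "w = ?B *v (matrix_inv ?B *v w)" using inv by (simp add: matrix_vector_mul_assoc)
    then show "w \<in> (\<lambda>v. ?B *v v) ` slow b x" using w slow_shift_iff by (metis image_eqI)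
  qed
  then show "dim (slow b (T x)) \<le> dim (slow b x)"
    using dim_subset dim_image_le[OF matrix_vector_mul_linear] order.trans by metis
  have "slow b x \<subseteq> (\<lambda>v. matrix_inv ?B *v v) ` slow b (T x)"
  proof
    fix w assume w: "w \<in> slow b x"
    have "w = matrix_inv ?B *v (?B *v w)" using inv by (simp add: matrix_vector_mul_assoc)
    then show "w \<in> (\<lambda>v. matrix_inv ?B *v v) ` slow b (T x)" using w slow_shift_iff by (metis image_eqI)
  qed
  then show "dim (slow b x) \<le> dim (slow b (T x))"
    using dim_subset dim_image_le[OF matrix_vector_mul_linear] order.trans by metis
qed

text \<open>Orthonormal families indexed by I, padded with zero rows so that they all live in the
  type of square matrices; the size of the family is encoded in I.\<close>

definition ortho_frames :: "'p set \<Rightarrow> (real^'p^'p) set" where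
  "ortho_frames I = {V. (\<forall>i\<in>I. \<forall>j\<in>I. V $ i \<bullet> V $ j = (if i = j then 1 else 0)) \<and> (\<forall>i. i \<notin> I \<longrightarrow> V $ i = 0)}"

lemma compact_ortho_frames: "compact (ortho_frames I)"
proof (rule compact_eq_bounded_closed[THEN iffD2], rule conjI)
  have "norm V \<le> (\<Sum>i\<in>(UNIV::'p set). 1)" if V: "V \<in> ortho_frames I" for V
  proof -
    have "norm (V $ i) \<le> 1" for i
      using V by (cases "i \<in> I") (auto simp: ortho_frames_def norm_eq_sqrt_inner)
    then have "(\<Sum>i\<in>UNIV. norm (V $ i)) \<le> (\<Sum>i\<in>(UNIV::'p set). 1)" by (intro sum_mono)
    then show ?thesis using L2_set_le_sum[of UNIV "\<lambda>i. norm (V $ i)"] unfolding norm_vec_def by simp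
  qed
  then show "bounded (ortho_frames I)" unfolding bounded_iff by blast
  have "ortho_frames I = (\<Inter>i\<in>I. \<Inter>j\<in>I. {V. V $ i \<bullet> V $ j = (if i = j then 1 else 0)}) \<inter> (\<Inter>i\<in>-I. {V. V $ i = 0})"
    by (auto simp: ortho_frames_def)
  moreover have "closed {V :: real^'p^'p. V $ i \<bullet> V $ j = (if i = j then 1 else 0)}" for i j
    by (intro closed_Collect_eq continuous_intros)
  moreover have "closed {V :: real^'p^'p. V $ i = 0}" for i
    by (intro closed_Collect_eq continuous_intros)
  ultimately show "closed (ortho_frames I)" by (simp add: closed_INT closed_Int)
qed

text \<open>Frames are compact, so frames that are slow up to each time m, with one common constant,
  yield a frame that is slow forever. The right side has only countable quantifiers in front of
  predicates of finite words.\<close>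

lemma dim_slow_ge_iff:
  "card I \<le> dim (slow b x) \<longleftrightarrow>
    (\<exists>C::nat. \<forall>m::nat. \<exists>V\<in>ortho_frames I. \<forall>n\<le>m. \<forall>i\<in>I. norm (co n x *v (V $ i)) \<le> C * exp (b * n))" (is "?l \<longleftrightarrow> ?r")
proof
  assume l: ?l
  obtain S where S: "S \<subseteq> slow b x" "pairwise orthogonal S" "\<And>v. v \<in> S \<Longrightarrow> norm v = 1" "card S = dim (slow b x)"
    using orthonormal_basis_subspace[OF subspace_slow] by metis
  obtain S' where S': "S' \<subseteq> S" "card S' = card I" "finite S'" using l S(4) by (metis obtain_subset_with_card_n)
  then obtain f where f: "bij_betw f I S'" using finite_same_card_bij[of I S'] by auto
  define V where "V = (\<chi> i. if i \<in> I then f i else 0)"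
  have fS: "f i \<in> S" if "i \<in> I" for i using f S' that by (auto simp: bij_betw_def)
  have V: "V \<in> ortho_frames I"
  proof -
    have "f i \<bullet> f j = (if i = j then 1 else 0)" if "i \<in> I" "j \<in> I" for i j
    proof (cases "i = j")
      case True then show ?thesis using S(3)[OF fS[OF that(1)]] by (simp add: norm_eq_sqrt_inner)
    next
      case False
      then have "f i \<noteq> f j" using f that by (auto simp: bij_betw_def inj_on_def)
      then show ?thesis using S(2) fS that False by (auto simp: pairwise_def orthogonal_def)
    qed
    then show ?thesis by (simp add: ortho_frames_def V_def)
  qed
  have "\<forall>i. \<exists>C. i \<in> I \<longrightarrow> (\<forall>n. norm (co n x *v f i) \<le> C * exp (b * n))"
    using fS S(1) by (auto simp: slow_def)
  then obtain C where C: "\<And>i n. i \<in> I \<Longrightarrow> norm (co n x *v f i) \<le> C i * exp (b * n)" by metis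
  obtain C' :: nat where C': "(\<Sum>i\<in>UNIV. \<bar>C i\<bar>) \<le> C'" using real_arch_simple by blast
  have "norm (co n x *v (V $ i)) \<le> C' * exp (b * n)" if "i \<in> I" for n i
  proof -
    have "C i \<le> C'" using member_le_sum[of i UNIV "\<lambda>i. \<bar>C i\<bar>"] C' by auto
    then have "C i * exp (b * n) \<le> C' * exp (b * n)" by (intro mult_right_mono) auto
    then show ?thesis using C[OF that, of n] that by (auto simp: V_def intro: order.trans)
  qed
  then show ?r using V by blast
next
  assume ?r
  then obtain C :: nat where
    C: "\<And>m. \<exists>V\<in>ortho_frames I. \<forall>n\<le>m. \<forall>i\<in>I. norm (co n x *v (V $ i)) \<le> C * exp (b * n)" by blast
  \<comment> \<open>Nested nonempty compact sets, whose common point is a frame slow at all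
    times.\<close>
  define F where "F m = ortho_frames I \<inter> (\<Inter>n\<in>{..m}. \<Inter>i\<in>I. {V. norm (co n x *v (V $ i)) \<le> C * exp (b * n)})" for m :: nat
  have "\<Inter>(range F) \<noteq> {}"
  proof (rule compact_nest)
    have "closed {V :: real^'p^'p. norm (co n x *v (V $ i)) \<le> C * exp (b * n)}" for n i
      by (intro closed_Collect_le continuous_intros
          continuous_on_compose2[OF matrix_vector_mult_linear_continuous_on[of UNIV]]) auto
    then show "compact (F m)" for m
      unfolding F_def using compact_ortho_frames by (intro compact_Int_closed closed_INT ballI)
    show "F m \<noteq> {}" for m using C[of m] by (auto simp: F_def)
    show "F n \<subseteq> F m" if "m \<le> n" for m n using that by (auto simp: F_def)
  qed
  then obtain V where V: "\<And>m. V \<in> F m" by blast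
  then have Vo: "V \<in> ortho_frames I" by (auto simp: F_def)
  have slow: "V $ i \<in> slow b x" if "i \<in> I" for i
    using V that unfolding slow_def F_def by (auto intro!: exI[of _ "real C"])
  have inj: "inj_on (\<lambda>i. V $ i) I"
  proof (rule inj_onI)
    fix i j assume ij: "i \<in> I" "j \<in> I" "V $ i = V $ j"
    have e: "V $ i \<bullet> V $ j = (if i = j then 1 else 0)" "V $ j \<bullet> V $ j = 1"
      using ij(1,2) Vo unfolding ortho_frames_def by auto
    show "i = j"
    proof (rule ccontr)
      assume "i \<noteq> j"
      then show False using e ij(3) by simp
    qed
  qed
  have "independent ((\<lambda>i. V $ i) ` I)"
  proof (rule pairwise_orthogonal_independent)
    show "pairwise orthogonal ((\<lambda>i. V $ i) ` I)"
      using Vo by (auto simp: pairwise_def orthogonal_def ortho_frames_def)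
    show "0 \<notin> (\<lambda>i. V $ i) ` I" using Vo by (force simp: ortho_frames_def)
  qed
  then have "card ((\<lambda>i. V $ i) ` I) \<le> dim (slow b x)"
    using slow by (intro independent_card_le_dim) auto
  then show ?l using inj by (simp add: card_image)
qed

text \<open>For fixed C and m the existence of a frame depends only on the first m letters, hence is
  measurable in spite of its uncountable quantifier.\<close>

lemma dim_slow_meas: "{x \<in> space M. card (I :: 'p set) \<le> dim (slow b x)} \<in> sets M"
proof -
  have "Measurable.pred M (\<lambda>x. \<exists>V\<in>ortho_frames I. \<forall>n\<le>m. \<forall>i\<in>I. norm (co n x *v (V $ i)) \<le> C * exp (b * n))" for m C :: nat
  proof -
    let ?P = "\<lambda>w. \<exists>V\<in>ortho_frames I. \<forall>n\<le>m. \<forall>i\<in>I. norm (wmat B (take n w) *v (V $ i)) \<le> C * exp (b * n)"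
    have "co n x = wmat B (take n (wd m x))" if "n \<le> m" for n x
      using word_add[of T lt n "m - n" x] that by (simp add: co_wmat)
    then have "(\<lambda>x. \<exists>V\<in>ortho_frames I. \<forall>n\<le>m. \<forall>i\<in>I. norm (co n x *v (V $ i)) \<le> C * exp (b * n)) = (\<lambda>x. ?P (wd m x))"
      by (intro ext) auto
    moreover have "Measurable.pred M (\<lambda>x. ?P (wd m x))"
      by (rule measurable_compose[OF word_meas]) simp
    ultimately show ?thesis by simp
  qed
  then show ?thesis unfolding dim_slow_ge_iff by measurable
qed

text \<open>The dimension is invariant under T, so by ergodicity each event k \<le> dim is null or
  full; d is the largest k for which it is full, with dimensions bounded by p.\<close>

lemma dim_slow_AE_const: "\<exists>d. AE x in M. dim (slow b x) = d"
proof -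
  have zo: "(AE x in M. k \<le> dim (slow b x)) \<or> (AE x in M. \<not> k \<le> dim (slow b x))" if k: "k \<le> CARD('p)" for k
  proof -
    obtain I :: "'p set" where I: "card I = k" using k by (metis obtain_subset_with_card_n)
    let ?S = "{x \<in> space M. k \<le> dim (slow b x)}"
    have S: "?S \<in> sets M" by (rule dim_slow_meas[of I b, unfolded I])
    moreover have "T -` ?S \<inter> space M = ?S"
      using measurable_space[OF T_meas] by (auto simp: dim_slow_shift)
    ultimately have "prob ?S = 0 \<or> prob ?S = 1" using erg unfolding ergodic_def by blast
    then show ?thesis
    proof
      assume "prob ?S = 0"
      then have "AE x in M. x \<notin> ?S" using prob_eq_0[OF S] by blast
      then have "AE x in M. \<not> k \<le> dim (slow b x)" using AE_space by eventually_elim blast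
      then show ?thesis ..
    next
      assume "prob ?S = 1"
      then have "AE x in M. x \<in> ?S" using prob_eq_1[OF S] by blast
      then have "AE x in M. k \<le> dim (slow b x)" by eventually_elim blast
      then show ?thesis ..
    qed
  qed
  let ?P = "\<lambda>k. k \<le> CARD('p) \<and> (AE x in M. k \<le> dim (slow b x))"
  define d where "d = (GREATEST k. ?P k)"
  have d: "?P d" unfolding d_def by (rule GreatestI_nat[where k=0 and b="CARD('p)"]) auto
  have "AE x in M. \<not> d < dim (slow b x)"
  proof (cases "d = CARD('p)")
    case True
    then show ?thesis using dim_subset_UNIV_cart by (auto simp: not_less)
  next
    case False
    then have "Suc d \<le> CARD('p)" using d by simp
    moreover have "\<not> ?P (Suc d)"
    proof
      assume "?P (Suc d)"
      then have "Suc d \<le> d" unfolding d_def by (intro Greatest_le_nat[where b="CARD('p)"]) auto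
      then show False by simp
    qed
    ultimately show ?thesis using zo[of "Suc d"] by (auto simp: Suc_le_eq)
  qed
  moreover have "AE x in M. d \<le> dim (slow b x)" using d by simp
  ultimately have "AE x in M. dim (slow b x) = d" by eventually_elim simp
  then show ?thesis by blast
qed

text \<open>The spaces for the rates 1 / (i + 1) decrease with i and have almost surely constant
  dimensions. Once the smallest dimension is reached they coincide, so a vector slow at that rate is
  slow at all smaller rates b i, which tend to 0.\<close>

lemma slow_subset_central_stable: "\<exists>c>0. AE x in M. slow c x \<subseteq> central_stable T (\<lambda>x. B (lt x)) x"
proof -
  define b where "b i = 1 / real (Suc i)" for i
  define d where "d i = (SOME d. AE x in M. dim (slow (b i) x) = d)" for i
  have d: "AE x in M. dim (slow (b i) x) = d i" for i
    unfolding d_def by (rule someI_ex) (rule dim_slow_AE_const)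
  define i0 where "i0 = (ARG_MIN d i. True)"
  have i0: "d i0 \<le> d i" for i unfolding i0_def by (rule arg_min_nat_le) simp
  have "AE x in M. \<forall>i. dim (slow (b i) x) = d i" using d by (simp add: AE_all_countable)
  then have "AE x in M. slow (b i0) x \<subseteq> central_stable T (\<lambda>x. B (lt x)) x"
  proof eventually_elim
    fix x assume dx: "\<forall>i. dim (slow (b i) x) = d i"
    show "slow (b i0) x \<subseteq> central_stable T (\<lambda>x. B (lt x)) x"
    proof
      fix v assume v: "v \<in> slow (b i0) x"
      have "v \<in> slow (b (i + i0)) x" for i
      proof -
        have "b (i + i0) \<le> b i0" by (simp add: b_def frac_le)
        then have "slow (b (i + i0)) x = slow (b i0) x"
          using dx i0 by (intro subspace_dim_equal subspace_slow slow_mono) auto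
        then show ?thesis using v by simp
      qed
      then have "\<exists>C. \<forall>n. norm (co n x *v v) \<le> C * exp (b (i + i0) * n)" for i by (auto simp: slow_def)
      moreover have "(\<lambda>i. b (i + i0)) \<longlonglongrightarrow> 0"
        unfolding b_def by (rule LIMSEQ_ignore_initial_segment) (use LIMSEQ_inverse_real_of_nat in \<open>simp add: inverse_eq_divide\<close>)
      ultimately have "limsup (\<lambda>n. ereal (norm (co n x *v v) powr (1 / real n))) \<le> 1"
        by (intro limsup_root_le_1) auto
      then show "v \<in> central_stable T (\<lambda>x. B (lt x)) x" by (simp add: central_stable_def)
    qed
  qed
  then show ?thesis by (intro exI[of _ "b i0"]) (auto simp: b_def)
qed

text \<open>The term with indices n and j has mean at most C0 (exp (3 c) \<rho>)^j, independently of
  n. Weighting by exp (- c n) gives a double series of finite mean, hence almost surely finite, and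
  its sum serves as D.\<close>

lemma AE_expansion_sums:
  fixes c :: real
  assumes \<rho>: "0 < \<rho>" "0 < C0"
    and growth: "\<And>j u w. w \<in> Th \<Longrightarrow>
      cylint u (\<lambda>x. ennreal (norm w / norm (co j x *v w))) \<le> ennreal (C0 * \<rho> ^ j) * emeasure M (cyl u)"
    and c: "0 < c" "exp (3 * c) * \<rho> < 1" and w: "w \<in> Th"
  shows "AE x in M. \<exists>D\<ge>0. \<forall>n.
     summable (\<lambda>j. exp (3 * c * j) * (norm (co n x *v w) / norm (co (n + j) x *v w))) \<and>
     (\<Sum>j. exp (3 * c * j) * (norm (co n x *v w) / norm (co (n + j) x *v w))) \<le> D * exp (c * n)"
proof -
  define Z where "Z n j x = exp (3 * c * j) * (norm (co n x *v w) / norm (co (n + j) x *v w))" for n j x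
  have Z0: "0 \<le> Z n j x" for n j x by (simp add: Z_def)
  have Zm[measurable]: "Z n j \<in> borel_measurable M" for n j unfolding Z_def by measurable
  have ZI: "(\<integral>\<^sup>+ x. ennreal (Z n j x) \<partial>M) \<le> ennreal (C0 * (exp (3 * c) * \<rho>) ^ j)" for n j
  proof -
    \<comment> \<open>Given the first n letters v, this is the ratio for the fixed vector
      \<open>wmat B v *v w\<close> of Th, to which \<open>growth\<close> applies on every
      cylinder.\<close>
    let ?H = "\<lambda>v y. ennreal (norm (wmat B v *v w) / norm (co j y *v (wmat B v *v w)))"
    have "(\<integral>\<^sup>+ x. ennreal (Z n j x) \<partial>M) = (\<integral>\<^sup>+ x. ennreal (exp (3 * c * j)) * ?H (wd n x) ((T ^^ n) x) \<partial>M)"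
      by (intro nn_integral_cong) (simp add: Z_def ennreal_mult'[symmetric] co_add co_wmat[of n])
    also have "\<dots> = ennreal (exp (3 * c * j)) * cylint [] (\<lambda>x. ?H (wd n x) ((T ^^ n) x))"
      unfolding cylint_Nil
    proof (rule nn_integral_cmult)
      have "(\<lambda>x. ennreal (norm (co n x *v w) / norm (co (n + j) x *v w))) \<in> borel_measurable M" by measurable
      then show "(\<lambda>x. ?H (wd n x) ((T ^^ n) x)) \<in> borel_measurable M" by (simp add: co_add co_wmat[of n])
    qed
    also have "cylint [] (\<lambda>x. ?H (wd n x) ((T ^^ n) x)) \<le> cylint [] (\<lambda>x. ennreal (C0 * \<rho> ^ j))"
      by (rule cylint_tower) (use growth wmat_Th[OF w] in auto)
    also have "\<dots> = ennreal (C0 * \<rho> ^ j)" by (simp add: cylint_Nil emeasure_space_1)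
    also have "ennreal (exp (3 * c * j)) * \<dots> = ennreal (C0 * (exp (3 * c) * \<rho>) ^ j)"
      using \<rho> by (simp add: ennreal_mult'[symmetric] power_mult_distrib exp_of_nat_mult[symmetric] ac_simps)
    finally show ?thesis by (simp add: mult_left_mono)
  qed
  define W where "W x = (\<Sum>n. ennreal (exp (- c * n)) * (\<Sum>j. ennreal (Z n j x)))" for x
  have "(\<integral>\<^sup>+ x. W x \<partial>M) = (\<Sum>n. ennreal (exp (- c * n)) * (\<Sum>j. \<integral>\<^sup>+ x. ennreal (Z n j x) \<partial>M))"
    unfolding W_def by (subst nn_integral_suminf) (auto simp: nn_integral_cmult nn_integral_suminf)
  also have "\<dots> \<le> (\<Sum>n. ennreal (exp (- c * n)) * (\<Sum>j. ennreal (C0 * (exp (3 * c) * \<rho>) ^ j)))"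
    by (intro suminf_le mult_left_mono ZI) auto
  also have "(\<Sum>j. ennreal (C0 * (exp (3 * c) * \<rho>) ^ j)) = ennreal (\<Sum>j. C0 * (exp (3 * c) * \<rho>) ^ j)"
    using \<rho> c by (intro suminf_ennreal2 summable_mult summable_geometric) auto
  also have "(\<Sum>n. ennreal (exp (- c * n)) * ennreal (\<Sum>j. C0 * (exp (3 * c) * \<rho>) ^ j))
      = (\<Sum>n. ennreal (exp (- c) ^ n)) * ennreal (\<Sum>j. C0 * (exp (3 * c) * \<rho>) ^ j)"
    by (simp add: exp_of_nat_mult[symmetric] mult.commute ennreal_suminf_multc)
  also have "(\<Sum>n. ennreal (exp (- c) ^ n)) = ennreal (\<Sum>n. exp (- c) ^ n)"
    using c by (intro suminf_ennreal2 summable_geometric) auto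
  also have "\<dots> * ennreal (\<Sum>j. C0 * (exp (3 * c) * \<rho>) ^ j) < \<infinity>"
    by (simp add: ennreal_mult_less_top)
  finally have "AE x in M. W x \<noteq> \<infinity>"
    by (intro nn_integral_PInf_AE) (auto simp: W_def)
  then show ?thesis
  proof eventually_elim
    fix x assume "W x \<noteq> \<infinity>"
    then obtain D where D: "0 \<le> D" "W x = ennreal D" by (cases "W x") auto
    have *: "ennreal (exp (- c * n)) * (\<Sum>j. ennreal (Z n j x)) \<le> ennreal D" for n :: nat
      unfolding D(2)[symmetric] W_def
      using sum_le_suminf[of "\<lambda>n. ennreal (exp (- c * n)) * (\<Sum>j. ennreal (Z n j x))" "{n}"] by simp
    have **: "(\<Sum>j. ennreal (Z n j x)) \<le> ennreal (D * exp (c * n))" for n :: nat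
    proof -
      have "(\<Sum>j. ennreal (Z n j x)) = ennreal (exp (c * n)) * (ennreal (exp (- c * n)) * (\<Sum>j. ennreal (Z n j x)))"
        by (simp add: mult.assoc[symmetric] ennreal_mult'[symmetric] exp_add[symmetric])
      also have "\<dots> \<le> ennreal (exp (c * n)) * ennreal D" by (intro mult_left_mono *) auto
      finally show ?thesis using D(1) by (simp add: ennreal_mult mult.commute)
    qed
    have summ: "summable (\<lambda>j. Z n j x)" for n
      using **[of n] Z0 by (intro summable_suminf_not_top) (auto simp: top_unique)
    moreover have "(\<Sum>j. Z n j x) \<le> D * exp (c * n)" for n
      using **[of n] suminf_ennreal2[OF Z0 summ[of n]] D(1) by simp
    ultimately show "\<exists>D\<ge>0. \<forall>n.
     summable (\<lambda>j. exp (3 * c * j) * (norm (co n x *v w) / norm (co (n + j) x *v w))) \<and>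
     (\<Sum>j. exp (3 * c * j) * (norm (co n x *v w) / norm (co (n + j) x *v w))) \<le> D * exp (c * n)"
      using D(1) unfolding Z_def by blast
  qed
qed

text \<open>Otherwise the distance stays below exp (c n) times its initial value, and
  \<open>shadowing_point\<close> puts a slow point on the line, inside the central stable space by
  the choice of c. A single such time n is enough for later use, since the argument restarts from
  the image line.\<close>

lemma line_divergence:
  "\<exists>c>0. \<forall>a. \<forall>w\<in>Th. 0 < line_dist a w \<longrightarrow>
     (AE x in M. \<exists>n\<ge>1. exp (c * n) * line_dist a w < line_dist (co n x *v a) (co n x *v w))"
proof -
  obtain c0 where c0: "0 < c0" "AE x in M. slow c0 x \<subseteq> central_stable T (\<lambda>x. B (lt x)) x"
    using slow_subset_central_stable by blast
  obtain \<rho> C0 where \<rho>: "0 < \<rho>" "\<rho> < 1" "0 < C0" and growth: "\<And>j u w. w \<in> Th \<Longrightarrow>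
      cylint u (\<lambda>x. ennreal (norm w / norm (co j x *v w))) \<le> ennreal (C0 * \<rho> ^ j) * emeasure M (cyl u)"
    using direction_growth by blast
  \<comment> \<open>The bound c0 / 4 places growth exp (4 c n) within \<open>slow c0\<close>; the
    bound with ln \<rho> makes exp (3 c) \<rho> less than 1, as the sums of ratios require.\<close>
  define c where "c = min (c0 / 4) (- ln \<rho> / 6)"
  have c: "0 < c" using c0 \<rho> by (simp add: c_def)
  have "c \<le> - ln \<rho> / 6" by (simp add: c_def)
  then have "3 * c + ln \<rho> < 0" using \<rho> ln_less_zero[of \<rho>] by linarith
  then have "exp (3 * c + ln \<rho>) < 1" by simp
  then have c3: "exp (3 * c) * \<rho> < 1" using \<rho> by (simp add: exp_add)
  have "AE x in M. \<exists>n\<ge>1. exp (c * n) * line_dist a w < line_dist (co n x *v a) (co n x *v w)"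
    if w: "w \<in> Th" and a: "0 < line_dist a w" for a w
  proof -
    have "AE x in M. \<exists>D\<ge>0. \<forall>n.
       summable (\<lambda>j. exp (3 * c * j) * (norm (co n x *v w) / norm (co (n + j) x *v w))) \<and>
       (\<Sum>j. exp (3 * c * j) * (norm (co n x *v w) / norm (co (n + j) x *v w))) \<le> D * exp (c * n)"
      by (rule AE_expansion_sums[OF \<rho>(1,3) _ c c3 w]) (rule growth)
    from c0(2) no_cs[OF w a] this
      AE_subexponential[of "\<lambda>x. lognorm (lt x)" c, OF lognorm_meas lognorm_nonneg lognorm_finite c]
  show ?thesis
  proof eventually_elim
    fix x
    assume x1: "slow c0 x \<subseteq> central_stable T (\<lambda>x. B (lt x)) x"
      and x2: "aff_line a w \<inter> central_stable T (\<lambda>x. B (lt x)) x = {}"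
      and x3: "\<exists>D\<ge>0. \<forall>n. summable (\<lambda>j. exp (3 * c * j) * (norm (co n x *v w) / norm (co (n + j) x *v w))) \<and>
        (\<Sum>j. exp (3 * c * j) * (norm (co n x *v w) / norm (co (n + j) x *v w))) \<le> D * exp (c * n)"
      and x4: "eventually (\<lambda>n. lognorm (lt ((T ^^ n) x)) \<le> c * real n) sequentially"
    show "\<exists>n\<ge>1. exp (c * n) * line_dist a w < line_dist (co n x *v a) (co n x *v w)"
    proof (rule ccontr)
      assume neg: "\<not> ?thesis"
      have dist: "line_dist (co n x *v a) (co n x *v w) \<le> line_dist a w * exp (c * n)" for n
      proof (cases "n = 0")
        case False
        then have "1 \<le> n" by simp
        then have "\<not> exp (c * n) * line_dist a w < line_dist (co n x *v a) (co n x *v w)" using neg by blast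
        then show ?thesis by (simp add: mult.commute)
      qed simp
      obtain D3 where D3: "D3 \<ge> 0"
        "\<And>n. summable (\<lambda>j. exp (3 * c * j) * (norm (co n x *v w) / norm (co (n + j) x *v w)))"
        "\<And>n. (\<Sum>j. exp (3 * c * j) * (norm (co n x *v w) / norm (co (n + j) x *v w))) \<le> D3 * exp (c * n)"
        using x3 by blast
      \<comment> \<open>Integrability of \<open>lognorm\<close> bounds the cost of inverting one
        step by a multiple of exp (c n).\<close>
      have "eventually (\<lambda>n. exp (lognorm (lt ((T ^^ n) x))) \<le> exp (c * real n)) sequentially"
        using x4 by eventually_elim simp
      from eventually_le_imp_bound[OF this] obtain D2 where
        D2: "D2 \<ge> 0" "\<And>n. exp (lognorm (lt ((T ^^ n) x))) \<le> D2 * exp (c * real n)" by auto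
      have Q: "norm v \<le> D2 * exp (c * n) * norm (B (lt ((T ^^ n) x)) *v v)" for n v
      proof -
        let ?l = "lt ((T ^^ n) x)"
        have "v = matrix_inv (B ?l) *v (B ?l *v v)"
          using GL[of ?l] by (simp add: matrix_vector_mul_assoc matrix_inv_cancel GL_int_def)
        then have "norm v \<le> exp (lognorm ?l) * norm (B ?l *v v)" using lognorm_bounds(2)[of ?l "B ?l *v v"] by simp
        also have "\<dots> \<le> D2 * exp (c * n) * norm (B ?l *v v)" using D2 by (intro mult_right_mono) auto
        finally show ?thesis .
      qed
      have "\<exists>t C. \<forall>n. norm (co n x *v (a + t *\<^sub>R w)) \<le> C * exp (4 * c * n)"
        by (rule shadowing_point[where Q="\<lambda>n. B (lt ((T ^^ n) x))", OF _ Q dist _ D3(2,3) c _ D2(1) D3(1)])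
           (use Th_nonzero[OF co_Th[OF w]] in auto)
      then obtain t where "a + t *\<^sub>R w \<in> slow (4 * c) x" by (auto simp: slow_def)
      moreover have "4 * c \<le> c0" by (simp add: c_def)
      ultimately have "a + t *\<^sub>R w \<in> central_stable T (\<lambda>x. B (lt x)) x" using x1 slow_mono by blast
      moreover have "a + t *\<^sub>R w \<in> aff_line a w" by (auto simp: aff_line_def)
      ultimately show False using x2 by blast
    qed
  qed
  qed
  then show ?thesis using c by blast
qed

end

section \<open>Contraction in the mean\<close>

lemma measurable_tail:
  fixes f :: "'a \<Rightarrow> real"
  assumes [measurable]: "f \<in> borel_measurable M"
  shows "(\<lambda>x. ennreal (f x) * indicator {x. r < f x} x) \<in> borel_measurable M"
proof -
  have "(\<lambda>x. ennreal (if r < f x then f x else 0)) \<in> borel_measurable M" by measurable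
  moreover have "(\<lambda>x. ennreal (if r < f x then f x else 0)) = (\<lambda>x. ennreal (f x) * indicator {x. r < f x} x)"
    by (auto simp: indicator_def fun_eq_iff)
  ultimately show ?thesis by simp
qed

lemma nn_integral_tail_small:
  fixes f :: "'a \<Rightarrow> real"
  assumes [measurable]: "f \<in> borel_measurable M" and f0: "\<And>x. 0 \<le> f x"
    and int: "(\<integral>\<^sup>+ x. f x \<partial>M) < \<infinity>" and e: "0 < e"
  shows "\<exists>R>0. (\<integral>\<^sup>+ x. ennreal (f x) * indicator {x. R < f x} x \<partial>M) \<le> ennreal e"
proof -
  let ?u = "\<lambda>n::nat. \<lambda>x. ennreal (f x) * indicator {x. real (Suc n) < f x} x"
  have "(\<lambda>n. \<integral>\<^sup>+ x. ?u n x \<partial>M) \<longlonglongrightarrow> (\<integral>\<^sup>+ x. 0 \<partial>M)"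
  proof (rule nn_integral_dominated_convergence[where w="\<lambda>x. ennreal (f x)"])
    show "AE x in M. (\<lambda>i. ?u i x) \<longlonglongrightarrow> 0"
    proof (rule AE_I2, rule tendsto_eventually)
      fix x
      obtain n :: nat where "f x \<le> n" using real_arch_simple by blast
      then show "eventually (\<lambda>i. ?u i x = 0) sequentially"
        by (intro eventually_sequentiallyI[of n]) (auto simp: indicator_def)
    qed
    show "AE x in M. ?u j x \<le> ennreal (f x)" for j by (simp add: indicator_def)
    show "(\<lambda>x. ?u i x) \<in> borel_measurable M" for i by (rule measurable_tail[OF assms(1)])
  qed (use int in auto)
  then have "eventually (\<lambda>n. (\<integral>\<^sup>+ x. ?u n x \<partial>M) < ennreal e) sequentially"
    using e by (intro order_tendstoD) auto
  then obtain n where "(\<integral>\<^sup>+ x. ?u n x \<partial>M) < ennreal e" by (auto simp: eventually_sequentially)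
  then show ?thesis by (intro exI[of _ "real (Suc n)"]) auto
qed

lemma (in prob_space) nn_integral_uniformly_small:
  fixes f :: "'a \<Rightarrow> real"
  assumes [measurable]: "f \<in> borel_measurable M" and f0: "\<And>x. 0 \<le> f x"
    and int: "(\<integral>\<^sup>+ x. f x \<partial>M) < \<infinity>" and e: "0 < e"
  shows "\<exists>\<eta>>0. \<forall>E\<in>events. prob E < \<eta> \<longrightarrow> (\<integral>\<^sup>+ x. ennreal (f x) * indicator E x \<partial>M) \<le> ennreal e"
proof -
  obtain R where R: "0 < R" "(\<integral>\<^sup>+ x. ennreal (f x) * indicator {x. R < f x} x \<partial>M) \<le> ennreal (e / 2)"
    using nn_integral_tail_small[OF assms(1-3), of "e / 2"] e by auto
  note m = measurable_tail[OF assms(1), of R]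
  have "(\<integral>\<^sup>+ x. ennreal (f x) * indicator E x \<partial>M) \<le> ennreal e"
    if [measurable]: "E \<in> events" and E: "prob E < e / (2 * R)" for E
  proof -
    have "(\<integral>\<^sup>+ x. ennreal (f x) * indicator E x \<partial>M)
        \<le> (\<integral>\<^sup>+ x. ennreal R * indicator E x + ennreal (f x) * indicator {x. R < f x} x \<partial>M)"
      by (intro nn_integral_mono) (auto simp: indicator_def intro: ennreal_leI)
    also have "\<dots> = ennreal R * emeasure M E + (\<integral>\<^sup>+ x. ennreal (f x) * indicator {x. R < f x} x \<partial>M)"
      by (subst nn_integral_add[OF _ m]) (auto simp: nn_integral_cmult_indicator)
    also have "\<dots> \<le> ennreal (e / 2) + ennreal (e / 2)"
    proof (rule add_mono[OF _ R(2)])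
      have "ennreal R * emeasure M E = ennreal (R * prob E)"
        using R by (simp add: emeasure_eq_measure ennreal_mult')
      also have "\<dots> \<le> ennreal (e / 2)" using E R by (intro ennreal_leI) (simp add: field_simps)
      finally show "ennreal R * emeasure M E \<le> ennreal (e / 2)" .
    qed
    also have "\<dots> = ennreal e" using e by (subst ennreal_plus[symmetric]) auto
    finally show ?thesis .
  qed
  then show ?thesis using e R by (intro exI[of _ "e / (2 * R)"]) auto
qed

section \<open>Bad times, the loss and the damped contraction\<close>

context theta_cocycle begin

definition bad :: "real \<Rightarrow> nat \<Rightarrow> 'a \<Rightarrow> real^'p \<Rightarrow> real^'p \<Rightarrow> bool" where
  "bad c m x a w \<longleftrightarrow> (\<forall>n\<in>{1..m}. line_dist (co n x *v a) (co n x *v w) \<le> exp (c * n) * line_dist a w)"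

lemma bad_meas [measurable]: "{x \<in> space M. bad c m x a w} \<in> sets M"
  unfolding bad_def by measurable

text \<open>Badness compares the distances with the initial one, so it is invariant under homothety
  and can be tested on orthonormal pairs. There the comparison is a closed condition, because images
  of directions in Th do not vanish.\<close>

lemma bad_uniformly_small:
  assumes div: "\<And>a w. w \<in> Th \<Longrightarrow> 0 < line_dist a w \<Longrightarrow>
       AE x in M. \<exists>n\<ge>1. exp (c * n) * line_dist a w < line_dist (co n x *v a) (co n x *v w)"
    and \<eta>: "0 < \<eta>"
  shows "\<exists>m. \<forall>a. \<forall>w\<in>Th. 0 < line_dist a w \<longrightarrow> prob {x \<in> space M. bad c m x a w} < \<eta>"
proof -
  \<comment> \<open>Pairs of closest point and unit direction, for the lines parallel to Th at
    distance 1 from 0.\<close>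
  define X where "X = (sphere 0 1 \<times> (Th \<inter> sphere 0 1)) \<inter> {J. fst J \<bullet> snd J = 0}"
  have X1: "line_dist (fst J) (snd J) = 1" if "J \<in> X" for J using that by (auto simp: X_def line_dist_def)
  have compX: "compact X"
  proof -
    have "closed {J :: (real^'p) \<times> (real^'p). fst J \<bullet> snd J = 0}"
      by (intro closed_Collect_eq continuous_intros)
    moreover have "compact (sphere (0::real^'p) 1 \<times> (Th \<inter> sphere 0 1))"
      using Th_cone by (simp add: compact_Times compact_proj_def)
    ultimately show ?thesis unfolding X_def by (rule compact_Int_closed[rotated])
  qed
  have "\<exists>m. \<forall>J\<in>X. prob {x \<in> space M. bad c m x (fst J) (snd J)} < \<eta>"
  proof (rule uniformly_small_on_compact[OF compX])
    show "{x \<in> space M. bad c n x (fst J) (snd J)} \<subseteq> {x \<in> space M. bad c m x (fst J) (snd J)}" if "m \<le> n" for m n J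
      using that by (auto simp: bad_def)
    show "closed {J \<in> X. x \<in> {x \<in> space M. bad c m x (fst J) (snd J)}}" if x: "x \<in> space M" for m x
    proof -
      have "{J \<in> X. x \<in> {x \<in> space M. bad c m x (fst J) (snd J)}}
          = X \<inter> (\<Inter>n\<in>{1..m}. {J \<in> X. line_dist (co n x *v fst J) (co n x *v snd J) \<le> exp (c * n) * line_dist (fst J) (snd J)})"
        using x by (auto simp: bad_def)
      moreover have "closed {J \<in> X. line_dist (co n x *v fst J) (co n x *v snd J) \<le> exp (c * n) * line_dist (fst J) (snd J)}" for n
      proof (rule continuous_on_closed_Collect_le)
        have nz: "snd J \<noteq> 0" "co n x *v snd J \<noteq> 0" if "J \<in> X" for J
          using that Th_nonzero[of "snd J"] Th_nonzero[OF co_Th, of "snd J" n x] by (auto simp: X_def)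
        have cont: "continuous_on X (\<lambda>J. co n x *v fst J)" "continuous_on X (\<lambda>J. co n x *v snd J)"
          by (rule continuous_on_compose2[OF matrix_vector_mult_linear_continuous_on[of UNIV]],
              auto intro!: continuous_intros)+
        show "continuous_on X (\<lambda>J. line_dist (co n x *v fst J) (co n x *v snd J))"
          using cont nz by (intro continuous_on_line_dist)
        show "continuous_on X (\<lambda>J. exp (c * n) * line_dist (fst J) (snd J))"
          using nz by (intro continuous_intros continuous_on_line_dist)
        show "closed X" using compX by (rule compact_imp_closed)
      qed
      ultimately show ?thesis using compact_imp_closed[OF compX] by (simp only:) (intro closed_Int closed_INT ballI)
    qed
    show "AE x in M. \<exists>n. x \<notin> {x \<in> space M. bad c n x (fst J) (snd J)}" if J: "J \<in> X" for J
    proof -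
      have "AE x in M. \<exists>n\<ge>1. exp (c * n) * line_dist (fst J) (snd J) < line_dist (co n x *v fst J) (co n x *v snd J)"
        using J X1[OF J] by (intro div) (auto simp: X_def)
      then show ?thesis
      proof eventually_elim
        fix x assume "\<exists>n\<ge>1. exp (c * n) * line_dist (fst J) (snd J) < line_dist (co n x *v fst J) (co n x *v snd J)"
        then obtain n where "1 \<le> n" "\<not> line_dist (co n x *v fst J) (co n x *v snd J) \<le> exp (c * n) * line_dist (fst J) (snd J)"
          by (auto simp: not_le)
        then have "\<not> bad c n x (fst J) (snd J)" by (auto simp: bad_def intro!: bexI[of _ n])
        then show "\<exists>n. x \<notin> {x \<in> space M. bad c n x (fst J) (snd J)}" by blast
      qed
    qed
  qed (use \<eta> in auto)
  then obtain m where m: "\<And>J. J \<in> X \<Longrightarrow> prob {x \<in> space M. bad c m x (fst J) (snd J)} < \<eta>" by blast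
  have "prob {x \<in> space M. bad c m x a w} < \<eta>" if w: "w \<in> Th" and a: "0 < line_dist a w" for a w
  proof -
    define a' where "a' = (1 / line_dist a w) *\<^sub>R (a - ((a \<bullet> w) / (w \<bullet> w)) *\<^sub>R w)"
    define w' where "w' = (1 / norm w) *\<^sub>R w"
    note n = line_dist_normalize[OF Th_nonzero[OF w] a, folded a'_def w'_def]
    have J: "(a', w') \<in> X" using n(1-3) Th_normalize[OF w] by (simp add: X_def w'_def)
    have "bad c m x a w \<longleftrightarrow> bad c m x a' w'" for x
      unfolding bad_def n(4) using a X1[OF J] by (simp add: mult.commute[of _ "line_dist a w"])
    then show ?thesis using m[OF J] by simp
  qed
  then show ?thesis by blast
qed

text \<open>The deficit with respect to the ideal gain c N. A charge consists of the missed gain c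
  and the worst approach to 0 in one step. The last m times are charged too, since a jump starting
  there might overshoot N.\<close>

definition loss :: "real \<Rightarrow> nat \<Rightarrow> nat \<Rightarrow> 'a \<Rightarrow> real^'p \<Rightarrow> real^'p \<Rightarrow> real" where
  "loss c m N x a w = (\<Sum>k<N. if bad c m ((T ^^ k) x) (co k x *v a) (co k x *v w) \<or> N \<le> k + m
     then c + lognorm (lt ((T ^^ k) x)) else 0)"

text \<open>The condition on the last m times is counted from the end, so removing an initial
  segment leaves the loss of the remaining orbit.\<close>

lemma loss_add:
  "loss c m (j + n) x a w =
     (\<Sum>k<j. if bad c m ((T ^^ k) x) (co k x *v a) (co k x *v w) \<or> j + n \<le> k + m
        then c + lognorm (lt ((T ^^ k) x)) else 0)
     + loss c m n ((T ^^ j) x) (co j x *v a) (co j x *v w)"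
proof -
  have "(T ^^ (j + k)) x = (T ^^ k) ((T ^^ j) x)" for k by (simp add: add.commute[of j] funpow_add)
  then show ?thesis
    unfolding loss_def lessThan_atLeast0
    by (subst sum.atLeastLessThan_concat[of 0 j "j + n", symmetric])
       (auto simp: sum.atLeastLessThan_shift_0[of _ j] co_add intro!: sum.cong)
qed

text \<open>The block decomposition of Katznelson and Weiss: along the orbit, jump ahead by a time interval over
  which the line recedes exponentially whenever there is one, and by a single step otherwise.\<close>

lemma line_dist_ge_exp_loss:
  assumes "0 \<le> c" "0 < line_dist a w"
  shows "line_dist a w * exp (c * N - loss c m N x a w) \<le> line_dist (co N x *v a) (co N x *v w)"
  using assms(2)
proof (induction N arbitrary: x a w rule: less_induct)
  case (less N)
  show ?case
  proof (cases "N = 0")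
    case True
    then show ?thesis by (simp add: loss_def)
  next
    case False
    show ?thesis
    proof (cases "bad c m x a w \<or> N \<le> m")
      \<comment> \<open>A single step: the present time is charged, and the charge pays for exactly
        what one step can lose.\<close>
      case True
      obtain n where n: "N = 1 + n" using False by (cases N) auto
      let ?a = "co 1 x *v a" and ?w = "co 1 x *v w"
      have e: "loss c m N x a w = c + lognorm (lt x) + loss c m n ((T ^^ 1) x) ?a ?w"
        unfolding n loss_add using True n by simp
      have d: "line_dist a w \<le> exp (lognorm (lt x)) * line_dist ?a ?w"
      proof -
        have "line_dist (matrix_inv (B (lt x)) *v ?a) (matrix_inv (B (lt x)) *v ?w) \<le> exp (lognorm (lt x)) * line_dist ?a ?w"
          by (rule line_dist_image_le) (rule lognorm_bounds)
        then show ?thesis using GL[of "lt x"] by (simp add: matrix_vector_mul_assoc matrix_inv_cancel GL_int_def)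
      qed
      then have d0: "0 < line_dist ?a ?w" using less.prems by (smt (verit) exp_gt_zero mult_nonneg_nonpos line_dist_nonneg zero_less_mult_iff)
      have "line_dist a w * exp (c * N - loss c m N x a w)
          \<le> exp (lognorm (lt x)) * line_dist ?a ?w * exp (c * N - loss c m N x a w)"
        using d by (intro mult_right_mono) auto
      also have "\<dots> = line_dist ?a ?w * exp (c * n - loss c m n ((T ^^ 1) x) ?a ?w)"
      proof -
        have "c * N - loss c m N x a w = - lognorm (lt x) + (c * n - loss c m n ((T ^^ 1) x) ?a ?w)"
          using e by (simp add: n algebra_simps)
        then show ?thesis by (simp only: exp_add exp_minus) simp
      qed
      also have "\<dots> \<le> line_dist (co n ((T ^^ 1) x) *v ?a) (co n ((T ^^ 1) x) *v ?w)"
        using n d0 by (intro less.IH) auto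
      also have "\<dots> = line_dist (co N x *v a) (co N x *v w)" unfolding n co_add ..
      finally show ?thesis .
    next
      case False
      \<comment> \<open>As N > m, a jump of j \<le> m steps stays within the time interval. The
        charges at the skipped times are nonnegative and are dropped.\<close>
      then obtain j where j: "1 \<le> j" "j \<le> m" "exp (c * j) * line_dist a w < line_dist (co j x *v a) (co j x *v w)"
        by (auto simp: bad_def not_le)
      obtain n where n: "N = j + n" using j False by (metis le_add_diff_inverse less_imp_le nat_le_linear not_le order_trans)
      let ?a = "co j x *v a" and ?w = "co j x *v w"
      have d0: "0 < line_dist ?a ?w" using j(3) less.prems by (smt (verit) exp_gt_zero mult_pos_pos)
      have e: "loss c m n ((T ^^ j) x) ?a ?w \<le> loss c m N x a w"
        unfolding n loss_add using lognorm_nonneg assms(1) by (simp add: sum_nonneg)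
      have "line_dist a w * exp (c * N - loss c m N x a w) \<le> line_dist a w * exp (c * N - loss c m n ((T ^^ j) x) ?a ?w)"
        using e less.prems by (intro mult_left_mono) auto
      also have "\<dots> = exp (c * j) * line_dist a w * exp (c * n - loss c m n ((T ^^ j) x) ?a ?w)"
      proof -
        have "c * N - loss c m n ((T ^^ j) x) ?a ?w = c * j + (c * n - loss c m n ((T ^^ j) x) ?a ?w)"
          unfolding n by (simp add: algebra_simps)
        then show ?thesis by (simp only: exp_add) simp
      qed
      also have "\<dots> \<le> line_dist ?a ?w * exp (c * n - loss c m n ((T ^^ j) x) ?a ?w)"
        using j(3) by (intro mult_right_mono) auto
      also have "\<dots> \<le> line_dist (co n ((T ^^ j) x) *v ?a) (co n ((T ^^ j) x) *v ?w)"
        using n j d0 by (intro less.IH) auto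
      also have "\<dots> = line_dist (co N x *v a) (co N x *v w)" unfolding n co_add ..
      finally show ?thesis .
    qed
  qed
qed

lemma wlog_word: "wlog (wd N x) = (\<Sum>k<N. lognorm (lt ((T ^^ k) x)))"
  unfolding wlog_def word_def by (simp add: comp_def interv_sum_list_conv_sum_set_nat lessThan_atLeast0)

lemma loss_bounds:
  assumes "0 \<le> c"
  shows "0 \<le> loss c m N x a w" "loss c m N x a w \<le> wlog (wd N x) + c * N"
proof -
  show "0 \<le> loss c m N x a w" unfolding loss_def using lognorm_nonneg assms by (intro sum_nonneg) auto
  have "loss c m N x a w \<le> (\<Sum>k<N. c + lognorm (lt ((T ^^ k) x)))"
    unfolding loss_def using lognorm_nonneg assms by (intro sum_mono) (simp add: add_nonneg_nonneg)
  then show "loss c m N x a w \<le> wlog (wd N x) + c * N" by (simp add: wlog_word sum.distrib mult.commute)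
qed

text \<open>The line in question moves with x; \<open>co_add\<close> rewrites the event as a
  comparison of distances at times k and k + n along the orbit of x.\<close>

lemma bad_pred [measurable]:
  "Measurable.pred M (\<lambda>x. bad c m ((T ^^ k) x) (co k x *v a) (co k x *v w))"
proof -
  define Q where "Q n x \<longleftrightarrow> line_dist (co (k + n) x *v a) (co (k + n) x *v w)
      \<le> exp (c * n) * line_dist (co k x *v a) (co k x *v w)" for n x
  have [measurable]: "Measurable.pred M (Q n)" for n
    unfolding Q_def pred_def by (intro borel_measurable_le co_meas)
  have "bad c m ((T ^^ k) x) (co k x *v a) (co k x *v w) \<longleftrightarrow> (\<forall>n\<in>{1..m}. Q n x)" for x
    by (simp add: bad_def Q_def co_add)
  then show ?thesis by simp
qed

lemma loss_meas [measurable]: "(\<lambda>x. loss c m N x a w) \<in> borel_measurable M"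
  unfolding loss_def by measurable

text \<open>Before the last m times a charge occurs only when the line reached so far is bad, which
  costs at most c / 4 in mean. The last m charges have bounded means, negligible for large N. Half
  of the ideal gain survives.\<close>

lemma mean_loss_small:
  assumes c: "0 < c" and div: "\<And>a w. w \<in> Th \<Longrightarrow> 0 < line_dist a w \<Longrightarrow>
       AE x in M. \<exists>n\<ge>1. exp (c * n) * line_dist a w < line_dist (co n x *v a) (co n x *v w)"
  shows "\<exists>m N. 1 \<le> N \<and> (\<forall>u a. \<forall>w\<in>Th. 0 < line_dist a w \<longrightarrow>
     cylint u (\<lambda>x. ennreal (loss c m N x a w)) \<le> ennreal (c * N / 2) * emeasure M (cyl u))"
proof -
  define r where "r x = c + lognorm (lt x)" for x
  have rm[measurable]: "r \<in> borel_measurable M" unfolding r_def by measurable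
  have r0: "0 \<le> r x" for x using c lognorm_nonneg by (simp add: r_def add_nonneg_nonneg less_imp_le)
  have "(\<integral>\<^sup>+ x. ennreal (r x) \<partial>M) = ennreal c + (\<integral>\<^sup>+ x. ennreal (lognorm (lt x)) \<partial>M)"
    unfolding r_def using c lognorm_nonneg by (simp add: nn_integral_add emeasure_space_1)
  then have rfin: "(\<integral>\<^sup>+ x. ennreal (r x) \<partial>M) < \<infinity>" using lognorm_finite by simp
  define C1 where "C1 = enn2real (\<integral>\<^sup>+ x. ennreal (r x) \<partial>M)"
  have C1: "(\<integral>\<^sup>+ x. ennreal (r x) \<partial>M) = ennreal C1" "0 \<le> C1" using rfin by (auto simp: C1_def)
  \<comment> \<open>The charge r is integrable, hence has small integral on all sets of small
    measure; the factor K pays for the passage from \<mu> to cylinders.\<close>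
  obtain \<eta> where \<eta>: "0 < \<eta>" "\<And>E. E \<in> events \<Longrightarrow> prob E < \<eta> \<Longrightarrow>
      (\<integral>\<^sup>+ x. ennreal (r x) * indicator E x \<partial>M) \<le> ennreal (c / (4 * K))"
    using nn_integral_uniformly_small[OF rm r0 rfin, of "c / (4 * K)"] c K_pos by auto
  obtain m where m: "\<And>a w. w \<in> Th \<Longrightarrow> 0 < line_dist a w \<Longrightarrow> prob {x \<in> space M. bad c m x a w} < \<eta>"
    using bad_uniformly_small[of c, OF div \<eta>(1)] by blast
  \<comment> \<open>Makes m charges of mean at most K C1 add up to at most c N / 4.\<close>
  obtain N0 :: nat where N0: "4 * m * K * C1 / c \<le> N0" using real_arch_simple by blast
  define N where "N = Suc N0"
  have N: "m * K * C1 \<le> c * N / 4"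
  proof -
    have "4 * m * K * C1 / c \<le> N" using N0 by (simp add: N_def)
    then show ?thesis using c by (simp add: field_simps)
  qed
  have "cylint u (\<lambda>x. ennreal (loss c m N x a w)) \<le> ennreal (c * N / 2) * emeasure M (cyl u)"
    if w: "w \<in> Th" and a: "0 < line_dist a w" for u a w
  proof -
    let ?P = "\<lambda>k x. bad c m ((T ^^ k) x) (co k x *v a) (co k x *v w)"
    define F where "F k x = ennreal (if ?P k x \<or> N \<le> k + m then r ((T ^^ k) x) else 0)" for k x
    have Fm: "F k \<in> borel_measurable M" for k unfolding F_def by measurable
    have last: "cylint u (F k) \<le> ennreal (K * C1) * emeasure M (cyl u)" for k
    proof -
      have "cylint u (F k) \<le> cylint u (\<lambda>x. ennreal (r ((T ^^ k) x)))"
        unfolding F_def using r0 by (intro cylint_mono) (auto intro: ennreal_leI)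
      also have "\<dots> \<le> cylint u (\<lambda>x. ennreal (K * C1))"
      proof (rule cylint_tower[where H="\<lambda>v y. ennreal (r y)" and h="\<lambda>v. ennreal (K * C1)"])
        fix u
        have "cylint u (\<lambda>y. ennreal (r y)) \<le> ennreal K * ennreal C1 * emeasure M (cyl u)"
          using cylint_le[of "\<lambda>y. ennreal (r y)" u] C1(1) by simp
        then show "cylint u (\<lambda>y. ennreal (r y)) \<le> ennreal (K * C1) * emeasure M (cyl u)"
          using K_pos by (simp add: ennreal_mult')
      qed measurable
      finally show ?thesis by (simp add: cylint_const)
    qed
    have early: "cylint u (F k) \<le> ennreal (c / 4) * emeasure M (cyl u)" if k: "\<not> N \<le> k + m" for k
    proof -
      \<comment> \<open>Once the first k letters v are fixed, badness concerns a fixed line, so the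
        choice of m, uniform over lines, applies to it.\<close>
      define H where "H v y = ennreal (r y) * indicator {x \<in> space M. bad c m x (wmat B v *v a) (wmat B v *v w)} y" for v y
      have "cylint u (F k) \<le> cylint u (\<lambda>x. H (wd k x) ((T ^^ k) x))"
        using k T_pow_space by (intro cylint_mono) (auto simp: F_def H_def co_wmat indicator_def)
      also have "\<dots> \<le> cylint u (\<lambda>x. ennreal (c / 4))"
      proof (rule cylint_tower[where H=H and h="\<lambda>v. ennreal (c / 4)"])
        fix u v
        show Hm: "H v \<in> borel_measurable M" unfolding H_def by measurable
        have wv: "wmat B v *v w \<in> Th" using wmat_Th[OF w] by blast
        have "line_dist (wmat B v *v a) (wmat B v *v w) > 0" by (rule line_dist_wmat_pos[OF a])
        then have "(\<integral>\<^sup>+ x. H v x \<partial>M) \<le> ennreal (c / (4 * K))"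
          unfolding H_def using m[OF wv] by (intro \<eta>) auto
        then have "ennreal K * (\<integral>\<^sup>+ x. H v x \<partial>M) \<le> ennreal K * ennreal (c / (4 * K))" by (intro mult_left_mono) auto
        also have "\<dots> = ennreal (c / 4)" using K_pos by (simp add: ennreal_mult'[symmetric])
        finally have "ennreal K * (\<integral>\<^sup>+ x. H v x \<partial>M) * emeasure M (cyl u) \<le> ennreal (c / 4) * emeasure M (cyl u)"
          by (intro mult_right_mono) auto
        then show "cylint u (H v) \<le> ennreal (c / 4) * emeasure M (cyl u)"
          using cylint_le[OF Hm, of u] by (rule order.trans[rotated])
      qed
      finally show ?thesis by (simp add: cylint_const)
    qed
    have "cylint u (\<lambda>x. ennreal (loss c m N x a w)) = cylint u (\<lambda>x. \<Sum>k<N. F k x)"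
    proof -
      have "ennreal (loss c m N x a w) = (\<Sum>k<N. F k x)" for x
        unfolding loss_def F_def r_def[symmetric] using r0 by (subst sum_ennreal) auto
      then show ?thesis by simp
    qed
    also have "\<dots> = (\<Sum>k<N. cylint u (F k))" by (rule cylint_sum[OF Fm])
    also have "\<dots> \<le> (\<Sum>k<N. ennreal (c / 4 + (if N \<le> k + m then K * C1 else 0)) * emeasure M (cyl u))"
    proof (rule sum_mono)
      fix k
      show "cylint u (F k) \<le> ennreal (c / 4 + (if N \<le> k + m then K * C1 else 0)) * emeasure M (cyl u)"
      proof (cases "N \<le> k + m")
        case True
        have "cylint u (F k) \<le> ennreal (K * C1) * emeasure M (cyl u)" by (rule last)
        also have "\<dots> \<le> ennreal (c / 4 + K * C1) * emeasure M (cyl u)" using c by (intro mult_right_mono ennreal_leI) auto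
        finally show ?thesis using True by simp
      qed (use early in auto)
    qed
    also have "\<dots> = ennreal (\<Sum>k<N. c / 4 + (if N \<le> k + m then K * C1 else 0)) * emeasure M (cyl u)"
      using c K_pos C1 by (subst sum_ennreal[symmetric]) (auto simp: sum_distrib_right)
    also have "\<dots> \<le> ennreal (c * N / 2) * emeasure M (cyl u)"
    proof (intro mult_right_mono ennreal_leI)
      have "(\<Sum>k<N. if N \<le> k + m then K * C1 else 0) = (\<Sum>k | k < N \<and> N \<le> k + m. K * C1)"
        by (subst sum.inter_filter[symmetric]) (auto simp: lessThan_def)
      also have "\<dots> = card {k. k < N \<and> N \<le> k + m} * (K * C1)" by simp
      also have "\<dots> \<le> m * (K * C1)"
      proof (rule mult_right_mono)
        have "card {k. k < N \<and> N \<le> k + m} \<le> card {N - m..<N}" by (intro card_mono) auto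
        then show "real (card {k. k < N \<and> N \<le> k + m}) \<le> real m" by simp
      qed (use K_pos C1 in auto)
      also have "\<dots> \<le> c * N / 4" using N by (simp add: mult.assoc)
      finally show "(\<Sum>k<N. c / 4 + (if N \<le> k + m then K * C1 else 0)) \<le> c * N / 2"
        by (simp add: sum.distrib algebra_simps)
    qed simp
    finally show ?thesis .
  qed
  then show ?thesis by (intro exI[of _ m] exI[of _ N]) (auto simp: N_def)
qed

text \<open>Beyond the threshold the ratio of distances is at most exp (wlog v); the damping cancels
  its \<alpha>-th power and still leaves the ideal factor exp (- \<alpha> s). Up to the threshold
  the loss, at most wlog v + s, is bounded by R.\<close>

definition damp :: "real \<Rightarrow> real \<Rightarrow> real \<Rightarrow> int list \<Rightarrow> real" where
  "damp \<alpha> R s v = (if wlog v + s \<le> R then 1 else exp (- \<alpha> * (wlog v + s)))"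

text \<open>For small \<alpha> the mean of exp (\<alpha> loss) is governed by its linear term, and
  the mean loss is at most s / 2. N and s are obtained before \<alpha> and R, which can therefore
  still be adapted to the tails of the block norms.\<close>

lemma block_contraction:
  "\<exists>N s. 1 \<le> N \<and> 0 < s \<and> (\<forall>\<alpha> R. 0 < \<alpha> \<longrightarrow> 4 * \<alpha> * R \<le> 1 \<longrightarrow> (\<forall>u a. \<forall>w\<in>Th. 0 < line_dist a w \<longrightarrow>
     cylint u (\<lambda>x. ennreal (damp \<alpha> R s (wd N x) * (line_dist a w / line_dist (co N x *v a) (co N x *v w)) powr \<alpha>))
       \<le> ennreal (exp (- (3/8) * \<alpha> * s)) * emeasure M (cyl u)))"
proof -
  obtain c where c: "0 < c" and div: "\<And>a w. w \<in> Th \<Longrightarrow> 0 < line_dist a w \<Longrightarrow>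
     AE x in M. \<exists>n\<ge>1. exp (c * n) * line_dist a w < line_dist (co n x *v a) (co n x *v w)"
    using line_divergence by blast
  obtain m N where N: "1 \<le> N" and loss: "\<And>u a w. w \<in> Th \<Longrightarrow> 0 < line_dist a w \<Longrightarrow>
     cylint u (\<lambda>x. ennreal (loss c m N x a w)) \<le> ennreal (c * N / 2) * emeasure M (cyl u)"
    using mean_loss_small[OF c div] by blast
  \<comment> \<open>The ideal gain of a block, in the logarithmic scale.\<close>
  define s where "s = c * N"
  have s: "0 < s" using c N by (simp add: s_def)
  have "cylint u (\<lambda>x. ennreal (damp \<alpha> R s (wd N x) * (line_dist a w / line_dist (co N x *v a) (co N x *v w)) powr \<alpha>))
       \<le> ennreal (exp (- (3/8) * \<alpha> * s)) * emeasure M (cyl u)"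
    if \<alpha>: "0 < \<alpha>" "4 * \<alpha> * R \<le> 1" and w: "w \<in> Th" and a: "0 < line_dist a w" for \<alpha> R u a w
  proof -
    have pw: "damp \<alpha> R s (wd N x) * (line_dist a w / line_dist (co N x *v a) (co N x *v w)) powr \<alpha>
        \<le> exp (- \<alpha> * s) * (1 + 5 / 4 * \<alpha> * loss c m N x a w)" for x
    proof -
      let ?d = "line_dist (co N x *v a) (co N x *v w)" and ?L = "loss c m N x a w"
      have d: "0 < ?d" unfolding co_wmat by (rule line_dist_wmat_pos[OF a])
      have L: "0 \<le> ?L" "?L \<le> wlog (wd N x) + s" using loss_bounds[of c m N x a w] c by (auto simp: s_def)
      show ?thesis
      proof (cases "wlog (wd N x) + s \<le> R")
        case True
        have "line_dist a w / ?d \<le> exp (?L - s)"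
          using line_dist_ge_exp_loss[of c a w N m x] a c d
          by (simp add: s_def field_simps exp_diff)
        then have "(line_dist a w / ?d) powr \<alpha> \<le> exp (?L - s) powr \<alpha>"
          using a d \<alpha> by (intro powr_mono2) auto
        also have "\<dots> = exp (- \<alpha> * s) * exp (\<alpha> * ?L)"
          by (simp add: powr_def exp_add[symmetric] algebra_simps)
        \<comment> \<open>Here \<alpha> loss \<le> \<alpha> R \<le> 1/4, so the quadratic term is at
          most a quarter of the linear one, whence 5/4. With mean loss s / 2 this becomes exp (5/8
          \<alpha> s), and 1 - 5/8 is the final 3/8.\<close>
        also have "exp (\<alpha> * ?L) \<le> 1 + \<alpha> * ?L + (\<alpha> * ?L)\<^sup>2"
        proof (rule exp_bound)
          show "0 \<le> \<alpha> * ?L" using \<alpha> L by simp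
          have "\<alpha> * ?L \<le> \<alpha> * R" using True L \<alpha> by (intro mult_left_mono) auto
          then show "\<alpha> * ?L \<le> 1" using \<alpha> by linarith
        qed
        also have "(\<alpha> * ?L)\<^sup>2 \<le> \<alpha> * ?L * (1 / 4)"
        proof -
          have "\<alpha> * ?L \<le> \<alpha> * R" using True L \<alpha> by (intro mult_left_mono) auto
          then have "\<alpha> * ?L \<le> 1 / 4" using \<alpha> by linarith
          then show ?thesis unfolding power2_eq_square using \<alpha> L by (intro mult_left_mono) auto
        qed
        finally show ?thesis using True by (simp add: damp_def algebra_simps)
      next
        case False
        have "line_dist a w / ?d \<le> exp (wlog (wd N x))"
          using line_dist_wmat_ge[of a w "wd N x"] d unfolding co_wmat by (simp add: field_simps)
        then have "(line_dist a w / ?d) powr \<alpha> \<le> exp (wlog (wd N x)) powr \<alpha>"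
          using a d \<alpha> by (intro powr_mono2) auto
        then have "damp \<alpha> R s (wd N x) * (line_dist a w / ?d) powr \<alpha> \<le> exp (- \<alpha> * (wlog (wd N x) + s)) * exp (wlog (wd N x)) powr \<alpha>"
          using False by (simp add: damp_def)
        also have "\<dots> = exp (- \<alpha> * s) * 1" by (simp add: powr_def exp_add[symmetric] algebra_simps)
        also have "\<dots> \<le> exp (- \<alpha> * s) * (1 + 5 / 4 * \<alpha> * ?L)" using \<alpha> L by (intro mult_left_mono) auto
        finally show ?thesis .
      qed
    qed
    have "cylint u (\<lambda>x. ennreal (damp \<alpha> R s (wd N x) * (line_dist a w / line_dist (co N x *v a) (co N x *v w)) powr \<alpha>))
        \<le> cylint u (\<lambda>x. ennreal (exp (- \<alpha> * s)) * (1 + ennreal (5 / 4 * \<alpha>) * ennreal (loss c m N x a w)))"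
    proof (rule cylint_mono)
      fix x
      have L: "0 \<le> loss c m N x a w" using loss_bounds[of c m N x a w] c by auto
      have "ennreal (exp (- \<alpha> * s)) * (1 + ennreal (5 / 4 * \<alpha>) * ennreal (loss c m N x a w))
         = ennreal (exp (- \<alpha> * s) * (1 + 5 / 4 * \<alpha> * loss c m N x a w))"
      proof -
        have "1 + ennreal (5 / 4 * \<alpha>) * ennreal (loss c m N x a w) = ennreal (1 + 5 / 4 * \<alpha> * loss c m N x a w)"
          using \<alpha> L ennreal_plus[of 1 "5 / 4 * \<alpha> * loss c m N x a w"] by (simp add: ennreal_mult[symmetric])
        then show ?thesis using \<alpha> L by (simp add: ennreal_mult)
      qed
      then show "ennreal (damp \<alpha> R s (wd N x) * (line_dist a w / line_dist (co N x *v a) (co N x *v w)) powr \<alpha>)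
        \<le> ennreal (exp (- \<alpha> * s)) * (1 + ennreal (5 / 4 * \<alpha>) * ennreal (loss c m N x a w))"
        using ennreal_leI[OF pw[of x]] by simp
    qed
    also have "\<dots> = ennreal (exp (- \<alpha> * s)) * (emeasure M (cyl u) + ennreal (5 / 4 * \<alpha>) * cylint u (\<lambda>x. ennreal (loss c m N x a w)))"
      by (subst cylint_cmult, measurable, subst cylint_add, measurable, subst cylint_cmult, measurable)
         (simp add: cylint_const)
    also have "\<dots> \<le> ennreal (exp (- \<alpha> * s)) * (emeasure M (cyl u) + ennreal (5 / 4 * \<alpha>) * (ennreal (s / 2) * emeasure M (cyl u)))"
      using loss[OF w a, of u] unfolding s_def[symmetric] by (intro mult_left_mono add_left_mono) auto
    also have "\<dots> = ennreal (exp (- \<alpha> * s) * (1 + 5 / 8 * \<alpha> * s)) * emeasure M (cyl u)"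
    proof -
      have "ennreal (1 + 5 / 8 * \<alpha> * s) = 1 + ennreal (5 / 4 * \<alpha>) * ennreal (s / 2)"
        using \<alpha> s by (subst ennreal_mult[symmetric], simp, simp) (simp add: ennreal_plus[symmetric] ennreal_1[symmetric] del: ennreal_plus ennreal_1)
      then have "emeasure M (cyl u) + ennreal (5 / 4 * \<alpha>) * (ennreal (s / 2) * emeasure M (cyl u))
          = ennreal (1 + 5 / 8 * \<alpha> * s) * emeasure M (cyl u)"
        by (simp only: distrib_right mult.assoc mult_1)
      then show ?thesis using \<alpha> s by (simp only: mult.assoc[symmetric]) (simp add: ennreal_mult)
    qed
    also have "\<dots> \<le> ennreal (exp (- (3/8) * \<alpha> * s)) * emeasure M (cyl u)"
    proof (intro mult_right_mono ennreal_leI)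
      have "1 + 5 / 8 * \<alpha> * s \<le> exp (5 / 8 * \<alpha> * s)" by (rule exp_ge_add_one_self)
      then have "exp (- \<alpha> * s) * (1 + 5 / 8 * \<alpha> * s) \<le> exp (- \<alpha> * s) * exp (5 / 8 * \<alpha> * s)" by (intro mult_left_mono) auto
      then show "exp (- \<alpha> * s) * (1 + 5 / 8 * \<alpha> * s) \<le> exp (- (3/8) * \<alpha> * s)" by (simp add: exp_add[symmetric] algebra_simps)
    qed simp
    finally show ?thesis .
  qed
  then show ?thesis using N s by blast
qed

end

section \<open>The branching process of lines\<close>

context theta_cocycle begin

text \<open>One parameter t serves all sampled times: the orbit of a single point of the line is
  followed modulo the lattice, once per generation of N steps.\<close>

definition hit :: "real \<Rightarrow> nat \<Rightarrow> nat \<Rightarrow> 'a \<Rightarrow> real^'p \<Rightarrow> real^'p \<Rightarrow> bool" where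
  "hit \<delta> N m x a w \<longleftrightarrow> (\<exists>t. norm (a + t *\<^sub>R w) < \<delta> \<and>
     (\<forall>k\<le>m. \<exists>c\<in>int_lattice. norm (co (k * N) x *v (a + t *\<^sub>R w) - c) < \<delta>))"

text \<open>The children are recorded by their translation vectors c; c = 0 stands for the image of
  the line itself.\<close>

definition children :: "real \<Rightarrow> int list \<Rightarrow> real^'p \<Rightarrow> real^'p \<Rightarrow> (real^'p) set" where
  "children \<delta> v a w = {c \<in> int_lattice. \<exists>t. norm (a + t *\<^sub>R w) < \<delta> \<and> norm (wmat B v *v (a + t *\<^sub>R w) - c) < \<delta>}"

lemma co_lattice: "c \<in> int_lattice \<Longrightarrow> co n x *v c \<in> int_lattice"
  using wmat_GL by (auto simp: co_wmat GL_int_def intro: int_matrix_maps_lattice)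

lemma hit_imp_near: "hit \<delta> N m x a w \<Longrightarrow> line_dist a w < \<delta>"
  unfolding hit_def using line_dist_le order.strict_trans1 by blast

text \<open>Translating the image by c replaces a later lattice point d by d minus the image of c.
  This is again a lattice point, so the child inherits the hits of the remaining
  generations.\<close>

lemma hit_Suc:
  assumes "hit \<delta> N (Suc m) x a w"
  shows "\<exists>c\<in>children \<delta> (wd N x) a w. hit \<delta> N m ((T ^^ N) x) (wmat B (wd N x) *v a - c) (wmat B (wd N x) *v w)"
proof -
  let ?A = "wmat B (wd N x)"
  obtain t where t: "norm (a + t *\<^sub>R w) < \<delta>"
    "\<And>k. k \<le> Suc m \<Longrightarrow> \<exists>c\<in>int_lattice. norm (co (k * N) x *v (a + t *\<^sub>R w) - c) < \<delta>"
    using assms by (auto simp: hit_def)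
  obtain c where c: "c \<in> int_lattice" "norm (?A *v (a + t *\<^sub>R w) - c) < \<delta>"
    using t(2)[of 1] by (auto simp: co_wmat)
  have e: "?A *v a - c + t *\<^sub>R (?A *v w) = ?A *v (a + t *\<^sub>R w) - c"
    by (simp add: matrix_vector_right_distrib matrix_vector_mult_scaleR)
  have "\<exists>d\<in>int_lattice. norm (co (k * N) ((T ^^ N) x) *v (?A *v (a + t *\<^sub>R w) - c) - d) < \<delta>" if "k \<le> m" for k
  proof -
    obtain d where d: "d \<in> int_lattice" "norm (co (Suc k * N) x *v (a + t *\<^sub>R w) - d) < \<delta>"
      using t(2)[of "Suc k"] \<open>k \<le> m\<close> by auto
    have "co (Suc k * N) x *v (a + t *\<^sub>R w) = co (k * N) ((T ^^ N) x) *v (?A *v (a + t *\<^sub>R w))"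
      using co_add[of N "k * N" x "a + t *\<^sub>R w"] by (simp add: co_wmat)
    then have "norm (co (k * N) ((T ^^ N) x) *v (?A *v (a + t *\<^sub>R w) - c) - (d - co (k * N) ((T ^^ N) x) *v c)) < \<delta>"
      using d(2) by (simp add: matrix_vector_mult_diff_distrib)
    then show ?thesis using d(1) c(1) int_lattice_diff co_lattice by blast
  qed
  then have "hit \<delta> N m ((T ^^ N) x) (?A *v a - c) (?A *v w)"
    unfolding hit_def e using c(2) by (intro exI[of _ t]) (auto simp: e)
  moreover have "c \<in> children \<delta> (wd N x) a w" using c t(1) by (auto simp: children_def)
  ultimately show ?thesis by blast
qed

lemma hit_meas [measurable]: "Measurable.pred M (\<lambda>x. hit \<delta> N m x a w)"
proof -
  let ?P = "\<lambda>v. \<exists>t. norm (a + t *\<^sub>R w) < \<delta> \<and>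
     (\<forall>k\<le>m. \<exists>c\<in>int_lattice. norm (wmat B (take (k * N) v) *v (a + t *\<^sub>R w) - c) < \<delta>)"
  have "co (k * N) x = wmat B (take (k * N) (wd (m * N) x))" if "k \<le> m" for k x
    using word_add[of T lt "k * N" "m * N - k * N" x] that by (simp add: co_wmat)
  then have "(\<lambda>x. hit \<delta> N m x a w) = (\<lambda>x. ?P (wd (m * N) x))"
    unfolding hit_def by (intro ext) auto
  moreover have "Measurable.pred M (\<lambda>x. ?P (wd (m * N) x))"
    by (rule measurable_compose[OF word_meas]) simp
  ultimately show ?thesis by simp
qed

lemma children_norm_le:
  assumes "c \<in> children \<delta> v a w"
  shows "norm c \<le> \<delta> * (exp (wlog v) + 1)"
proof -
  obtain t where t: "norm (a + t *\<^sub>R w) < \<delta>" "norm (wmat B v *v (a + t *\<^sub>R w) - c) < \<delta>"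
    using assms by (auto simp: children_def)
  have "norm c \<le> norm (wmat B v *v (a + t *\<^sub>R w)) + norm (wmat B v *v (a + t *\<^sub>R w) - c)"
    by (metis norm_triangle_sub norm_minus_commute)
  also have "\<dots> \<le> exp (wlog v) * norm (a + t *\<^sub>R w) + \<delta>" using wmat_bounds(1)[of v "a + t *\<^sub>R w"] t(2) by simp
  also have "\<dots> \<le> exp (wlog v) * \<delta> + \<delta>" using t(1) by simp
  finally show ?thesis by (simp add: algebra_simps)
qed

lemma children_finite:
  assumes \<delta>: "0 < \<delta>" "\<delta> \<le> 1 / 10"
  shows "finite (children \<delta> v a w)" "card (children \<delta> v a w) \<le> (3 * exp (wlog v)) ^ CARD('p)"
proof -
  have 1: "1 \<le> exp (wlog v)" using wlog_nonneg by simp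
  have "children \<delta> v a w \<subseteq> {c \<in> int_lattice. norm c \<le> exp (wlog v)}"
  proof
    fix c assume c: "c \<in> children \<delta> v a w"
    have "norm c \<le> \<delta> * (exp (wlog v) + 1)" by (rule children_norm_le[OF c])
    also have "\<dots> \<le> 1 / 10 * (exp (wlog v) + 1)" using \<delta> 1 by (intro mult_right_mono) auto
    also have "\<dots> \<le> exp (wlog v)"
    proof -
      have "1 / 10 * (y + 1) \<le> y" if "1 \<le> y" for y :: real using that by simp
      then show ?thesis using 1 by blast
    qed
    finally show "c \<in> {c \<in> int_lattice. norm c \<le> exp (wlog v)}"
      using c by (simp add: children_def)
  qed
  moreover note fin = int_lattice_ball[of "exp (wlog v)"]
  ultimately show "finite (children \<delta> v a w)" by (auto intro: finite_subset)
  have "real (card (children \<delta> v a w)) \<le> card {c \<in> int_lattice :: (real^'p) set. norm c \<le> exp (wlog v)}"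
    using \<open>children \<delta> v a w \<subseteq> _\<close> fin(1) by (auto intro: card_mono)
  also have "\<dots> \<le> (2 * exp (wlog v) + 1) ^ CARD('p)" by (rule fin(2)) simp
  also have "\<dots> \<le> (3 * exp (wlog v)) ^ CARD('p)" using 1 by (intro power_mono) auto
  finally show "card (children \<delta> v a w) \<le> (3 * exp (wlog v)) ^ CARD('p)" .
qed

lemma children_line_dist:
  assumes "\<delta> \<le> 1 / 10" "w \<in> Th" "c \<in> children \<delta> v a w" "c \<noteq> 0"
  shows "1 / (10 * exp (wlog v)) \<le> line_dist (wmat B v *v a - c) (wmat B v *v w)"
proof -
  obtain t where t: "norm (a + t *\<^sub>R w) < \<delta>" "norm (wmat B v *v (a + t *\<^sub>R w) - c) < \<delta>"
    using assms by (auto simp: children_def)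
  show ?thesis
    by (rule child_line_dist_ge[OF wmat_GL wmat_bounds(2), where t=t])
       (use assms t wlog_nonneg wmat_Th[OF assms(2)] in \<open>auto simp: children_def\<close>)
qed

text \<open>The first factor protects the contraction of the image line, the second pays for the
  other children. The thresholds differ because R' is chosen after \<beta>, which depends on
  \<alpha> and so on R.\<close>

definition weight :: "real \<Rightarrow> real \<Rightarrow> real \<Rightarrow> real \<Rightarrow> real \<Rightarrow> int list \<Rightarrow> real" where
  "weight \<alpha> R \<beta> R' s v = damp \<alpha> R s v * damp \<beta> R' s v"

lemma damp_bounds:
  assumes "0 \<le> \<alpha>" "0 \<le> s"
  shows "0 < damp \<alpha> R s v" "damp \<alpha> R s v \<le> 1"
  using assms wlog_nonneg[of v] by (auto simp: damp_def)

lemma weight_pos: "0 \<le> \<alpha> \<Longrightarrow> 0 \<le> \<beta> \<Longrightarrow> 0 \<le> s \<Longrightarrow> 0 < weight \<alpha> R \<beta> R' s v"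
  using damp_bounds by (simp add: weight_def)

text \<open>For wlog v + s \<le> R' the choice of \<delta> excludes nonzero lattice points, so only
  the image line contributes. Beyond, there are at most (3 exp (wlog v))^p children, each
  contributing at most (10 exp (wlog v))^\<alpha> because of its distance from 0, and the damping
  with \<beta> brings the total below \<epsilon>.\<close>

lemma weighted_children_sum:
  assumes \<alpha>: "0 < \<alpha>" and \<beta>: "0 < \<beta>" and s: "0 < s"
    and \<delta>: "0 < \<delta>" "\<delta> \<le> 1 / 10" "\<delta> * (exp R' + 1) \<le> 1"
    and \<epsilon>: "\<And>G. 0 \<le> G \<Longrightarrow> exp (- \<beta> * (G + s)) * ((3 * exp G) ^ CARD('p) * (10 * exp G) powr \<alpha>) \<le> \<epsilon>"
    and w: "w \<in> Th" and a: "0 < line_dist a w"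
  shows "weight \<alpha> R \<beta> R' s v * (\<Sum>c\<in>children \<delta> v a w. (\<delta> / line_dist (wmat B v *v a - c) (wmat B v *v w)) powr \<alpha>)
     \<le> (\<delta> / line_dist a w) powr \<alpha> *
        (damp \<alpha> R s v * (line_dist a w / line_dist (wmat B v *v a) (wmat B v *v w)) powr \<alpha> + \<epsilon>)"
proof -
  let ?t = "\<lambda>c. (\<delta> / line_dist (wmat B v *v a - c) (wmat B v *v w)) powr \<alpha>"
  let ?d = "line_dist a w" and ?d' = "line_dist (wmat B v *v a) (wmat B v *v w)"
  let ?C = "children \<delta> v a w"
  have e0: "0 \<le> \<epsilon>" by (rule order.trans[OF _ \<epsilon>[of 0]]) auto
  have D: "0 < damp \<alpha> R s v" "damp \<alpha> R s v \<le> 1" "0 < damp \<beta> R' s v" "damp \<beta> R' s v \<le> 1"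
    using damp_bounds \<alpha> \<beta> s by auto
  have W: "0 < weight \<alpha> R \<beta> R' s v" using weight_pos \<alpha> \<beta> s by simp
  have d': "0 < ?d'" by (rule line_dist_wmat_pos[OF a])
  show ?thesis
  proof (cases "?C = {}")
    case True
    then show ?thesis using D e0 by (simp add: add_nonneg_nonneg)
  next
    case False
    then obtain t where "norm (a + t *\<^sub>R w) < \<delta>" by (auto simp: children_def)
    then have "?d < \<delta>" using line_dist_le order.strict_trans1 by blast
    \<comment> \<open>A child exists only when the line comes within \<delta> of 0. The factor is
      then at least 1, so that the absolute error \<epsilon> can be multiplied by it.\<close>
    then have V: "1 \<le> (\<delta> / ?d) powr \<alpha>" using a \<alpha> by (intro ge_one_powr_ge_zero) auto
    have fin: "finite ?C" by (rule children_finite(1)[OF \<delta>(1,2)])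
    \<comment> \<open>The image itself may fail to be a child; adding its nonnegative term makes the
      splitting uniform.\<close>
    have "(\<Sum>c\<in>?C. ?t c) \<le> (\<Sum>c\<in>insert 0 (?C - {0}). ?t c)"
      using fin by (intro sum_mono2) auto
    also have "\<dots> = ?t 0 + (\<Sum>c\<in>?C - {0}. ?t c)" using fin by (subst sum.insert) auto
    finally have "weight \<alpha> R \<beta> R' s v * (\<Sum>c\<in>?C. ?t c)
        \<le> weight \<alpha> R \<beta> R' s v * ?t 0 + weight \<alpha> R \<beta> R' s v * (\<Sum>c\<in>?C - {0}. ?t c)"
      using W by (simp add: distrib_left[symmetric])
    also have "\<dots> \<le> damp \<alpha> R s v * ((\<delta> / ?d) powr \<alpha> * (?d / ?d') powr \<alpha>) + (\<delta> / ?d) powr \<alpha> * \<epsilon>"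
    proof (rule add_mono)
      have "?t 0 = (\<delta> / ?d) powr \<alpha> * (?d / ?d') powr \<alpha>"
        using a d' \<delta> by (subst powr_mult[symmetric]) auto
      then show "weight \<alpha> R \<beta> R' s v * ?t 0 \<le> damp \<alpha> R s v * ((\<delta> / ?d) powr \<alpha> * (?d / ?d') powr \<alpha>)"
        using D by (intro mult_mono) (auto simp: weight_def mult_le_cancel_left1)
      show "weight \<alpha> R \<beta> R' s v * (\<Sum>c\<in>?C - {0}. ?t c) \<le> (\<delta> / ?d) powr \<alpha> * \<epsilon>"
      proof (cases "wlog v + s \<le> R'")
        case True
        have "c = 0" if c: "c \<in> ?C" for c
        proof (rule ccontr)
          assume "c \<noteq> 0"
          then have "1 \<le> norm c" using c int_lattice_norm_ge_1 by (auto simp: children_def)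
          also have "\<dots> \<le> \<delta> * (exp (wlog v) + 1)" by (rule children_norm_le[OF c])
          also have "\<dots> < \<delta> * (exp R' + 1)" using True s \<delta> by simp
          finally show False using \<delta> by simp
        qed
        then have "?C - {0} = {}" by blast
        then show ?thesis using e0 by (simp only: sum.empty) simp
      next
        case False
        have "(\<Sum>c\<in>?C - {0}. ?t c) \<le> (\<Sum>c\<in>?C - {0}. (10 * exp (wlog v)) powr \<alpha>)"
        proof (rule sum_mono)
          fix c assume c: "c \<in> ?C - {0}"
          have l: "1 / (10 * exp (wlog v)) \<le> line_dist (wmat B v *v a - c) (wmat B v *v w)"
            using children_line_dist[OF \<delta>(2) w, of c v a] c by auto
          have p: "0 < 1 / (10 * exp (wlog v))" by simp
          have "\<delta> / line_dist (wmat B v *v a - c) (wmat B v *v w) \<le> 1 / (1 / (10 * exp (wlog v)))"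
            using l p \<delta> by (intro frac_le) auto
          then show "?t c \<le> (10 * exp (wlog v)) powr \<alpha>"
            using \<delta> \<alpha> by (intro powr_mono2) auto
        qed
        also have "\<dots> = card (?C - {0}) * (10 * exp (wlog v)) powr \<alpha>" by simp
        also have "\<dots> \<le> (3 * exp (wlog v)) ^ CARD('p) * (10 * exp (wlog v)) powr \<alpha>"
        proof (rule mult_right_mono)
          have "real (card (?C - {0})) \<le> card ?C" using fin by (simp add: card_mono)
          then show "real (card (?C - {0})) \<le> (3 * exp (wlog v)) ^ CARD('p)"
            using children_finite(2)[OF \<delta>(1,2), of v a w] by linarith
        qed simp
        finally have 1: "(\<Sum>c\<in>?C - {0}. ?t c) \<le> (3 * exp (wlog v)) ^ CARD('p) * (10 * exp (wlog v)) powr \<alpha>" .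
        have "weight \<alpha> R \<beta> R' s v \<le> exp (- \<beta> * (wlog v + s))"
          using D False by (simp add: weight_def damp_def[of \<beta>] mult_le_cancel_right1)
        then have "weight \<alpha> R \<beta> R' s v * (\<Sum>c\<in>?C - {0}. ?t c)
          \<le> exp (- \<beta> * (wlog v + s)) * ((3 * exp (wlog v)) ^ CARD('p) * (10 * exp (wlog v)) powr \<alpha>)"
          using 1 by (intro mult_mono) (auto intro: sum_nonneg)
        also have "\<dots> \<le> \<epsilon>" by (rule \<epsilon>[OF wlog_nonneg])
        also have "\<dots> \<le> (\<delta> / ?d) powr \<alpha> * \<epsilon>" using mult_right_mono[OF V e0] by simp
        finally show ?thesis .
      qed
    qed
    also have "\<dots> = (\<delta> / ?d) powr \<alpha> * (damp \<alpha> R s v * (?d / ?d') powr \<alpha> + \<epsilon>)" by (simp add: algebra_simps)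
    finally show ?thesis .
  qed
qed

definition pathweight :: "(int list \<Rightarrow> real) \<Rightarrow> nat \<Rightarrow> nat \<Rightarrow> 'a \<Rightarrow> real" where
  "pathweight W N m x = (\<Prod>k<m. W (wd N ((T ^^ (k * N)) x)))"

lemma pathweight_Suc: "pathweight W N (Suc m) x = W (wd N x) * pathweight W N m ((T ^^ N) x)"
proof -
  have "(T ^^ (Suc k * N)) x = (T ^^ (k * N)) ((T ^^ N) x)" for k by (simp add: add.commute[of N] funpow_add)
  then show ?thesis unfolding pathweight_def by (simp add: prod.lessThan_Suc_shift del: prod.lessThan_Suc mult_Suc)
qed

lemma pathweight_meas [measurable]: "pathweight W N m \<in> borel_measurable M"
proof -
  have "(\<lambda>x. W (wd N ((T ^^ (k * N)) x))) \<in> borel_measurable M" for k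
    using measurable_compose[OF T_pow_meas word_fun_meas[of W N]] .
  then show ?thesis unfolding pathweight_def by measurable
qed

text \<open>A first-moment bound with \<open>(\<delta> / line_dist a w) powr \<alpha>\<close> as
  Lyapunov function: it is at least 1 on a line that hits, and one generation multiplies its damped
  mean by at most q + \<epsilon>.\<close>

lemma hitting_mass_decay:
  assumes \<alpha>: "0 < \<alpha>" and \<beta>: "0 < \<beta>" and s: "0 < s"
    and \<delta>: "0 < \<delta>" "\<delta> \<le> 1 / 10" "\<delta> * (exp R' + 1) \<le> 1"
    and \<epsilon>: "\<And>G. 0 \<le> G \<Longrightarrow> exp (- \<beta> * (G + s)) * ((3 * exp G) ^ CARD('p) * (10 * exp G) powr \<alpha>) \<le> \<epsilon>"
    and q: "0 \<le> q"
    and contr: "\<And>u a w. w \<in> Th \<Longrightarrow> 0 < line_dist a w \<Longrightarrow>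
     cylint u (\<lambda>x. ennreal (damp \<alpha> R s (wd N x) * (line_dist a w / line_dist (co N x *v a) (co N x *v w)) powr \<alpha>))
       \<le> ennreal q * emeasure M (cyl u)"
    and w: "w \<in> Th" and a: "0 < line_dist a w"
  shows "cylint u (\<lambda>x. if hit \<delta> N m x a w then ennreal (pathweight (weight \<alpha> R \<beta> R' s) N m x) else 0)
     \<le> ennreal ((q + \<epsilon>) ^ m * (\<delta> / line_dist a w) powr \<alpha>) * emeasure M (cyl u)"
  using w a
proof (induction m arbitrary: u a w)
  case 0
  have "cylint u (\<lambda>x. if hit \<delta> N 0 x a w then ennreal (pathweight (weight \<alpha> R \<beta> R' s) N 0 x) else 0)
     \<le> cylint u (\<lambda>x. ennreal ((\<delta> / line_dist a w) powr \<alpha>))"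
  proof (rule cylint_mono)
    fix x
    show "(if hit \<delta> N 0 x a w then ennreal (pathweight (weight \<alpha> R \<beta> R' s) N 0 x) else 0) \<le> ennreal ((\<delta> / line_dist a w) powr \<alpha>)"
    proof (cases "hit \<delta> N 0 x a w")
      case True
      then have "line_dist a w < \<delta>" by (rule hit_imp_near)
      then have "1 \<le> (\<delta> / line_dist a w) powr \<alpha>" using 0 \<alpha> by (intro ge_one_powr_ge_zero) auto
      then show ?thesis using True ennreal_leI by (fastforce simp: pathweight_def)
    qed simp
  qed
  then show ?case by (simp add: cylint_const)
next
  case (Suc m)
  let ?W = "weight \<alpha> R \<beta> R' s"
  have W: "0 < ?W v" for v using weight_pos \<alpha> \<beta> s by simp
  have e0: "0 \<le> \<epsilon>" by (rule order.trans[OF _ \<epsilon>[of 0]]) auto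
  define F where "F a w x = (if hit \<delta> N m x a w then ennreal (pathweight ?W N m x) else 0)" for a w x
  have Fm: "F a w \<in> borel_measurable M" for a w unfolding F_def by measurable
  \<comment> \<open>Union bound: a hit over m + 1 generations gives some child a hit over m. With
    the block v fixed the children are fixed lines, and the induction hypothesis applies to each of
    them.\<close>
  define H where "H v y = ennreal (?W v) * (\<Sum>c\<in>children \<delta> v a w. F (wmat B v *v a - c) (wmat B v *v w) y)" for v y
  let ?t = "\<lambda>v c. (\<delta> / line_dist (wmat B v *v a - c) (wmat B v *v w)) powr \<alpha>"
  define h where "h v = ennreal (?W v * (\<Sum>c\<in>children \<delta> v a w. (q + \<epsilon>) ^ m * ?t v c))" for v
  let ?V = "(q + \<epsilon>) ^ m * (\<delta> / line_dist a w) powr \<alpha>"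
  let ?D = "\<lambda>x. damp \<alpha> R s (wd N x) * (line_dist a w / line_dist (co N x *v a) (co N x *v w)) powr \<alpha>"
  have "cylint u (\<lambda>x. if hit \<delta> N (Suc m) x a w then ennreal (pathweight ?W N (Suc m) x) else 0)
      \<le> cylint u (\<lambda>x. H (wd N x) ((T ^^ N) x))"
  proof (rule cylint_mono)
    fix x
    show "(if hit \<delta> N (Suc m) x a w then ennreal (pathweight ?W N (Suc m) x) else 0) \<le> H (wd N x) ((T ^^ N) x)"
    proof (cases "hit \<delta> N (Suc m) x a w")
      case True
      then obtain c where c: "c \<in> children \<delta> (wd N x) a w"
        "hit \<delta> N m ((T ^^ N) x) (wmat B (wd N x) *v a - c) (wmat B (wd N x) *v w)"
        using hit_Suc by blast
      have "ennreal (pathweight ?W N (Suc m) x) = ennreal (?W (wd N x)) * F (wmat B (wd N x) *v a - c) (wmat B (wd N x) *v w) ((T ^^ N) x)"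
        using c(2) W by (simp add: F_def pathweight_Suc ennreal_mult' less_imp_le)
      also have "\<dots> \<le> H (wd N x) ((T ^^ N) x)"
        unfolding H_def using c(1) children_finite(1)[OF \<delta>(1,2)]
        by (intro mult_left_mono member_le_sum) auto
      finally show ?thesis using True by simp
    qed simp
  qed
  also have "\<dots> \<le> cylint u (\<lambda>x. h (wd N x))"
  proof (rule cylint_tower)
    fix u v
    show "H v \<in> borel_measurable M" unfolding H_def using Fm by measurable
    have "cylint u (H v) = ennreal (?W v) * (\<Sum>c\<in>children \<delta> v a w. cylint u (F (wmat B v *v a - c) (wmat B v *v w)))"
      unfolding H_def using Fm by (subst cylint_cmult) (auto simp: cylint_sum)
    also have "\<dots> \<le> ennreal (?W v) * (\<Sum>c\<in>children \<delta> v a w. ennreal ((q + \<epsilon>) ^ m * ?t v c) * emeasure M (cyl u))"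
    proof (intro mult_left_mono sum_mono)
      fix c assume c: "c \<in> children \<delta> v a w"
      have "0 < line_dist (wmat B v *v a - c) (wmat B v *v w)"
      proof (cases "c = 0")
        case True then show ?thesis using line_dist_wmat_pos[OF Suc.prems(2)] by simp
      next
        case False
        have "0 < 1 / (10 * exp (wlog v))" by simp
        then show ?thesis using children_line_dist[OF \<delta>(2) Suc.prems(1) c False] by linarith
      qed
      then show "cylint u (F (wmat B v *v a - c) (wmat B v *v w)) \<le> ennreal ((q + \<epsilon>) ^ m * ?t v c) * emeasure M (cyl u)"
        unfolding F_def using wmat_Th[OF Suc.prems(1)] by (intro Suc.IH) auto
    qed auto
    also have "\<dots> = h v * emeasure M (cyl u)"
    proof -
      have "h v = ennreal (?W v) * (\<Sum>c\<in>children \<delta> v a w. ennreal ((q + \<epsilon>) ^ m * ?t v c))"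
        unfolding h_def using W q e0 by (subst sum_ennreal) (auto simp: ennreal_mult' less_imp_le)
      then show ?thesis by (simp add: sum_distrib_right mult.assoc)
    qed
    finally show "cylint u (H v) \<le> h v * emeasure M (cyl u)" .
  qed
  also have "\<dots> \<le> cylint u (\<lambda>x. ennreal ?V * (ennreal (?D x) + ennreal \<epsilon>))"
  proof (rule cylint_mono)
    fix x
    have D0: "0 \<le> ?D x" using damp_bounds(1)[of \<alpha> s R "wd N x"] \<alpha> s by simp
    have "?W (wd N x) * (\<Sum>c\<in>children \<delta> (wd N x) a w. (q + \<epsilon>) ^ m * ?t (wd N x) c)
        = (q + \<epsilon>) ^ m * (?W (wd N x) * (\<Sum>c\<in>children \<delta> (wd N x) a w. ?t (wd N x) c))"
      by (simp add: sum_distrib_left algebra_simps)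
    also have "\<dots> \<le> (q + \<epsilon>) ^ m * ((\<delta> / line_dist a w) powr \<alpha> * (?D x + \<epsilon>))"
      using q e0 weighted_children_sum[OF \<alpha> \<beta> s \<delta> \<epsilon> Suc.prems, of R "wd N x"]
      unfolding co_wmat by (intro mult_left_mono) auto
    finally have "h (wd N x) \<le> ennreal (?V * (?D x + \<epsilon>))" unfolding h_def by (intro ennreal_leI) (simp add: mult.assoc)
    also have "\<dots> = ennreal ?V * (ennreal (?D x) + ennreal \<epsilon>)"
      using q e0 D0 by (simp add: ennreal_mult)
    finally show "h (wd N x) \<le> ennreal ?V * (ennreal (?D x) + ennreal \<epsilon>)" .
  qed
  also have "\<dots> = ennreal ?V * (cylint u (\<lambda>x. ennreal (?D x)) + ennreal \<epsilon> * emeasure M (cyl u))"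
  proof -
    have Dm[measurable]: "?D \<in> borel_measurable M" unfolding co_wmat by (rule word_fun_meas)
    show ?thesis by (subst cylint_cmult, measurable, subst cylint_add, measurable) (simp add: cylint_const)
  qed
  also have "\<dots> \<le> ennreal ?V * (ennreal q * emeasure M (cyl u) + ennreal \<epsilon> * emeasure M (cyl u))"
    by (intro mult_left_mono add_right_mono contr Suc.prems) auto
  also have "\<dots> = ennreal ((q + \<epsilon>) ^ Suc m * (\<delta> / line_dist a w) powr \<alpha>) * emeasure M (cyl u)"
  proof -
    have "ennreal ((q + \<epsilon>) ^ Suc m * (\<delta> / line_dist a w) powr \<alpha>) = ennreal (?V * (q + \<epsilon>))" by (simp add: ac_simps)
    also have "\<dots> = ennreal ?V * (ennreal q + ennreal \<epsilon>)" using q e0 by (simp add: ennreal_mult)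
    finally show ?thesis by (simp only: distrib_right mult.assoc)
  qed
  finally show ?case .
qed

end

section \<open>Lines leave the neighbourhood of the lattice\<close>

context theta_cocycle begin

lemma wlog_word_finite:
  assumes "0 \<le> s"
  shows "(\<integral>\<^sup>+ x. ennreal (wlog (wd N x) + s) \<partial>M) < \<infinity>"
proof -
  have "(\<integral>\<^sup>+ x. ennreal (wlog (wd N x) + s) \<partial>M) = (\<integral>\<^sup>+ x. (\<Sum>k<N. ennreal (lognorm (lt ((T ^^ k) x)))) + ennreal s \<partial>M)"
    using assms lognorm_nonneg by (intro nn_integral_cong) (simp add: wlog_word sum_nonneg)
  also have "\<dots> = (\<Sum>k<N. \<integral>\<^sup>+ x. ennreal (lognorm (lt ((T ^^ k) x))) \<partial>M) + ennreal s"
    by (simp add: nn_integral_add nn_integral_sum emeasure_space_1)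
  also have "\<dots> = (\<Sum>k<N. \<integral>\<^sup>+ x. ennreal (lognorm (lt x)) \<partial>M) + ennreal s"
    using nn_integral_T_pow[of "\<lambda>x. ennreal (lognorm (lt x))"] by simp
  also have "\<dots> < \<infinity>" using lognorm_finite by (simp add: ennreal_mult_less_top ennreal_of_nat_eq_real_of_nat)
  finally show ?thesis .
qed

text \<open>On an orbit that hits forever, exp (\<alpha> s m / 8) times the path weight must tend to
  0, by summing the means. The Birkhoff bound on the damping keeps it away from 0 for infinitely
  many m.\<close>

lemma lines_eventually_leave:
  "\<exists>\<delta> N. 0 < \<delta> \<and> (\<forall>a. \<forall>w\<in>Th. 0 < line_dist a w \<longrightarrow> (AE x in M. \<exists>m. \<not> hit \<delta> N m x a w))"
proof -
  obtain N s where N: "1 \<le> N" and s: "0 < s" and block: "\<And>\<alpha> R u a w. 0 < \<alpha> \<Longrightarrow> 4 * \<alpha> * R \<le> 1 \<Longrightarrow>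
     w \<in> Th \<Longrightarrow> 0 < line_dist a w \<Longrightarrow>
     cylint u (\<lambda>x. ennreal (damp \<alpha> R s (wd N x) * (line_dist a w / line_dist (co N x *v a) (co N x *v w)) powr \<alpha>))
       \<le> ennreal (exp (- (3/8) * \<alpha> * s)) * emeasure M (cyl u)"
    using block_contraction by blast
  define f where "f x = wlog (wd N x) + s" for x
  have fm[measurable]: "f \<in> borel_measurable M" unfolding f_def by measurable
  have f0: "0 \<le> f x" for x using wlog_nonneg[of "wd N x"] s by (simp add: f_def)
  have ffin: "(\<integral>\<^sup>+ x. f x \<partial>M) < \<infinity>" unfolding f_def using wlog_word_finite s by simp
  \<comment> \<open>This tail and the one for R' each contribute at most \<alpha> s / (32 N) to the
    mean of \<kappa>, together half of the rate b below.\<close>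
  obtain R where R: "0 < R" "(\<integral>\<^sup>+ x. ennreal (f x) * indicator {x. R < f x} x \<partial>M) \<le> ennreal (s / (32 * N))"
    using nn_integral_tail_small[OF fm f0 ffin, of "s / (32 * N)"] s N by auto
  define \<alpha> where "\<alpha> = 1 / (4 * R)"
  have \<alpha>: "0 < \<alpha>" "4 * \<alpha> * R \<le> 1" using R by (auto simp: \<alpha>_def)
  define q where "q = exp (- (3/8) * \<alpha> * s)"
  \<comment> \<open>Gives up part of the contraction: q + \<epsilon> = exp (- \<alpha> s /
    4).\<close>
  define \<epsilon> where "\<epsilon> = exp (- (1/4) * \<alpha> * s) - q"
  have e0: "0 < \<epsilon>" using \<alpha> s by (simp add: \<epsilon>_def q_def)
  define C where "C = 3 ^ CARD('p) * 10 powr \<alpha>"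
  have C0: "0 < C" by (simp add: C_def)
  \<comment> \<open>exp (- \<beta>' s) \<le> \<epsilon> / C disposes of the constants; the summand p
    + \<alpha> of \<beta> cancels the growth exp ((p + \<alpha>) G) of number and size of the
    children.\<close>
  define \<beta>' where "\<beta>' = max 0 (ln (C / \<epsilon>) / s)"
  define \<beta> where "\<beta> = CARD('p) + \<alpha> + \<beta>'"
  have \<beta>: "0 < \<beta>" using \<alpha> by (simp add: \<beta>_def \<beta>'_def add_nonneg_pos add_pos_nonneg)
  have \<epsilon>: "exp (- \<beta> * (G + s)) * ((3 * exp G) ^ CARD('p) * (10 * exp G) powr \<alpha>) \<le> \<epsilon>" if G: "0 \<le> G" for G
  proof -
    have "(3 * exp G) ^ CARD('p) * (10 * exp G) powr \<alpha> = C * exp ((CARD('p) + \<alpha>) * G)"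
      by (simp add: C_def power_mult_distrib powr_mult powr_def[of "exp _"] exp_of_nat_mult[symmetric] exp_add distrib_right)
    then have "exp (- \<beta> * (G + s)) * ((3 * exp G) ^ CARD('p) * (10 * exp G) powr \<alpha>)
        = C * exp (- \<beta> * (G + s) + (CARD('p) + \<alpha>) * G)" by (simp only: exp_add mult.left_commute)
    also have "\<dots> \<le> C * exp (- ln (C / \<epsilon>))"
    proof -
      have "ln (C / \<epsilon>) \<le> \<beta>' * s" using s by (simp add: \<beta>'_def max_def field_simps)
      also have "\<dots> \<le> \<beta>' * (G + s) + (CARD('p) + \<alpha>) * s" using G s \<alpha> by (simp add: \<beta>'_def distrib_left add_nonneg_nonneg)
      also have "\<dots> = \<beta> * (G + s) - (CARD('p) + \<alpha>) * G" by (simp add: \<beta>_def algebra_simps)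
      finally have "- \<beta> * (G + s) + (CARD('p) + \<alpha>) * G \<le> - ln (C / \<epsilon>)" by linarith
      then show ?thesis using C0 by (intro mult_left_mono) auto
    qed
    also have "\<dots> = \<epsilon>" using C0 e0 by (simp add: exp_minus)
    finally show ?thesis .
  qed
  obtain R' where R': "0 < R'" "(\<integral>\<^sup>+ x. ennreal (f x) * indicator {x. R' < f x} x \<partial>M) \<le> ennreal (\<alpha> * s / (32 * N * \<beta>))"
    using nn_integral_tail_small[OF fm f0 ffin, of "\<alpha> * s / (32 * N * \<beta>)"] s N \<alpha> \<beta> by auto
  \<comment> \<open>So small that a block below R' cannot carry a point within \<delta> of 0 to
    within \<delta> of a nonzero lattice point.\<close>
  define \<delta> where "\<delta> = min (1 / 10) (1 / (exp R' + 1))"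
  have \<delta>: "0 < \<delta>" "\<delta> \<le> 1 / 10" by (auto simp: \<delta>_def add_pos_pos)
  have \<delta>': "\<delta> * (exp R' + 1) \<le> 1"
  proof -
    have p: "0 < exp R' + 1" by (simp add: add_pos_pos)
    have "\<delta> \<le> 1 / (exp R' + 1)" by (simp add: \<delta>_def)
    then show ?thesis using p by (simp add: pos_le_divide_eq)
  qed
  let ?W = "weight \<alpha> R \<beta> R' s"
  have W: "0 < ?W v" for v using weight_pos \<alpha> \<beta> s by simp
  define \<kappa> where "\<kappa> x = - ln (?W (wd N x))" for x
  have \<kappa>m[measurable]: "\<kappa> \<in> borel_measurable M" unfolding \<kappa>_def by measurable
  have W1: "?W v \<le> 1" for v
    unfolding weight_def using damp_bounds \<alpha> \<beta> s by (intro mult_le_one) (auto simp: less_imp_le)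
  have \<kappa>0: "0 \<le> \<kappa> x" for x unfolding \<kappa>_def using W[of "wd N x"] W1[of "wd N x"] by simp
  have \<kappa>_eq: "ennreal (\<kappa> x) = ennreal \<alpha> * (ennreal (f x) * indicator {x. R < f x} x) + ennreal \<beta> * (ennreal (f x) * indicator {x. R' < f x} x)" for x
  proof -
    have "\<kappa> x = (if R < f x then \<alpha> * f x else 0) + (if R' < f x then \<beta> * f x else 0)"
      unfolding \<kappa>_def weight_def damp_def f_def by (simp add: ln_mult not_less)
    then show ?thesis using f0[of x] \<alpha> \<beta> by (simp add: indicator_def ennreal_mult)
  qed
  \<comment> \<open>Allows damping \<alpha> s / 8 per block, half the decay of the hitting mass. The
    averages run over all iterates of T, whose ergodicity is assumed, and not of
    \<open>T ^^ N\<close>; hence the division by N.\<close>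
  define b where "b = \<alpha> * s / (8 * N)"
  have b0: "0 < b" using \<alpha> s N by (simp add: b_def)
  have "(\<integral>\<^sup>+ x. \<kappa> x \<partial>M) < ennreal b"
  proof -
    note ind = measurable_tail[OF fm]
    have "(\<integral>\<^sup>+ x. \<kappa> x \<partial>M) = ennreal \<alpha> * (\<integral>\<^sup>+ x. ennreal (f x) * indicator {x. R < f x} x \<partial>M)
        + ennreal \<beta> * (\<integral>\<^sup>+ x. ennreal (f x) * indicator {x. R' < f x} x \<partial>M)"
      unfolding \<kappa>_eq using ind by (simp add: nn_integral_add nn_integral_cmult)
    also have "\<dots> \<le> ennreal \<alpha> * ennreal (s / (32 * N)) + ennreal \<beta> * ennreal (\<alpha> * s / (32 * N * \<beta>))"
      by (intro add_mono mult_left_mono R R') auto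
    also have "\<dots> = ennreal (\<alpha> * (s / (32 * N)) + \<beta> * (\<alpha> * s / (32 * N * \<beta>)))"
      using \<alpha> \<beta> s N
      by (subst ennreal_plus) (auto simp only: ennreal_mult' less_imp_le intro!: mult_nonneg_nonneg divide_nonneg_nonneg)
    also have "\<dots> < ennreal b"
    proof (rule ennreal_lessI[OF b0])
      have "\<alpha> * (s / (32 * N)) + \<beta> * (\<alpha> * s / (32 * N * \<beta>)) = b / 2" using \<beta> N by (simp add: b_def field_simps)
      then show "\<alpha> * (s / (32 * N)) + \<beta> * (\<alpha> * s / (32 * N * \<beta>)) < b" using b0 by simp
    qed
    finally show ?thesis .
  qed
  from frequently_birkhoff_sum_le[OF \<kappa>m \<kappa>0 this]
  have birk: "AE x in M. \<exists>r::nat. \<exists>\<^sub>F n in sequentially. (\<Sum>i<n. \<kappa> ((T ^^ i) x)) \<le> b * n + r" .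
  have "AE x in M. \<exists>m. \<not> hit \<delta> N m x a w" if w: "w \<in> Th" and a: "0 < line_dist a w" for a w
  proof -
    define F where "F m x = (if hit \<delta> N m x a w then ennreal (pathweight ?W N m x) else 0)" for m x
    have Fm[measurable]: "F m \<in> borel_measurable M" for m unfolding F_def by measurable
    let ?V = "(\<delta> / line_dist a w) powr \<alpha>"
    have FI: "(\<integral>\<^sup>+ x. F m x \<partial>M) \<le> ennreal (exp (- (1/4) * \<alpha> * s) ^ m * ?V)" for m
    proof -
      have "cylint [] (F m) \<le> ennreal ((q + \<epsilon>) ^ m * ?V) * emeasure M (cyl [])"
        unfolding F_def
        by (rule hitting_mass_decay[OF \<alpha>(1) \<beta> s \<delta> \<delta>' \<epsilon> _ _ w a])
           (simp_all only: q_def block[OF \<alpha>] exp_ge_zero)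
      also have "\<dots> \<le> ennreal ((q + \<epsilon>) ^ m * ?V) * 1" by (intro mult_left_mono emeasure_le_1) auto
      finally show ?thesis by (simp add: cylint_Nil \<epsilon>_def)
    qed
    \<comment> \<open>Half the decay rate: multiplied by these powers, the hitting masses are still
      summable.\<close>
    let ?e = "exp (\<alpha> * s / 8)"
    have "(\<integral>\<^sup>+ x. (\<Sum>m. ennreal (?e ^ m) * F m x) \<partial>M) = (\<Sum>m. ennreal (?e ^ m) * (\<integral>\<^sup>+ x. F m x \<partial>M))"
      by (subst nn_integral_suminf) (auto simp: nn_integral_cmult)
    also have "\<dots> \<le> (\<Sum>m. ennreal (?e ^ m) * ennreal (exp (- (1/4) * \<alpha> * s) ^ m * ?V))"
      by (intro suminf_le mult_left_mono FI) auto
    also have "\<dots> = (\<Sum>m. ennreal (exp (- \<alpha> * s / 8) ^ m * ?V))"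
    proof -
      have "?e ^ m * exp (- (1/4) * \<alpha> * s) ^ m = exp (- \<alpha> * s / 8) ^ m" for m
        by (simp add: power_mult_distrib[symmetric] exp_add[symmetric])
      then show ?thesis by (simp add: ennreal_mult'[symmetric] mult.assoc[symmetric])
    qed
    also have "\<dots> = ennreal (\<Sum>m. exp (- \<alpha> * s / 8) ^ m * ?V)"
      using \<alpha> s by (intro suminf_ennreal2 summable_mult2 summable_geometric) auto
    also have "\<dots> < \<infinity>" by simp
    finally have "AE x in M. (\<Sum>m. ennreal (?e ^ m) * F m x) \<noteq> \<infinity>"
      by (intro nn_integral_PInf_AE) auto
    then show ?thesis using birk
    proof eventually_elim
      fix x assume fin: "(\<Sum>m. ennreal (?e ^ m) * F m x) \<noteq> \<infinity>"
        and "\<exists>r::nat. \<exists>\<^sub>F n in sequentially. (\<Sum>i<n. \<kappa> ((T ^^ i) x)) \<le> b * n + r"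
      then obtain r :: nat where r: "\<exists>\<^sub>F n in sequentially. (\<Sum>i<n. \<kappa> ((T ^^ i) x)) \<le> b * n + r" by blast
      show "\<exists>m. \<not> hit \<delta> N m x a w"
      proof (rule ccontr)
        assume "\<not> ?thesis"
        then have F: "F m x = ennreal (pathweight ?W N m x)" for m by (simp add: F_def)
        have P0: "0 < pathweight ?W N m x" for m unfolding pathweight_def using W by (intro prod_pos) auto
        have "(\<Sum>m. ennreal (?e ^ m * pathweight ?W N m x)) \<noteq> top"
          using fin unfolding F by (simp add: ennreal_mult')
        then have "summable (\<lambda>m. ?e ^ m * pathweight ?W N m x)"
          using P0 by (intro summable_suminf_not_top) (auto simp: less_imp_le)
        then have "(\<lambda>m. ?e ^ m * pathweight ?W N m x) \<longlonglongrightarrow> 0" by (rule summable_LIMSEQ_zero)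
        then have "eventually (\<lambda>m. ?e ^ m * pathweight ?W N m x < exp (- (\<alpha> * s / 8) - r)) sequentially"
          by (rule order_tendstoD) simp
        then obtain m0 where m0: "\<And>m. m \<ge> m0 \<Longrightarrow> ?e ^ m * pathweight ?W N m x < exp (- (\<alpha> * s / 8) - r)"
          by (auto simp: eventually_sequentially)
        obtain n where n: "n \<ge> m0 * N" "(\<Sum>i<n. \<kappa> ((T ^^ i) x)) \<le> b * n + r"
          using r by (auto simp: frequently_sequentially)
        \<comment> \<open>The time n from the Birkhoff bound need not be a multiple of N. The
          damping of the m complete blocks is part of the nonnegative sum up to n, and the
          incomplete block costs one more \<alpha> s / 8.\<close>
        define m where "m = n div N"
        have m: "m0 \<le> m" using n N by (simp add: m_def less_eq_div_iff_mult_less_eq)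
        have mN: "m * N \<le> n" "n \<le> (m + 1) * N"
          using N dividend_less_div_times[of N n] by (simp_all add: m_def div_times_less_eq_dividend)
        have "ln (pathweight ?W N m x) = - (\<Sum>k<m. \<kappa> ((T ^^ (k * N)) x))"
          unfolding pathweight_def \<kappa>_def using W by (subst ln_prod) (simp_all add: sum_negf less_imp_neq[OF W, THEN not_sym])
        moreover have "(\<Sum>k<m. \<kappa> ((T ^^ (k * N)) x)) \<le> (\<Sum>i<n. \<kappa> ((T ^^ i) x))"
        proof -
          have inj: "inj_on (\<lambda>k. k * N) {..<m}" using N by (auto simp: inj_on_def)
          have "(\<Sum>k<m. \<kappa> ((T ^^ (k * N)) x)) = (\<Sum>i\<in>(\<lambda>k. k * N) ` {..<m}. \<kappa> ((T ^^ i) x))"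
            by (subst sum.reindex[OF inj]) simp
          also have "\<dots> \<le> (\<Sum>i<n. \<kappa> ((T ^^ i) x))"
          proof (rule sum_mono2)
            show "(\<lambda>k. k * N) ` {..<m} \<subseteq> {..<n}"
            proof (clarsimp)
              fix k assume "k < m"
              then have "k * N < m * N" using N by simp
              then show "k * N < n" using mN by linarith
            qed
          qed (use \<kappa>0 in auto)
          finally show ?thesis .
        qed
        moreover have "b * n \<le> \<alpha> * s / 8 * (m + 1)"
        proof -
          have "real n \<le> real ((m + 1) * N)" using mN(2) by (simp only: of_nat_le_iff)
          then have "b * n \<le> b * real ((m + 1) * N)" using b0 by (intro mult_left_mono) auto
          also have "\<dots> = \<alpha> * s / 8 * (m + 1)" using N by (simp add: b_def field_simps)
          finally show ?thesis .
        qed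
        ultimately have "- (\<alpha> * s / 8 * (m + 1)) - r \<le> ln (pathweight ?W N m x)" using n(2) by linarith
        then have "exp (- (\<alpha> * s / 8 * (m + 1)) - r) \<le> exp (ln (pathweight ?W N m x))" by simp
        then have "exp (- (\<alpha> * s / 8 * (m + 1)) - r) \<le> pathweight ?W N m x" using P0[of m] by simp
        then have "?e ^ m * exp (- (\<alpha> * s / 8 * (m + 1)) - r) \<le> ?e ^ m * pathweight ?W N m x" by (intro mult_left_mono) auto
        moreover have "?e ^ m * exp (- (\<alpha> * s / 8 * (m + 1)) - r) = exp (- (\<alpha> * s / 8) - r)"
        proof -
          have "?e ^ m = exp (m * (\<alpha> * s / 8))" by (simp only: exp_of_nat_mult)
          then show ?thesis by (simp add: exp_add[symmetric] algebra_simps)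
        qed
        ultimately show False using m0[OF m] by linarith
      qed
    qed
  qed
  then show ?thesis using \<delta>(1) by blast
qed

lemma weak_stable_line_integral:
  assumes w: "w \<in> Th"
  shows "AE x in M. aff_line a w \<inter> weak_stable T (\<lambda>x. B (lt x)) x \<subseteq> int_lattice"
proof -
  obtain \<delta> N where \<delta>: "0 < \<delta>" and leave: "\<And>a w. w \<in> Th \<Longrightarrow> 0 < line_dist a w \<Longrightarrow>
      AE x in M. \<exists>m. \<not> hit \<delta> N m x a w"
    using lines_eventually_leave by blast
  \<comment> \<open>All integer translates of images of the given line are indexed by pairs of a
    word v and a lattice point c. These are countable, so one null set serves all of them, and by
    invariance all times.\<close>
  let ?Q = "\<lambda>v c y. 0 < line_dist (wmat B v *v a - c) (wmat B v *v w) \<longrightarrow>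
     (\<exists>m. \<not> hit \<delta> N m y (wmat B v *v a - c) (wmat B v *v w))"
  have "AE y in M. ?Q v c y" for v c
  proof (cases "0 < line_dist (wmat B v *v a - c) (wmat B v *v w)")
    case True
    have "AE y in M. \<exists>m. \<not> hit \<delta> N m y (wmat B v *v a - c) (wmat B v *v w)"
      using wmat_Th[OF w] True by (intro leave) auto
    then show ?thesis by eventually_elim simp
  qed simp
  then have "AE y in M. \<forall>c\<in>int_lattice. ?Q v c y" for v
    using countable_int_lattice by (subst AE_ball_countable) auto
  then have "AE y in M. \<forall>v. \<forall>c\<in>int_lattice. ?Q v c y" by (simp only: AE_all_countable simp_thms)
  from AE_all_T_pow[OF this] Th_grow[OF w] show ?thesis
  proof eventually_elim
    fix x
    assume x1: "\<forall>n v. \<forall>c\<in>int_lattice. ?Q v c ((T ^^ n) x)"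
      and x2: "filterlim (\<lambda>n. norm (co n x *v w)) at_top sequentially"
    show "aff_line a w \<inter> weak_stable T (\<lambda>x. B (lt x)) x \<subseteq> int_lattice"
    proof
      fix z assume z: "z \<in> aff_line a w \<inter> weak_stable T (\<lambda>x. B (lt x)) x"
      then obtain t where t: "z = a + t *\<^sub>R w" by (auto simp: aff_line_def)
      have "(\<lambda>n. infdist (co n x *v z) int_lattice) \<longlonglongrightarrow> 0" using z by (simp add: weak_stable_def)
      then have "eventually (\<lambda>n. infdist (co n x *v z) int_lattice < \<delta>) sequentially"
        using \<delta> by (intro order_tendstoD)
      then obtain n0 where n0: "\<And>n. n \<ge> n0 \<Longrightarrow> infdist (co n x *v z) int_lattice < \<delta>"
        by (auto simp: eventually_sequentially)
      have ne: "int_lattice \<noteq> ({} :: (real^'p) set)" by (auto simp: int_lattice_def intro: exI[of _ 0])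
      have near: "\<exists>c\<in>int_lattice. norm (co n x *v z - c) < \<delta>" if n: "n \<ge> n0" for n
      proof -
        obtain c where "c \<in> int_lattice" "infdist (co n x *v z) int_lattice = dist (co n x *v z) c"
          using infdist_attains_inf[OF closed_int_lattice ne] by metis
        then show ?thesis using n0[OF n] by (auto simp: dist_norm)
      qed
      \<comment> \<open>At time n a lattice point c lies near the image of z. The image line
        translated by -c stays near the lattice forever, hence passes through 0; pulling c back
        gives a lattice point on L, and the expansion of w bounds its distance to z.\<close>
      have close: "\<exists>z'\<in>int_lattice. norm (z' - z) * norm (co n x *v w) \<le> \<delta> * norm w" if n: "n \<ge> n0" for n
      proof -
        let ?A = "wmat B (wd n x)"
        obtain c where c: "c \<in> int_lattice" "norm (?A *v z - c) < \<delta>" using near[OF n] by (auto simp: co_wmat)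
        have e: "?A *v a - c + t *\<^sub>R (?A *v w) = ?A *v z - c"
          by (simp add: t matrix_vector_right_distrib matrix_vector_mult_scaleR)
        have "hit \<delta> N m ((T ^^ n) x) (?A *v a - c) (?A *v w)" for m
          unfolding hit_def
        proof (intro exI[of _ t] conjI allI impI)
          show "norm (?A *v a - c + t *\<^sub>R (?A *v w)) < \<delta>" unfolding e by (rule c)
          fix k
          obtain d where d: "d \<in> int_lattice" "norm (co (n + k * N) x *v z - d) < \<delta>" using near[of "n + k * N"] n by auto
          have "norm (co (k * N) ((T ^^ n) x) *v (?A *v z - c) - (d - co (k * N) ((T ^^ n) x) *v c)) < \<delta>"
            using d(2) by (simp add: matrix_vector_mult_diff_distrib co_add co_wmat[of n])
          then show "\<exists>d\<in>int_lattice. norm (co (k * N) ((T ^^ n) x) *v (?A *v a - c + t *\<^sub>R (?A *v w)) - d) < \<delta>"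
            unfolding e using d(1) c(1) int_lattice_diff co_lattice by blast
        qed
        then have "\<not> 0 < line_dist (?A *v a - c) (?A *v w)" using x1 c(1) by blast
        then have "line_dist (?A *v a - c) (?A *v w) = 0" using line_dist_nonneg[of "?A *v a - c" "?A *v w"] by linarith
        then obtain t' where "?A *v a - c + t' *\<^sub>R (?A *v w) = 0" by (auto simp: line_dist_eq_0_iff)
        then have c': "c = ?A *v (a + t' *\<^sub>R w)"
          by (simp add: matrix_vector_right_distrib matrix_vector_mult_scaleR algebra_simps)
        have "matrix_inv ?A *v c \<in> int_lattice"
          using wmat_GL c(1) by (auto simp: GL_int_def intro: int_matrix_maps_lattice)
        moreover have "matrix_inv ?A *v c = a + t' *\<^sub>R w"
          using wmat_invertible by (simp add: c' matrix_vector_mul_assoc matrix_inv_cancel)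
        ultimately have int: "a + t' *\<^sub>R w \<in> int_lattice" by simp
        have "?A *v z - c = (t - t') *\<^sub>R (?A *v w)"
          by (simp add: c' t matrix_vector_right_distrib matrix_vector_mult_scaleR algebra_simps)
        then have "\<bar>t - t'\<bar> * norm (co n x *v w) \<le> \<delta>" using c(2) by (simp add: co_wmat)
        then have "\<bar>t - t'\<bar> * norm (co n x *v w) * norm w \<le> \<delta> * norm w" by (intro mult_right_mono) auto
        moreover have "norm (a + t' *\<^sub>R w - z) = \<bar>t - t'\<bar> * norm w"
        proof -
          have "a + t' *\<^sub>R w - z = (t' - t) *\<^sub>R w" by (simp add: t algebra_simps)
          then show ?thesis by (simp add: abs_minus_commute)
        qed
        ultimately show ?thesis using int by (intro bexI[of _ "a + t' *\<^sub>R w"]) (auto simp: ac_simps)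
      qed
      have "z \<in> closure int_lattice"
        unfolding closure_approachable
      proof (intro allI impI)
        fix e :: real assume e: "0 < e"
        have "eventually (\<lambda>n. \<delta> * norm w / e < norm (co n x *v w)) sequentially"
          using x2 by (auto simp: filterlim_at_top_dense)
        then obtain n1 where n1: "\<And>n. n \<ge> n1 \<Longrightarrow> \<delta> * norm w / e < norm (co n x *v w)"
          by (auto simp: eventually_sequentially)
        define n where "n = max n0 n1"
        obtain z' where z': "z' \<in> int_lattice" "norm (z' - z) * norm (co n x *v w) \<le> \<delta> * norm w"
          using close[of n] by (auto simp: n_def)
        have p: "0 < norm (co n x *v w)" using Th_nonzero[OF co_Th[OF w]] by simp
        have "\<delta> * norm w < e * norm (co n x *v w)" using n1[of n] e by (simp add: n_def field_simps)
        then have "norm (z' - z) * norm (co n x *v w) < e * norm (co n x *v w)" using z'(2) by linarith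
        then have "norm (z' - z) < e" using p by simp
        then show "\<exists>y\<in>int_lattice. dist y z < e" using z'(1) by (auto simp: dist_norm)
      qed
      then show "z \<in> int_lattice" by (simp add: closure_closed[OF closed_int_lattice])
    qed
  qed
qed

end

section \<open>From the partition modulo null sets to letters\<close>

lemma (in prob_space) AE_imp_ex_in:
  assumes "AE x in M. P x" "D \<in> events" "0 < prob D"
  shows "\<exists>x\<in>D. P x"
proof (rule ccontr)
  assume "\<not> ?thesis"
  then have "AE x in M. x \<notin> D" using assms(1) by (auto elim!: AE_mp)
  then have "prob D = 0" using assms(2) by (simp add: prob_eq_0)
  then show False using assms(3) by simp
qed

lemma cocycle_cong:
  assumes "\<And>n. A ((T ^^ n) x) = A' ((T ^^ n) x)"
  shows "cocycle T A n x = cocycle T A' n x"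
  using assms by (induction n) auto

theorem theorem3p1:
  fixes M :: "'a measure" and T :: "'a \<Rightarrow> 'a" and A :: "'a \<Rightarrow> real^'p^'p"
    and D :: "int \<Rightarrow> 'a set" and Al :: "int \<Rightarrow> real^'p^'p" and Th :: "(real^'p) set"
  assumes "uniform_cocycle M T A"
    and "integral_cocycle M A"
    and "locally_constant M T A D Al"
    and "adapted M T A Al Th"
    and "\<forall>J \<in> J_lines Th. AE x in M. J \<inter> central_stable T A x = {}"
  shows "\<forall>L \<in> lines_parallel Th. AE x in M. L \<inter> weak_stable T A x \<subseteq> int_lattice"
proof -
  have M: "prob_space M" "T \<in> measurable M M" "distr M M T = M" "ergodic M T"
    and A_int: "integrable M (\<lambda>x. ln (mat_norm0 (A x)))"
    using assms(1) by (auto simp: uniform_cocycle_def invariant_measure_def)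
  interpret mpt M T using M by (simp add: mpt_def mpt_axioms_def)
  have exp: "strongly_expanding M T D" and const: "\<And>l x. x \<in> D l \<Longrightarrow> x \<in> space M \<Longrightarrow> A x = Al l"
    using assms(3) by (auto simp: locally_constant_def)
  have D: "\<And>l. D l \<in> sets M" "\<And>l. 0 < prob (D l)" "\<And>l k. l \<noteq> k \<Longrightarrow> prob (D l \<inter> D k) = 0"
    "AE x in M. \<exists>l. x \<in> D l"
    using exp by (auto simp: strongly_expanding_def)
  note [measurable] = D(1)
  have "\<exists>K>0. \<forall>ls :: int list. \<forall>C \<in> sets M.
        measure M C / K \<le> measure M (word_cyl M T D ls \<inter> (T ^^ length ls) -` C) / measure M (word_cyl M T D ls)
      \<and> measure M (word_cyl M T D ls \<inter> (T ^^ length ls) -` C) / measure M (word_cyl M T D ls) \<le> K * measure M C"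
    using exp unfolding strongly_expanding_def by (elim conjE)
  then obtain K where K: "0 < K" and "\<forall>ls :: int list. \<forall>C \<in> sets M.
        measure M C / K \<le> measure M (word_cyl M T D ls \<inter> (T ^^ length ls) -` C) / measure M (word_cyl M T D ls)
      \<and> measure M (word_cyl M T D ls \<inter> (T ^^ length ls) -` C) / measure M (word_cyl M T D ls) \<le> K * measure M C"
    by (elim exE conjE)
  note Kle = this(2)[rule_format]
  \<comment> \<open>Partition elements may overlap in null sets and may miss a null set. Taking the
    first one in an enumeration labels every point measurably, in agreement with D along almost
    every orbit.\<close>
  define lt where "lt x = (from_nat (LEAST k. x \<in> D (from_nat k)) :: int)" for x
  have lt_meas: "lt \<in> measurable M (count_space UNIV)"
  proof -
    have "(\<lambda>x. LEAST k. x \<in> D (from_nat k)) \<in> measurable M (count_space UNIV)" by measurable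
    then show ?thesis unfolding lt_def by (rule measurable_compose) simp
  qed
  have lt_in: "x \<in> D (lt x)" if "x \<in> D l" for x l
    unfolding lt_def using LeastI[of "\<lambda>k. x \<in> D (from_nat k)" "to_nat l"] that by simp
  have "AE x in M. \<forall>l k. l \<noteq> k \<longrightarrow> x \<notin> D l \<inter> D k"
  proof -
    have "AE x in M. l \<noteq> k \<longrightarrow> x \<notin> D l \<inter> D k" for l k
    proof (cases "l = k")
      case False
      have "AE x in M. x \<notin> D l \<inter> D k" using D(3)[OF False] by (subst prob_eq_0[symmetric]) auto
      then show ?thesis by eventually_elim simp
    qed simp
    then show ?thesis by (simp only: AE_all_countable simp_thms)
  qed
  with D(4) have "AE x in M. \<forall>l. x \<in> D l \<longleftrightarrow> lt x = l"
  proof eventually_elim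
    fix x assume x: "\<exists>l. x \<in> D l" "\<forall>l k. l \<noteq> k \<longrightarrow> x \<notin> D l \<inter> D k"
    then have "x \<in> D (lt x)" using lt_in by blast
    then show "\<forall>l. x \<in> D l \<longleftrightarrow> lt x = l" using x(2) by blast
  qed
  then have lt_AE: "AE x in M. \<forall>n l. (T ^^ n) x \<in> D l \<longleftrightarrow> lt ((T ^^ n) x) = l" by (rule AE_all_T_pow)
  have A_AE: "AE x in M. \<forall>n. A ((T ^^ n) x) = Al (lt ((T ^^ n) x))"
    using lt_AE AE_space
  proof eventually_elim
    fix x assume "\<forall>n l. (T ^^ n) x \<in> D l \<longleftrightarrow> lt ((T ^^ n) x) = l" "x \<in> space M"
    then show "\<forall>n. A ((T ^^ n) x) = Al (lt ((T ^^ n) x))" by (auto intro!: const T_pow_space)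
  qed
  then have co_AE: "AE x in M. \<forall>n. cocycle T A n x = cocycle T (\<lambda>x. Al (lt x)) n x"
  proof eventually_elim
    fix x assume "\<forall>n. A ((T ^^ n) x) = Al (lt ((T ^^ n) x))"
    then show "\<forall>n. cocycle T A n x = cocycle T (\<lambda>x. Al (lt x)) n x"
      by (intro allI cocycle_cong) simp
  qed
  note word_meas' = word_measurable[OF lt_meas]
  have cyl_AE: "AE x in M. x \<in> word_cyl M T D u \<longleftrightarrow> x \<in> space M \<and> word T lt (length u) x = u" for u
    using lt_AE
  proof eventually_elim
    fix x assume x: "\<forall>n l. (T ^^ n) x \<in> D l \<longleftrightarrow> lt ((T ^^ n) x) = l"
    have "word T lt (length u) x = u \<longleftrightarrow> (\<forall>k<length u. lt ((T ^^ k) x) = u ! k)"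
      unfolding word_def by (subst list_eq_iff_nth_eq) auto
    then show "x \<in> word_cyl M T D u \<longleftrightarrow> x \<in> space M \<and> word T lt (length u) x = u"
      using x by (simp add: word_cyl_def)
  qed
  have cyl_sets[measurable]: "word_cyl M T D u \<in> sets M" for u
    unfolding word_cyl_def by measurable
  interpret theta_cocycle M T lt K Al Th
  proof
    show "ergodic M T" "lt \<in> measurable M (count_space UNIV)" "0 < K" by fact+
    fix u C assume C[measurable]: "C \<in> sets M"
    let ?c = "{x \<in> space M. word T lt (length u) x = u}"
    have cm[measurable]: "?c \<in> sets M" using word_meas' by measurable
    have 1: "emeasure M ?c = emeasure M (word_cyl M T D u)"
      by (rule emeasure_eq_AE) (use cyl_AE[of u] in auto)
    have s: "cy \<inter> (T ^^ length u) -` C \<in> sets M" if cy: "cy \<in> sets M" for cy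
    proof -
      have "cy \<inter> (T ^^ length u) -` C = cy \<inter> ((T ^^ length u) -` C \<inter> space M)"
        using sets.sets_into_space[OF cy] by auto
      then show ?thesis using cy by simp
    qed
    have 2: "emeasure M (?c \<inter> (T ^^ length u) -` C) = emeasure M (word_cyl M T D u \<inter> (T ^^ length u) -` C)"
      by (rule emeasure_eq_AE) (use cyl_AE[of u] s in auto)
    \<comment> \<open>A quotient by a null cylinder is 0, against the lower density bound for the
      whole space. So all cylinders have positive measure and the upper bound can be multiplied
      out.\<close>
    have "prob (space M) / K \<le> measure M (word_cyl M T D u \<inter> (T ^^ length u) -` space M) / measure M (word_cyl M T D u)"
      using Kle[of "space M" u] by simp
    then have "measure M (word_cyl M T D u) \<noteq> 0" using K by (auto simp: prob_space)
    then have pos: "0 < measure M (word_cyl M T D u)" by (simp add: zero_less_measure_iff)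
    have "measure M (word_cyl M T D u \<inter> (T ^^ length u) -` C) \<le> K * measure M C * measure M (word_cyl M T D u)"
      using Kle[OF C, of u] pos by (simp add: pos_divide_le_eq)
    then have "emeasure M (word_cyl M T D u \<inter> (T ^^ length u) -` C) \<le> ennreal (K * measure M C * measure M (word_cyl M T D u))"
      by (simp add: emeasure_eq_measure ennreal_leI)
    also have "\<dots> = ennreal K * emeasure M (word_cyl M T D u) * emeasure M C"
      using K by (simp add: emeasure_eq_measure ennreal_mult' ac_simps)
    finally show "emeasure M (?c \<inter> (T ^^ length u) -` C) \<le> ennreal K * emeasure M ?c * emeasure M C"
      unfolding 1 2 .
  next
    fix l
    \<comment> \<open>D l has positive measure, so it contains a point with the almost sure
      property, and A is constant on D l.\<close>
    have "AE x in M. GL_int (A x)" using assms(2) by (simp add: integral_cocycle_def)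
    then obtain x where "x \<in> D l" "GL_int (A x)" using AE_imp_ex_in D(1,2) by blast
    then show "GL_int (Al l)" using const sets.sets_into_space[OF D(1)] by (metis subsetD)
  next
    have "(\<lambda>x. ln (mat_norm0 (Al (lt x)))) \<in> borel_measurable M"
      by (rule measurable_compose[OF lt_meas]) simp
    moreover have "AE x in M. ln (mat_norm0 (A x)) = ln (mat_norm0 (Al (lt x)))"
      using A_AE by eventually_elim (metis funpow_0)
    ultimately show "integrable M (\<lambda>x. ln (mat_norm0 (Al (lt x))))"
      using A_int integrable_cong_AE borel_measurable_integrable by blast
  next
    show "compact_proj Th" using assms(4) by (simp add: adapted_def)
  next
    fix l w assume w: "w \<in> Th"
    show "Al l *v w \<in> Th" using assms(4) w by (simp add: adapted_def)
    have "AE x in M. norm w \<le> norm (A x *v w)"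
      using assms(4) w unfolding adapted_def by (auto elim!: AE_mp)
    then obtain x where "x \<in> D l" "norm w \<le> norm (A x *v w)" using AE_imp_ex_in D(1,2) by blast
    then show "norm w \<le> norm (Al l *v w)" using const sets.sets_into_space[OF D(1)] by (metis subsetD)
  next
    fix w assume w: "w \<in> Th"
    have "AE x in M. filterlim (\<lambda>n. norm (cocycle T A n x *v w)) at_top sequentially"
      using assms(4) w unfolding adapted_def by (auto elim!: AE_mp)
    with co_AE show "AE x in M. filterlim (\<lambda>n. norm (cocycle T (\<lambda>x. Al (lt x)) n x *v w)) at_top sequentially"
      by eventually_elim simp
  next
    fix a w assume w: "w \<in> Th" and a: "0 < line_dist a w"
    have "0 \<notin> aff_line a w"
    proof
      assume "0 \<in> aff_line a w"
      then obtain t where "a + t *\<^sub>R w = 0" unfolding aff_line_def by auto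
      then show False using a line_dist_eq_0_iff[of a w] by auto
    qed
    then have "aff_line a w \<in> J_lines Th" using w by (auto simp: J_lines_def lines_parallel_def)
    then have "AE x in M. aff_line a w \<inter> central_stable T A x = {}" using assms(5) by blast
    with co_AE show "AE x in M. aff_line a w \<inter> central_stable T (\<lambda>x. Al (lt x)) x = {}"
      by eventually_elim (simp add: central_stable_def)
  qed
  show ?thesis
  proof
    fix L assume "L \<in> lines_parallel Th"
    then obtain a w where w: "w \<in> Th" and L: "L = aff_line a w" by (auto simp: lines_parallel_def)
    show "AE x in M. L \<inter> weak_stable T A x \<subseteq> int_lattice"
      unfolding L using weak_stable_line_integral[OF w, of a] co_AE
      by eventually_elim (simp add: weak_stable_def)
  qed
qed

end
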